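(* Let $p$ be a prime, let $L$ be a field of characteristic $p$ with a fixed algebraic closure $\overline{L}$, and let $\overline{\mathbb{F}}_p$ denote the algebraic closure of $\mathbb{F}_p$ inside $\overline{L}$. Let $f(x)=c_1x^{d_1}+c_2x^{d_2}\in\overline{\mathbb{F}}_p[x]$ with $c_1,c_2\in\overline{\mathbb{F}}_p^*$, $1\le d_1<d_2$, and write $d_i=p^{\ell_i}s_i$ with integers $\ell_i\ge 0$ and $p\nmid s_i$. Assume that $$p^{\ell_2}(s_2-1)<p^{\ell_1}(s_1-1).$$ Let $\alpha,\beta\in L$. Then the set $\mathrm{Prep}(f;\alpha,\beta)$ is infinite if and only if $\alpha,\beta\in\overline{\mathbb{F}}_p$ or $f(\alpha)=f(\beta)$.
   Context: For $\lambda\in\overline{L}$ let $f_\lambda(x):=f(x)+\lambda\in\overline{L}[x]$. An element $\gamma$ is preperiodic under $f_\lambda$ if its forward orbit $\{f_\lambda^n(\gamma):n\ge 0\}$ is finite. $\mathrm{Prep}(f;\alpha,\beta)$ denotes the set of all $\lambda\in\overline{L}$ such that both $\alpha$ and $\beta$ are preperiodic under $f_\lambda$. *)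

theory Defs
  imports "HOL-Computational_Algebra.Computational_Algebra"
begin

definition is_subfield :: "'a::field set \<Rightarrow> bool" where
  "is_subfield K \<longleftrightarrow> 0 \<in> K \<and> 1 \<in> K \<and>
     (\<forall>x\<in>K. \<forall>y\<in>K. x + y \<in> K \<and> x * y \<in> K) \<and>
     (\<forall>x\<in>K. - x \<in> K \<and> inverse x \<in> K)"

definition algebraic_over :: "'a::field set \<Rightarrow> 'a \<Rightarrow> bool" where
  "algebraic_over K x \<longleftrightarrow> (\<exists>q. q \<noteq> 0 \<and> (\<forall>i. coeff q i \<in> K) \<and> poly q x = 0)"

text \<open>
  An algebraically closed type plays the role of the algebraic closure, and the base field is
  a subset of it.
\<close>
definition is_algebraic_closure_of :: "'a::alg_closed_field itself \<Rightarrow> 'a set \<Rightarrow> bool" where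
  "is_algebraic_closure_of _ K \<longleftrightarrow> is_subfield K \<and> (\<forall>x::'a. algebraic_over K x)"

text \<open>
  In characteristic \<open>p\<close>, the set \<open>\<int>\<close> (the range of \<^const>\<open>of_int\<close>) is the prime field
  with \<open>p\<close> elements. The following set is therefore its algebraic closure inside the
  ambient field; it has this meaning in positive characteristic only.
\<close>
definition Fp_bar :: "'a::field set" where
  "Fp_bar = {x. algebraic_over \<int> x}"

definition preperiodic :: "('a \<Rightarrow> 'a) \<Rightarrow> 'a \<Rightarrow> bool" where
  "preperiodic g x \<longleftrightarrow> finite {(g ^^ n) x | n. n \<ge> 0}"

definition translate_poly :: "'a::comm_ring_1 poly \<Rightarrow> 'a \<Rightarrow> 'a poly" where
  "translate_poly f \<mu> = f + [:\<mu>:]"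

definition Prep :: "'a::field poly \<Rightarrow> 'a \<Rightarrow> 'a \<Rightarrow> 'a set" where
  "Prep f \<alpha> \<beta> = {\<mu>. preperiodic (poly (translate_poly f \<mu>)) \<alpha> \<and>
                      preperiodic (poly (translate_poly f \<mu>)) \<beta>}"

end

theory Submission
  imports Defs
begin

text \<open>
  Only the direction from infinitely many common parameters to \<open>f(\<alpha>) = f(\<beta>)\<close> is hard. Assume that
  \<open>\<alpha>\<close> is transcendental over the constants and that \<open>\<delta> = f(\<alpha>) - f(\<beta>)\<close> is nonzero. At a place with
  \<open>\<bar>\<alpha>\<bar> = R > 1\<close> both orbits of a common parameter stay on the sphere of radius \<open>R\<close>, and the
  hypothesis on the numbers \<open>p ^ l\<^sub>i * (s\<^sub>i - 1)\<close> forces \<open>\<bar>\<delta>\<bar>\<close> to be either less than \<open>1\<close> or a critical power of \<open>R\<close> with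
  positive exponent. In the critical case a polynomial in the parameter built from the differences of
  the two orbits is smaller on the common parameters than its leading coefficient allows on a set of
  capacity \<open>1\<close>, so the discriminant of a large set of common parameters is very small; at all other
  places it is at least not large. Hence some \<open>u = disc\<^sup>i \<delta>\<^sup>j\<close> has absolute value less than \<open>1\<close> at every
  pole of \<open>\<alpha>\<close>, while being integral elsewhere. An element integral at all places is constant, and a
  nonzero constant has absolute value \<open>1\<close>: contradiction.
\<close>

text \<open>On the sphere of radius \<open>R\<close> the term of degree \<open>d1\<close> turns a
  difference of size \<open>t\<close> into one of size at most \<open>R ^ a * t ^ Q1\<close>, the
  term of degree \<open>d2\<close> into one of size at most \<open>R ^ b * t ^ Q2\<close>. The
  bounds break even at \<open>t ^ w = R ^ (a - b)\<close>; this is the critical size. Neither factor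
  of \<open>u\<close> suffices alone: \<delta> is small only at non-critical places, the
  discriminant only at critical ones, while elsewhere it is merely known to grow slowly. The
  logarithm of a discriminant is quadratic in the number of points, so the exponent of \<delta> is
  quadratic too, and many parameters are taken so that the linear error terms are absorbed. One
  \<open>u\<close> must serve all places. Hence the polynomial in the parameter, its degree and all
  exponents are fixed before any place is considered. Places are arbitrary valuation rings over the
  constants, of any rank. Real sizes come from comparison with powers of \<alpha> alone, and
  elements infinitely small against \<alpha> get size \<open>0\<close>. The polynomial depends on
  whether \<open>Q1 > 1\<close>, or \<open>Q1 = 1\<close> and \<open>s2 > 1\<close>, or
  \<open>Q1 = s2 = 1\<close>; in the last case no plain difference of orbits gains anything.\<close>

definition subring :: "'a::comm_ring_1 set \<Rightarrow> bool" where
  "subring S \<longleftrightarrow> 1 \<in> S \<and> (\<forall>x\<in>S. \<forall>y\<in>S. x - y \<in> S \<and> x * y \<in> S)"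

lemma subringI:
  assumes "1 \<in> S" "\<And>x y. x \<in> S \<Longrightarrow> y \<in> S \<Longrightarrow> x - y \<in> S"
    "\<And>x y. x \<in> S \<Longrightarrow> y \<in> S \<Longrightarrow> x * y \<in> S"
  shows "subring S"
  using assms by (simp add: subring_def)

context
  fixes S :: "'a::comm_ring_1 set"
  assumes S: "subring S"
begin

lemma subring_1: "1 \<in> S"
  and subring_diff: "x \<in> S \<Longrightarrow> y \<in> S \<Longrightarrow> x - y \<in> S"
  and subring_mult: "x \<in> S \<Longrightarrow> y \<in> S \<Longrightarrow> x * y \<in> S"
  using S by (auto simp: subring_def)

lemma subring_0: "0 \<in> S"
  using subring_diff[OF subring_1 subring_1] by simp

lemma subring_uminus: "x \<in> S \<Longrightarrow> - x \<in> S"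
  using subring_diff[OF subring_0] by fastforce

lemma subring_add: "x \<in> S \<Longrightarrow> y \<in> S \<Longrightarrow> x + y \<in> S"
  using subring_diff[OF _ subring_uminus] by fastforce

lemma subring_power: "x \<in> S \<Longrightarrow> x ^ n \<in> S"
  by (induction n) (auto intro: subring_1 subring_mult)

lemma subring_sum: "(\<And>i. i \<in> I \<Longrightarrow> g i \<in> S) \<Longrightarrow> sum g I \<in> S"
  by (induction I rule: infinite_finite_induct) (auto intro: subring_0 subring_add)

lemma subring_prod: "(\<And>i. i \<in> I \<Longrightarrow> g i \<in> S) \<Longrightarrow> prod g I \<in> S"
  by (induction I rule: infinite_finite_induct) (auto intro: subring_1 subring_mult)

lemma subring_of_nat: "of_nat n \<in> S"
  by (induction n) (auto intro: subring_0 subring_1 subring_add)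

lemma subring_of_int: "of_int n \<in> S"
  by (cases n) (auto intro: subring_of_nat subring_uminus subring_diff subring_1)

lemmas subring_closed = subring_0 subring_1 subring_diff subring_mult subring_uminus
  subring_add subring_power subring_sum subring_prod subring_of_nat subring_of_int

end

definition polys_over :: "'a::comm_ring_1 set \<Rightarrow> 'a poly set" where
  "polys_over S = {q. \<forall>i. coeff q i \<in> S}"

lemma subring_polys_over:
  assumes "subring S"
  shows "subring (polys_over S)"
  by (rule subringI)
    (auto simp: polys_over_def coeff_mult coeff_1 intro!: subring_closed[OF assms])

lemma monom_in_polys_over: "subring S \<Longrightarrow> c \<in> S \<Longrightarrow> monom c n \<in> polys_over S"
  by (auto simp: polys_over_def coeff_monom intro: subring_0)

lemma const_in_polys_over: "subring S \<Longrightarrow> c \<in> S \<Longrightarrow> [:c:] \<in> polys_over S"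
  using monom_in_polys_over[of S c 0] by (simp add: monom_0)

lemma smult_in_polys_over: "subring S \<Longrightarrow> c \<in> S \<Longrightarrow> q \<in> polys_over S \<Longrightarrow> smult c q \<in> polys_over S"
  by (auto simp: polys_over_def intro: subring_mult)

lemma X_in_polys_over: "subring S \<Longrightarrow> [:0, 1:] \<in> polys_over S"
  using monom_in_polys_over[of S 1 1] by (simp add: monom_altdef subring_1)

lemma lead_coeff_in: "q \<in> polys_over S \<Longrightarrow> lead_coeff q \<in> S"
  by (simp add: polys_over_def)

lemma poly_in_subring:
  assumes "subring S" "q \<in> polys_over S" "x \<in> S"
  shows "poly q x \<in> S"
  unfolding poly_altdef using assms(2,3)
  by (auto intro!: subring_closed[OF assms(1)] simp: polys_over_def)

definition adjoin :: "'a::comm_ring_1 set \<Rightarrow> 'a \<Rightarrow> 'a set" where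
  "adjoin S x = (\<lambda>q. poly q x) ` polys_over S"

lemma adjoinI: "q \<in> polys_over S \<Longrightarrow> poly q x \<in> adjoin S x"
  by (simp add: adjoin_def)

lemma subring_adjoin:
  assumes "subring S"
  shows "subring (adjoin S x)"
proof -
  note P = subring_polys_over[OF assms]
  show ?thesis
  proof (rule subringI)
    show "1 \<in> adjoin S x"
      using adjoinI[OF subring_1[OF P], of x] by simp
  next
    fix u v assume "u \<in> adjoin S x" "v \<in> adjoin S x"
    then obtain q r where qr: "q \<in> polys_over S" "r \<in> polys_over S" "u = poly q x" "v = poly r x"
      by (auto simp: adjoin_def)
    show "u - v \<in> adjoin S x"
      using adjoinI[OF subring_diff[OF P qr(1,2)], of x] qr by simp
    show "u * v \<in> adjoin S x"
      using adjoinI[OF subring_mult[OF P qr(1,2)], of x] qr by simp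
  qed
qed

lemma adjoin_superset: "subring S \<Longrightarrow> S \<subseteq> adjoin S x"
  using adjoinI[OF const_in_polys_over] by fastforce

lemma adjoin_gen: "subring S \<Longrightarrow> x \<in> adjoin S x"
  using adjoinI[OF X_in_polys_over] by fastforce


lemma power_swap: "(x ^ m) ^ n = (x :: 'a::monoid_mult) ^ (n * m)"
  by (metis mult.commute power_mult)


section \<open>The algebraic closure of the prime field\<close>

context
  fixes p :: nat
  assumes p: "prime p" and char: "CHAR('a::field) = p"
begin

lemma frob_add: "(x + y :: 'a) ^ (p ^ m) = x ^ (p ^ m) + y ^ (p ^ m)"
  using freshmans_dream'[of "p ^ m" m x y] p char by simp

lemma frob_diff: "(x - y :: 'a) ^ (p ^ m) = x ^ (p ^ m) - y ^ (p ^ m)"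
  using frob_add[of "x - y" y m] by (simp add: eq_diff_eq)

lemma frob_inj:
  assumes "(x :: 'a) ^ (p ^ m) = y ^ (p ^ m)"
  shows "x = y"
  using frob_diff[of x y m] assms by simp

lemma frob_diff_poly: "(x - y :: 'a poly) ^ (p ^ m) = x ^ (p ^ m) - y ^ (p ^ m)"
  using freshmans_dream'[of "p ^ m" m "x - y" y] p char by (simp add: eq_diff_eq)

lemma subring_frob_fixed: "subring {x::'a. x ^ (p ^ m) = x}"
  by (rule subringI) (auto simp: frob_diff power_mult_distrib)

lemma frob_fixed_iterate: "(x::'a) ^ (p ^ m) = x \<Longrightarrow> x ^ (p ^ (m * j)) = x"
  by (induction j) (auto simp: power_add power_mult)

lemma finite_frob_fixed:
  assumes "m > 0"
  shows "finite {x::'a. x ^ (p ^ m) = x}"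
proof -
  have "p ^ m > 1"
    using p assms prime_gt_1_nat one_less_power by blast
  hence "coeff (monom (1::'a) (p ^ m) - monom 1 1) (p ^ m) \<noteq> 0"
    by (simp add: coeff_monom)
  hence "monom (1::'a) (p ^ m) - monom 1 1 \<noteq> 0"
    by (metis coeff_0)
  from poly_roots_finite[OF this] show ?thesis
    by (simp add: poly_monom)
qed

text \<open>Multiplication by \<open>x\<close> preserves the finite set \<open>T\<close> of
  \<open>S\<close>-combinations of \<open>1, ..., x ^ (n - 1)\<close>, so every power of
  \<open>x\<close> lies in \<open>T\<close>. Two Frobenius powers of \<open>x\<close> therefore
  agree, and injectivity of Frobenius cancels the smaller one.\<close>

lemma root_over_finite_ring:
  fixes x :: 'a
  assumes S: "subring S" "finite S" and q: "q \<in> polys_over S" "q \<noteq> 0"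
    "inverse (lead_coeff q) \<in> S" "poly q x = 0"
  shows "\<exists>m>0. x ^ (p ^ m) = x"
proof -
  define n where "n = degree q"
  have n: "n > 0"
  proof (rule ccontr)
    assume "\<not> n > 0"
    hence "degree q = 0" by (simp add: n_def)
    then obtain c where "q = [:c:]" by (auto elim: degree_eq_zeroE)
    thus False using q(2,4) by simp
  qed
  define T where "T = (\<lambda>c. \<Sum>j<n. c j * x ^ j) ` (PiE {..<n} (\<lambda>_. S))"
  have fin: "finite T"
    unfolding T_def using S by (intro finite_imageI finite_PiE) auto
  have TI: "(\<Sum>j<n. c j * x ^ j) \<in> T" if "\<And>j. c j \<in> S" for c
  proof -
    have "(\<Sum>j<n. c j * x ^ j) = (\<Sum>j<n. restrict c {..<n} j * x ^ j)"
      by (intro sum.cong) auto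
    moreover have "restrict c {..<n} \<in> PiE {..<n} (\<lambda>_. S)"
      using that by simp
    ultimately show ?thesis unfolding T_def by (rule image_eqI)
  qed
  define e where "e j = - inverse (lead_coeff q) * coeff q j" for j
  have eS: "e j \<in> S" for j
    unfolding e_def using q by (auto simp: polys_over_def intro!: subring_closed[OF S(1)])
  have xn: "x ^ n = (\<Sum>j<n. e j * x ^ j)"
  proof -
    have "poly q x = (\<Sum>j<n. coeff q j * x ^ j) + lead_coeff q * x ^ n"
      by (simp add: poly_altdef n_def lessThan_Suc_atMost[symmetric])
    hence "lead_coeff q * x ^ n = - (\<Sum>j<n. coeff q j * x ^ j)"
      using q(4) by (metis add.commute eq_neg_iff_add_eq_0)
    hence "inverse (lead_coeff q) * (lead_coeff q * x ^ n)
        = inverse (lead_coeff q) * - (\<Sum>j<n. coeff q j * x ^ j)" by simp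
    moreover have "inverse (lead_coeff q) * (lead_coeff q * x ^ n) = x ^ n"
      using q(2) by (simp flip: mult.assoc)
    ultimately show ?thesis
      by (simp add: e_def sum_distrib_left mult.assoc sum_negf)
  qed
  have step: "x * t \<in> T" if t: "t \<in> T" for t
  proof -
    obtain c where c: "c \<in> PiE {..<n} (\<lambda>_. S)" "t = (\<Sum>j<n. c j * x ^ j)"
      using t by (auto simp: T_def)
    obtain n' where n': "n = Suc n'" using n by (cases n) auto
    have cS: "c n' \<in> S" using c n' by auto
    \<comment> \<open>The coefficients are shifted by one place; the overflowing power
      \<open>x ^ n\<close> is rewritten with \<open>xn\<close>.\<close>
    define c' where "c' j = (if j = 0 then 0 else if j < n then c (j - 1) else 0) + c n' * e j" for j
    have "x * t = (\<Sum>j<n. c j * x ^ Suc j)"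
      by (simp add: c(2) sum_distrib_left mult_ac)
    also have "\<dots> = (\<Sum>j<n'. c j * x ^ Suc j) + c n' * x ^ n"
      by (simp add: n')
    also have "(\<Sum>j<n'. c j * x ^ Suc j)
        = (\<Sum>j<n. (if j = 0 then 0 else if j < n then c (j - 1) else 0) * x ^ j)"
      unfolding n' by (subst sum.lessThan_Suc_shift) simp
    also have "c n' * x ^ n = (\<Sum>j<n. c n' * e j * x ^ j)"
      by (simp add: xn sum_distrib_left mult.assoc)
    also have "(\<Sum>j<n. (if j = 0 then 0 else if j < n then c (j - 1) else 0) * x ^ j)
        + (\<Sum>j<n. c n' * e j * x ^ j) = (\<Sum>j<n. c' j * x ^ j)"
      unfolding c'_def by (simp only: distrib_right sum.distrib)
    also have "\<dots> \<in> T"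
    proof (rule TI)
      fix j
      have "c (j - 1) \<in> S" if "j < n"
        using c(1) that by (auto simp: PiE_iff)
      hence "(if j = 0 then 0 else if j < n then c (j - 1) else 0) \<in> S"
        using subring_0[OF S(1)] by simp
      thus "c' j \<in> S"
        unfolding c'_def using eS cS by (intro subring_add[OF S(1)] subring_mult[OF S(1)])
    qed
    finally show ?thesis .
  qed
  have pow: "x ^ i \<in> T" for i
  proof (induction i)
    case 0
    have "(\<Sum>j<n. (if j = 0 then 1 else 0) * x ^ j) \<in> T"
      by (rule TI) (auto intro: subring_closed[OF S(1)])
    also have "(\<Sum>j<n. (if j = 0 then 1 else 0) * x ^ j) = (\<Sum>j<n. if j = 0 then 1 else 0)"
      by (intro sum.cong) auto
    also have "\<dots> = 1" using n by simp
    finally show ?case by simp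
  qed (use step in auto)
  have "finite (range (\<lambda>i. x ^ (p ^ i)))"
    by (rule finite_subset[OF _ fin]) (use pow in auto)
  hence "\<not> inj (\<lambda>i. x ^ (p ^ i))"
    using finite_imageD by blast
  then obtain i j where "i < j" "x ^ (p ^ i) = x ^ (p ^ j)"
    by (metis inj_def linorder_neqE_nat)
  moreover have "x ^ (p ^ j) = (x ^ (p ^ (j - i))) ^ (p ^ i)"
    using \<open>i < j\<close> by (simp flip: power_mult power_add)
  ultimately have "x ^ (p ^ (j - i)) = x"
    using frob_inj by metis
  thus ?thesis using \<open>i < j\<close> by (intro exI[of _ "j - i"]) auto
qed

lemma Fp_bar_iff: "(x::'a) \<in> Fp_bar \<longleftrightarrow> (\<exists>m>0. x ^ (p ^ m) = x)"
proof
  assume "x \<in> Fp_bar"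
  then obtain q where q: "q \<noteq> 0" "\<forall>i. coeff q i \<in> \<int>" "poly q x = 0"
    by (auto simp: Fp_bar_def algebraic_over_def)
  define S where "S = {x::'a. x ^ (p ^ 1) = x}"
  have S: "subring S" "finite S"
    unfolding S_def using subring_frob_fixed[of 1] finite_frob_fixed[of 1] by auto
  have "\<int> \<subseteq> S"
    using subring_of_int[OF S(1)] by (auto elim: Ints_cases)
  hence qS: "q \<in> polys_over S" using q by (auto simp: polys_over_def)
  have "inverse (lead_coeff q) \<in> S"
    using lead_coeff_in[OF qS] by (simp add: S_def power_inverse)
  from root_over_finite_ring[OF S qS q(1) this q(3)]
  show "\<exists>m>0. x ^ (p ^ m) = x" .
next
  assume "\<exists>m>0. x ^ (p ^ m) = x"
  then obtain m where m: "m > 0" "x ^ (p ^ m) = x" by blast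
  have "p ^ m > 1"
    using p m prime_gt_1_nat one_less_power by blast
  hence "coeff (monom (1::'a) (p ^ m) - monom 1 1) (p ^ m) \<noteq> 0"
    by (simp add: coeff_monom)
  hence "monom (1::'a) (p ^ m) - monom 1 1 \<noteq> 0"
    by (metis coeff_0)
  moreover have "poly (monom (1::'a) (p ^ m) - monom 1 1) x = 0"
    using m by (simp add: poly_monom)
  ultimately show "x \<in> Fp_bar"
    unfolding Fp_bar_def algebraic_over_def
    by (intro CollectI exI[of _ "monom 1 (p ^ m) - monom 1 1"]) (auto simp: coeff_monom)
qed

text \<open>Levels multiply: what the power \<open>p ^ m\<close> fixes is also fixed by
  \<open>p ^ (m * j)\<close>. Finitely many constants thus lie in one finite ring, which is how all
  closure properties are reached.\<close>

lemma Fp_bar_common_level: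
  assumes "finite C" "C \<subseteq> (Fp_bar :: 'a set)"
  shows "\<exists>m>0. \<forall>c\<in>C. c ^ (p ^ m) = c"
  using assms
proof (induction C)
  case (insert c C)
  then obtain m where m: "m > 0" "\<forall>c\<in>C. c ^ (p ^ m) = c" by auto
  from insert obtain j where j: "j > 0" "c ^ (p ^ j) = c"
    using Fp_bar_iff by auto
  show ?case
    using m j frob_fixed_iterate[of _ m j] frob_fixed_iterate[of c j m]
    by (intro exI[of _ "m * j"]) (auto simp: mult.commute)
qed auto

lemma subring_Fp_bar: "subring (Fp_bar :: 'a set)"
proof (rule subringI)
  show "1 \<in> (Fp_bar :: 'a set)" by (auto simp: Fp_bar_iff)
next
  fix x y :: 'a assume "x \<in> Fp_bar" "y \<in> Fp_bar"
  then obtain m where m: "m > 0" "x ^ (p ^ m) = x" "y ^ (p ^ m) = y"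
    using Fp_bar_common_level[of "{x, y}"] by auto
  show "x - y \<in> Fp_bar" "x * y \<in> Fp_bar"
    using m subring_frob_fixed[of m] by (auto simp: Fp_bar_iff subring_def)
qed

lemma Fp_bar_inverse: "(x::'a) \<in> Fp_bar \<Longrightarrow> inverse x \<in> Fp_bar"
  by (auto simp: Fp_bar_iff power_inverse)

text \<open>The coefficients lie in one finite fixed ring, which is closed under inverses, so
  \<open>root_over_finite_ring\<close> applies.\<close>

lemma Fp_bar_closed:
  fixes x :: 'a
  assumes q: "q \<in> polys_over Fp_bar" "q \<noteq> 0" "poly q x = 0"
  shows "x \<in> Fp_bar"
proof -
  obtain m where m: "m > 0" "\<forall>c\<in>coeff q ` {..degree q}. c ^ (p ^ m) = c"
    using Fp_bar_common_level[of "coeff q ` {..degree q}"] q(1) by (auto simp: polys_over_def)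
  define S where "S = {x::'a. x ^ (p ^ m) = x}"
  have S: "subring S" "finite S"
    unfolding S_def using subring_frob_fixed[of m] finite_frob_fixed[of m] m(1) by auto
  have "coeff q i \<in> S" for i
    using m(2) subring_0[OF S(1)] by (cases "i \<le> degree q") (auto simp: S_def coeff_eq_0)
  hence qS: "q \<in> polys_over S" by (simp add: polys_over_def)
  have "inverse (lead_coeff q) \<in> S"
    using lead_coeff_in[OF qS] by (simp add: S_def power_inverse)
  from root_over_finite_ring[OF S qS q(2) this q(3)] show ?thesis
    by (simp add: Fp_bar_iff)
qed

end

text \<open>Euclid's argument: a root of the product of all \<open>X - c\<close>, increased by
  \<open>1\<close>, would be a further constant.\<close>

lemma infinite_Fp_bar:
  assumes "prime p" "CHAR('a::alg_closed_field) = p"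
  shows "infinite (Fp_bar :: 'a set)"
proof
  note k = subring_Fp_bar[OF assms]
  assume fin: "finite (Fp_bar :: 'a set)"
  define q where "q = (\<Prod>c\<in>(Fp_bar :: 'a set). [:- c, 1:]) + 1"
  have "degree (\<Prod>c\<in>(Fp_bar :: 'a set). [:- c, 1:]) = card (Fp_bar :: 'a set)"
    by (subst degree_prod_eq_sum_degree) auto
  moreover have "card (Fp_bar :: 'a set) > 0"
    using fin subring_1[OF k] by (auto simp: card_gt_0_iff)
  ultimately have "degree q > 0"
    unfolding q_def by (subst degree_add_eq_left) auto
  then obtain x where x: "poly q x = 0"
    using alg_closed_imp_poly_has_root by blast
  have "[:- c, 1:] \<in> polys_over Fp_bar" if "c \<in> (Fp_bar :: 'a set)" for c
    using that subring_diff[OF subring_polys_over[OF k] X_in_polys_over[OF k]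
      const_in_polys_over[OF k that]] by simp
  hence "q \<in> polys_over Fp_bar"
    unfolding q_def by (intro subring_closed[OF subring_polys_over[OF k]])
  moreover have "q \<noteq> 0" using \<open>degree q > 0\<close> by auto
  ultimately have "x \<in> Fp_bar"
    using Fp_bar_closed[OF assms] x by blast
  hence "poly (\<Prod>c\<in>(Fp_bar :: 'a set). [:- c, 1:]) x = 0"
    using fin by (simp add: poly_prod prod_zero_iff)
  thus False using x by (simp add: q_def)
qed

section \<open>Valuation rings\<close>

definition val_ring :: "'a::field set \<Rightarrow> bool" where
  "val_ring V \<longleftrightarrow> subring V \<and> (\<forall>x. x \<in> V \<or> inverse x \<in> V)"

lemma val_ring_subring: "val_ring V \<Longrightarrow> subring V"
  and val_ring_inverse: "val_ring V \<Longrightarrow> x \<notin> V \<Longrightarrow> inverse x \<in> V"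
  by (auto simp: val_ring_def)

lemma reflect_poly_in_polys_over:
  assumes "subring S" "q \<in> polys_over S"
  shows "reflect_poly q \<in> polys_over S"
  using assms by (auto simp: polys_over_def coeff_reflect_poly subring_0)

text \<open>
  A subring that is maximal among those not containing \<open>1/s\<close> is a valuation ring: there the
  elements \<open>1 + s b\<close> are units, and relations \<open>1 = s q(x)\<close> and \<open>1 = s r(1/x)\<close> can be played
  against each other to lower their degrees.
\<close>
lemma exists_val_ring:
  fixes s :: "'a::field"
  assumes B: "subring B" "s \<in> B" "inverse s \<notin> B"
  shows "\<exists>V. val_ring V \<and> B \<subseteq> V \<and> inverse s \<notin> V"
proof -
  define \<A> where "\<A> = {C. subring C \<and> B \<subseteq> C \<and> inverse s \<notin> C}"
  have "\<exists>M\<in>\<A>. \<forall>X\<in>\<A>. M \<subseteq> X \<longrightarrow> X = M"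
  proof (rule subset_Zorn_nonempty)
    show "\<A> \<noteq> {}" using B by (auto simp: \<A>_def)
  next
    fix \<C> assume ne: "\<C> \<noteq> {}" and ch: "subset.chain \<A> \<C>"
    have sub: "\<C> \<subseteq> \<A>" and lin: "\<And>X Y. X \<in> \<C> \<Longrightarrow> Y \<in> \<C> \<Longrightarrow> X \<subseteq> Y \<or> Y \<subseteq> X"
      using ch by (auto simp: subset_chain_def)
    have "subring (\<Union>\<C>)"
    proof (rule subringI)
      show "1 \<in> \<Union>\<C>" using ne sub by (auto simp: \<A>_def subring_def)
    next
      fix x y assume "x \<in> \<Union>\<C>" "y \<in> \<Union>\<C>"
      then obtain X Y where XY: "X \<in> \<C>" "Y \<in> \<C>" "x \<in> X" "y \<in> Y" by blast
      then obtain Z where Z: "Z \<in> \<C>" "x \<in> Z" "y \<in> Z" using lin[of X Y] by blast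
      hence "subring Z" using sub by (auto simp: \<A>_def)
      thus "x - y \<in> \<Union>\<C>" "x * y \<in> \<Union>\<C>" using Z by (auto simp: subring_def)
    qed
    thus "\<Union>\<C> \<in> \<A>" using ne sub by (fastforce simp: \<A>_def)
  qed
  then obtain M where M: "M \<in> \<A>" and max: "\<And>X. X \<in> \<A> \<Longrightarrow> M \<subseteq> X \<Longrightarrow> X = M" by blast
  have R: "subring M" and BM: "B \<subseteq> M" and sM: "inverse s \<notin> M" using M by (auto simp: \<A>_def)
  have s: "s \<in> M" using B BM by blast
  have s0: "s \<noteq> 0" using sM subring_0[OF R] by auto
  note cl = subring_closed[OF R]
  have big: "inverse s \<in> adjoin M x" if "x \<notin> M" for x
  proof (rule ccontr)
    assume "inverse s \<notin> adjoin M x"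
    hence "adjoin M x \<in> \<A>"
      using subring_adjoin[OF R] adjoin_superset[OF R, of x] BM by (auto simp: \<A>_def)
    from max[OF this adjoin_superset[OF R]] show False
      using adjoin_gen[OF R, of x] that by simp
  qed
  \<comment> \<open>With \<open>z = 1 + s * b\<close>: if \<open>1/z\<close> were not in
    \<open>M\<close>, then \<open>1/s = q(1/z)\<close>. Multiplying by \<open>z ^ degree q\<close>,
    which has the form \<open>1 + s * c\<close>, puts \<open>1/s + c\<close> into
    \<open>M\<close>.\<close>
  have unit: "inverse (1 + s * b) \<in> M" if b: "b \<in> M" for b
  proof (rule ccontr)
    define z where "z = 1 + s * b"
    assume "inverse (1 + s * b) \<notin> M"
    hence nz: "inverse z \<notin> M" by (simp add: z_def)
    hence z0: "z \<noteq> 0" using subring_0[OF R] by auto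
    obtain q where q: "q \<in> polys_over M" "inverse s = poly q (inverse z)"
      using big[OF nz] by (auto simp: adjoin_def)
    have zM: "z \<in> M" unfolding z_def by (intro cl s b)
    have "\<exists>c\<in>M. z ^ n = 1 + s * c" for n
    proof (induction n)
      case 0 show ?case using cl(1) by (intro bexI[of _ 0]) auto
    next
      case (Suc n)
      then obtain c where c: "c \<in> M" "z ^ n = 1 + s * c" by blast
      have "z ^ Suc n = 1 + s * (b + c + s * (b * c))"
        using c by (simp add: z_def algebra_simps)
      moreover have "b + c + s * (b * c) \<in> M" by (intro cl s b c)
      ultimately show ?case by blast
    qed
    then obtain c where c: "c \<in> M" "z ^ degree q = 1 + s * c" by blast
    have "poly (reflect_poly q) z \<in> M"
      by (intro poly_in_subring[OF R] reflect_poly_in_polys_over[OF R] q zM)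
    hence "z ^ degree q * inverse s \<in> M"
      using q(2) by (simp add: poly_reflect_poly_nz[OF z0])
    hence "inverse s + c \<in> M" using c s0 by (simp add: algebra_simps)
    hence "inverse s + c - c \<in> M" using c cl by blast
    thus False using sM by simp
  qed
  define rel where "rel x n \<longleftrightarrow> (\<exists>q\<in>polys_over M. degree q \<le> n \<and> 1 = s * poly q x)" for x n
  have rel_ex: "\<exists>n. rel x n" if nx: "x \<notin> M" for x
  proof -
    obtain q where q: "q \<in> polys_over M" "inverse s = poly q x"
      using big[OF nx] by (auto simp: adjoin_def)
    hence "rel x (degree q)"
      unfolding rel_def by (intro bexI[of _ q]) (use s0 in \<open>auto simp flip: q(2)\<close>)
    thus ?thesis ..
  qed
  have not_unit: "1 \<noteq> s * c" if "c \<in> M" for c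
    using sM that s0 by (metis inverse_unique)
  have rel0: False if r0: "rel x 0" for x
  proof -
    obtain q where "q \<in> polys_over M" "degree q = 0" "1 = s * poly q x"
      using r0 unfolding rel_def le_0_eq by blast
    thus False using not_unit[of "coeff q 0"]
      by (auto elim!: degree_eq_zeroE simp: polys_over_def split: nat.splits)
  qed
  \<comment> \<open>Multiplied by \<open>x ^ n\<close>, the relation for \<open>1/x\<close>
    expresses \<open>x ^ n\<close> through lower powers, because \<open>1 - s * coeff r 0\<close> is
    a unit of \<open>M\<close>. Substitution removes the term of degree \<open>n\<close> from
    \<open>q\<close>.\<close>
  have step: "rel x (n - 1)" if mn: "m \<le> n" "n > 0" and x: "x \<noteq> 0"
    and r1: "rel x n" and r2: "rel (inverse x) m" for x n m
  proof -
    obtain q where q: "q \<in> polys_over M" "degree q \<le> n" "1 = s * poly q x"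
      using r1 by (auto simp: rel_def)
    obtain r where r: "r \<in> polys_over M" "degree r \<le> m" "1 = s * poly r (inverse x)"
      using r2 by (auto simp: rel_def)
    define r' where "r' = (\<Sum>j=1..m. monom (coeff r j) (n - j))"
    have r'M: "r' \<in> polys_over M"
      unfolding r'_def using r(1)
      by (intro subring_sum[OF subring_polys_over[OF R]] monom_in_polys_over[OF R])
        (auto simp: polys_over_def)
    have dr': "degree r' \<le> n - 1"
      unfolding r'_def by (intro degree_sum_le order.trans[OF degree_monom_le]) auto
    have "poly r (inverse x) = (\<Sum>j\<le>m. coeff r j * inverse x ^ j)"
      unfolding poly_altdef using r(2)
      by (intro sum.mono_neutral_left) (auto simp: coeff_eq_0)
    hence "x ^ n * poly r (inverse x) = (\<Sum>j\<le>m. coeff r j * x ^ (n - j))"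
      using mn x by (auto simp: sum_distrib_left power_diff field_simps intro!: sum.cong)
    also have "\<dots> = coeff r 0 * x ^ n + (\<Sum>j=1..m. coeff r j * x ^ (n - j))"
      by (subst sum.atMost_shift) (simp add: sum.atLeast1_atMost_eq)
    also have "(\<Sum>j=1..m. coeff r j * x ^ (n - j)) = poly r' x"
      by (simp add: r'_def poly_sum poly_monom)
    finally have eq: "x ^ n * poly r (inverse x) = coeff r 0 * x ^ n + poly r' x" .
    have "x ^ n = s * (x ^ n * poly r (inverse x))"
      using r(3) by (metis mult.left_commute mult.right_neutral)
    hence eq2: "(1 - s * coeff r 0) * x ^ n = s * poly r' x"
      unfolding eq by (simp add: algebra_simps)
    define w where "w = inverse (1 - s * coeff r 0)"
    have r0: "coeff r 0 \<in> M" using r(1) by (simp add: polys_over_def)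
    have wM: "w \<in> M" using unit[of "- coeff r 0"] r0 cl by (simp add: w_def)
    have "1 - s * coeff r 0 \<noteq> 0" using not_unit[OF r0] by auto
    hence xn: "x ^ n = poly (smult (w * s) r') x"
      using eq2 by (simp add: w_def field_simps)
    define q' where "q' = q - monom (coeff q n) n + smult (coeff q n * (w * s)) r'"
    have qn: "coeff q n \<in> M" using q(1) by (simp add: polys_over_def)
    have "q' \<in> polys_over M"
      unfolding q'_def
      by (intro subring_closed[OF subring_polys_over[OF R]] smult_in_polys_over[OF R]
        monom_in_polys_over[OF R] q(1) r'M cl qn wM s)
    moreover have "degree q' \<le> n - 1"
    proof (rule degree_le, intro allI impI)
      fix i assume i: "n - 1 < i"
      hence "coeff r' i = 0" using dr' by (intro coeff_eq_0) auto
      thus "coeff q' i = 0"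
        using i q(2) by (cases "i = n") (auto simp: q'_def coeff_monom coeff_eq_0)
    qed
    moreover have "poly q' x = poly q x"
      using xn by (simp add: q'_def poly_monom)
    ultimately show ?thesis using q(3) by (auto simp: rel_def)
  qed
  have no_rel: False if "rel x n" "rel (inverse x) m" "x \<noteq> 0" for x n m
    using that
  proof (induction "n + m" arbitrary: x n m rule: less_induct)
    case less
    have n0: "n > 0" "m > 0" using rel0 less.prems by (metis gr0I)+
    show ?case
    proof (cases "m \<le> n")
      case True
      show False
        using less.hyps[of "n - 1" m x] step[OF True n0(1) less.prems(3,1,2)] less.prems n0 by simp
    next
      case False
      hence "rel (inverse x) (m - 1)"
        using step[of n m "inverse x"] less.prems n0 by simp
      thus False using less.hyps[of n "m - 1" x] less.prems n0 by simp
    qed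
  qed
  have "x \<in> M \<or> inverse x \<in> M" for x
    using rel_ex no_rel cl(1) by (metis inverse_zero)
  hence "val_ring M" using R by (simp add: val_ring_def)
  thus ?thesis using BM sM by blast
qed

text \<open>A case of valuation rings being integrally closed:
  \<open>x = x ^ n * (1/x) ^ (n - 1)\<close>.\<close>

lemma val_ring_power:
  assumes V: "val_ring V" and n: "n > 0" "x ^ n \<in> V"
  shows "x \<in> V"
proof (rule ccontr)
  note R = val_ring_subring[OF V]
  assume "x \<notin> V"
  hence y: "inverse x \<in> V" using V by (rule val_ring_inverse[rotated])
  have x0: "x \<noteq> 0" using \<open>x \<notin> V\<close> subring_0[OF R] by auto
  have "x ^ n * inverse x ^ (n - 1) \<in> V"
    by (rule subring_mult[OF R n(2) subring_power[OF R y]])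
  also have "x ^ n * inverse x ^ (n - 1) = x"
    using n x0 by (cases n) (auto simp: power_inverse)
  finally show False using \<open>x \<notin> V\<close> by simp
qed

text \<open>A relation \<open>u = q(1/u)\<close> would make \<open>u\<close> algebraic over the
  constants. So \<open>u\<close> is outside the ring generated by \<open>1/u\<close>, and
  \<open>exists_val_ring\<close> applies with \<open>s = 1/u\<close>.\<close>

lemma val_ring_separates:
  fixes u :: "'a::field"
  assumes p: "prime p" "CHAR('a) = p" and u: "u \<notin> Fp_bar"
  shows "\<exists>V. val_ring V \<and> Fp_bar \<subseteq> V \<and> u \<notin> V"
proof -
  note k = subring_Fp_bar[OF p]
  have u0: "u \<noteq> 0" using u subring_0[OF k] by auto
  have "u \<notin> adjoin Fp_bar (inverse u)"
  proof
    assume "u \<in> adjoin Fp_bar (inverse u)"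
    then obtain q where q: "q \<in> polys_over Fp_bar" "u = poly q (inverse u)"
      by (auto simp: adjoin_def)
    define r where "r = monom 1 (Suc (degree q)) - reflect_poly q"
    have "r \<in> polys_over Fp_bar"
      unfolding r_def by (intro subring_diff[OF subring_polys_over[OF k]] monom_in_polys_over[OF k]
        reflect_poly_in_polys_over[OF k] q subring_1[OF k])
    moreover have "coeff r (Suc (degree q)) = 1"
      by (simp add: r_def coeff_monom coeff_reflect_poly)
    hence "r \<noteq> 0" by (metis coeff_0 zero_neq_one)
    moreover have "poly r u = 0"
      using q(2) by (simp add: r_def poly_monom poly_reflect_poly_nz[OF u0])
    ultimately show False using Fp_bar_closed[OF p] u by blast
  qed
  with exists_val_ring[OF subring_adjoin[OF k] adjoin_gen[OF k], of "inverse u"]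
  obtain V where "val_ring V" "adjoin Fp_bar (inverse u) \<subseteq> V" "u \<notin> V"
    by auto
  thus ?thesis using adjoin_superset[OF k] by blast
qed


section \<open>The ultrametric seminorm of a valuation ring\<close>

text \<open>\<open>N\<close> may vanish at nonzero elements and is controlled on the subring
  \<open>A\<close> only: in a valuation of higher rank, elements infinitely small or infinitely
  large against \<alpha> have no positive real size.\<close>

locale ultranorm =
  fixes A :: "'a::field set" and N :: "'a \<Rightarrow> real"
  assumes A: "subring A"
    and N_nonneg [simp]: "x \<in> A \<Longrightarrow> N x \<ge> 0"
    and N_0 [simp]: "N 0 = 0"
    and N_1 [simp]: "N 1 = 1"
    and N_mult: "x \<in> A \<Longrightarrow> y \<in> A \<Longrightarrow> N (x * y) = N x * N y"
    and N_add: "x \<in> A \<Longrightarrow> y \<in> A \<Longrightarrow> N (x + y) \<le> max (N x) (N y)"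

lemma int_ratio_between:
  assumes "x < (y::real)"
  shows "\<exists>(m::int) (n::nat). n > 0 \<and> x < m / n \<and> m / n < y"
proof -
  obtain r where r: "r \<in> \<rat>" "x < r" "r < y"
    using Rats_dense_in_real[OF assms] by blast
  then obtain m :: int and n :: nat where "r = m / n" "n \<noteq> 0"
    by (auto simp: Rats_eq_int_div_nat)
  thus ?thesis using r by (intro exI[of _ m] exI[of _ n]) auto
qed

context
  fixes V :: "'a::field set" and \<alpha> :: 'a
  assumes V: "val_ring V" and \<alpha>: "\<alpha> \<notin> V"
begin

text \<open>\<open>slopes x\<close> collects the \<open>(m, n)\<close> with \<open>\<bar>x\<bar>\<^sup>n \<le> \<bar>\<alpha>\<bar>\<^sup>m\<close>.\<close>

definition slopes :: "'a \<Rightarrow> (int \<times> nat) set" where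
  "slopes x = {(m, n). n > 0 \<and> x ^ n * inverse \<alpha> powi m \<in> V}"

text \<open>The logarithm to base \<open>2\<close> is the lower end of the slopes
  \<open>m / n\<close>, a Dedekind cut normalised so that \<alpha> has size \<open>2\<close>. Slopes
  unbounded below give size \<open>0\<close>.\<close>

definition vnorm :: "'a \<Rightarrow> real" where
  "vnorm x = Inf ((\<lambda>(m, n). 2 powr (of_int m / of_nat n)) ` slopes x)"

text \<open>These elements are bounded by some power of \<alpha>, so that they have at least one
  slope.\<close>

definition vdom :: "'a set" where
  "vdom = {x. \<exists>m. x * inverse \<alpha> ^ m \<in> V}"

lemma vsub: "subring V"
  using V by (rule val_ring_subring)

lemma inv_alpha: "inverse \<alpha> \<in> V"
  using V \<alpha> by (rule val_ring_inverse)

lemma alpha_nz: "\<alpha> \<noteq> 0" "inverse \<alpha> \<noteq> 0"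
  using \<alpha> subring_0[OF vsub] by auto

lemma inv_alpha_powi: "m \<ge> 0 \<Longrightarrow> inverse \<alpha> powi m \<in> V"
  using subring_power[OF vsub inv_alpha] by (simp add: power_int_def)

lemma inv_alpha_powi_iff: "inverse \<alpha> powi m \<in> V \<longleftrightarrow> m \<ge> 0"
proof
  assume m: "inverse \<alpha> powi m \<in> V"
  show "m \<ge> 0"
  proof (rule ccontr)
    assume "\<not> m \<ge> 0"
    hence "inverse \<alpha> powi m * inverse \<alpha> powi (-1 - m) \<in> V"
      using \<open>\<not> m \<ge> 0\<close> by (intro subring_mult[OF vsub m] inv_alpha_powi) auto
    also have "inverse \<alpha> powi m * inverse \<alpha> powi (-1 - m) = \<alpha>"
      using alpha_nz by (simp flip: power_int_add)
    finally show False using \<alpha> by simp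
  qed
qed (rule inv_alpha_powi)

text \<open>The hypothesis is \<open>m / n \<le> m' / n'\<close> cross-multiplied. It puts only an
  \<open>n\<close>-th power into \<open>V\<close>; \<open>val_ring_power\<close> then extracts the
  root.\<close>

lemma slopes_mono:
  assumes "(m, n) \<in> slopes x" "n' > 0" "m * int n' \<le> m' * int n"
  shows "(m', n') \<in> slopes x"
proof -
  have mem: "x ^ n * inverse \<alpha> powi m \<in> V" and n: "n > 0"
    using assms(1) by (auto simp: slopes_def)
  have "(x ^ n' * inverse \<alpha> powi m') ^ n
      = (x ^ n * inverse \<alpha> powi m) ^ n' * inverse \<alpha> powi (m' * int n - m * int n')"
    using alpha_nz
    by (simp add: power_mult_distrib power_int_diff power_int_mult mult_ac flip: power_mult)
  also have "\<dots> \<in> V"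
    using assms(3) by (intro subring_closed[OF vsub] inv_alpha_powi mem) auto
  finally have "x ^ n' * inverse \<alpha> powi m' \<in> V"
    by (rule val_ring_power[OF V n])
  thus ?thesis using assms(2) by (simp add: slopes_def)
qed

lemma slopes_ne: "x \<in> vdom \<Longrightarrow> slopes x \<noteq> {}"
proof -
  assume "x \<in> vdom"
  then obtain m where "x * inverse \<alpha> ^ m \<in> V" by (auto simp: vdom_def)
  hence "(int m, 1) \<in> slopes x" by (simp add: slopes_def)
  thus ?thesis by blast
qed

lemma vnorm_le: "(m, n) \<in> slopes x \<Longrightarrow> vnorm x \<le> 2 powr (of_int m / of_nat n)"
  unfolding vnorm_def by (rule cInf_lower) (auto intro!: bdd_belowI[of _ 0] image_eqI)

lemma vnorm_ge:
  assumes "x \<in> vdom" "\<And>m n. (m, n) \<in> slopes x \<Longrightarrow> c \<le> 2 powr (of_int m / of_nat n)"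
  shows "c \<le> vnorm x"
  unfolding vnorm_def using slopes_ne[OF assms(1)] assms(2) by (intro cInf_greatest) auto

lemma vnorm_lessD:
  assumes "x \<in> vdom" "vnorm x < c"
  shows "\<exists>m n. (m, n) \<in> slopes x \<and> 2 powr (of_int m / of_nat n) < c"
  using assms vnorm_ge[of x c] by (meson not_less)

lemma vnorm_nonneg: "x \<in> vdom \<Longrightarrow> vnorm x \<ge> 0"
  by (rule vnorm_ge) auto

lemma vdom_superset: "V \<subseteq> vdom"
  by (auto simp: vdom_def intro!: exI[of _ 0])

lemma subring_vdom: "subring vdom"
proof (rule subringI)
  show "1 \<in> vdom" using subring_1[OF vsub] vdom_superset by blast
next
  fix x y assume "x \<in> vdom" "y \<in> vdom"
  then obtain m n where mn: "x * inverse \<alpha> ^ m \<in> V" "y * inverse \<alpha> ^ n \<in> V"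
    by (auto simp: vdom_def)
  have "(x * inverse \<alpha> ^ m) * inverse \<alpha> ^ n - (y * inverse \<alpha> ^ n) * inverse \<alpha> ^ m \<in> V"
    by (intro subring_diff[OF vsub] subring_mult[OF vsub mn(1)] subring_mult[OF vsub mn(2)]
      subring_power[OF vsub] inv_alpha)
  also have "(x * inverse \<alpha> ^ m) * inverse \<alpha> ^ n - (y * inverse \<alpha> ^ n) * inverse \<alpha> ^ m
      = (x - y) * inverse \<alpha> ^ (m + n)"
    by (simp add: algebra_simps power_add)
  finally show "x - y \<in> vdom" unfolding vdom_def by blast
  have "(x * inverse \<alpha> ^ m) * (y * inverse \<alpha> ^ n) \<in> V"
    by (rule subring_mult[OF vsub mn])
  also have "(x * inverse \<alpha> ^ m) * (y * inverse \<alpha> ^ n) = (x * y) * inverse \<alpha> ^ (m + n)"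
    by (simp add: algebra_simps power_add)
  finally show "x * y \<in> vdom" unfolding vdom_def by blast
qed

lemma vnorm_mult_le:
  assumes x: "x \<in> vdom" and y: "y \<in> vdom"
  shows "vnorm (x * y) \<le> vnorm x * vnorm y"
proof -
  have xy: "x * y \<in> vdom" using subring_mult[OF subring_vdom x y] .
  have *: "vnorm (x * y) \<le> 2 powr (of_int m / of_nat n) * 2 powr (of_int m' / of_nat n')"
    if "(m, n) \<in> slopes x" "(m', n') \<in> slopes y" for m n m' n'
  proof -
    have n: "n > 0" "n' > 0" and mem: "x ^ n * inverse \<alpha> powi m \<in> V" "y ^ n' * inverse \<alpha> powi m' \<in> V"
      using that by (auto simp: slopes_def)
    have "(x ^ n * inverse \<alpha> powi m) ^ n' * (y ^ n' * inverse \<alpha> powi m') ^ n \<in> V"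
      by (intro subring_closed[OF vsub] mem)
    also have "(x ^ n * inverse \<alpha> powi m) ^ n' * (y ^ n' * inverse \<alpha> powi m') ^ n
        = (x * y) ^ (n * n') * inverse \<alpha> powi (m * int n' + m' * int n)"
      using alpha_nz
      by (simp add: power_mult_distrib power_int_add power_int_mult mult_ac flip: power_mult)
    finally have "(m * int n' + m' * int n, n * n') \<in> slopes (x * y)"
      using n by (simp add: slopes_def)
    hence "vnorm (x * y) \<le> 2 powr (of_int (m * int n' + m' * int n) / of_nat (n * n'))"
      by (rule vnorm_le)
    also have "of_int (m * int n' + m' * int n) / of_nat (n * n')
        = of_int m / of_nat n + (of_int m' / of_nat n' :: real)"
      using n by (simp add: field_simps)
    finally show ?thesis by (simp add: powr_add)
  qed
  have **: "vnorm (x * y) \<le> 2 powr (of_int m / of_nat n) * vnorm y" if "(m, n) \<in> slopes x" for m n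
  proof -
    have "vnorm (x * y) / 2 powr (of_int m / of_nat n) \<le> vnorm y"
      using *[OF that] by (intro vnorm_ge[OF y]) (simp add: field_simps)
    thus ?thesis by (simp add: field_simps)
  qed
  show ?thesis
  proof (cases "vnorm y = 0")
    case True
    obtain m n where "(m, n) \<in> slopes x" using slopes_ne[OF x] by auto
    from **[OF this] show ?thesis using True by simp
  next
    case False
    hence pos: "vnorm y > 0" using vnorm_nonneg[OF y] by simp
    have "vnorm (x * y) / vnorm y \<le> vnorm x"
      using ** pos by (intro vnorm_ge[OF x]) (simp add: field_simps)
    thus ?thesis using pos by (simp add: field_simps)
  qed
qed

text \<open>If this failed, a slope \<open>M / n0\<close> of \<open>x * y\<close> would be smaller
  than a sum of rationals strictly below the cuts of \<open>x\<close> and \<open>y\<close>. These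
  rationals are not slopes, so by totality of \<open>V\<close> the inverses of the corresponding
  elements are in \<open>V\<close>; combined with the slope \<open>M / n0\<close> they put a
  negative power of \<open>1/\<alpha>\<close> into \<open>V\<close>.\<close>

lemma vnorm_mult_ge:
  assumes x: "x \<in> vdom" and y: "y \<in> vdom"
  shows "vnorm x * vnorm y \<le> vnorm (x * y)"
proof (rule ccontr)
  assume "\<not> ?thesis"
  hence less: "vnorm (x * y) < vnorm x * vnorm y" by simp
  have xy: "x * y \<in> vdom" using subring_mult[OF subring_vdom x y] .
  obtain M n0 where M: "(M, n0) \<in> slopes (x * y)"
    and M2: "2 powr (of_int M / of_nat n0) < vnorm x * vnorm y"
    using vnorm_lessD[OF xy less] by blast
  have n0: "n0 > 0" using M by (simp add: slopes_def)
  have "0 < vnorm x * vnorm y" by (rule le_less_trans[OF _ M2]) simp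
  hence pos: "vnorm x > 0" "vnorm y > 0"
    using vnorm_nonneg[OF x] vnorm_nonneg[OF y] by (auto simp: zero_less_mult_iff)
  define X Y where "X = log 2 (vnorm x)" and "Y = log 2 (vnorm y)"
  have XY: "vnorm x = 2 powr X" "vnorm y = 2 powr Y" using pos by (auto simp: X_def Y_def)
  have "of_int M / of_nat n0 < X + Y"
    using M2 by (simp add: XY flip: powr_add)
  then obtain m1 :: int and n1 :: nat where 1: "n1 > 0" "of_int M / of_nat n0 - Y < m1 / n1" "m1 / n1 < X"
    using int_ratio_between[of "of_int M / of_nat n0 - Y" X] by auto
  then obtain m2 :: int and n2 :: nat where 2: "n2 > 0" "of_int M / of_nat n0 - m1 / n1 < m2 / n2" "m2 / n2 < Y"
    using int_ratio_between[of "of_int M / of_nat n0 - m1 / n1" Y] by auto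
  have "(m1, n1) \<notin> slopes x" "(m2, n2) \<notin> slopes y"
    using vnorm_le[of m1 n1 x] vnorm_le[of m2 n2 y] 1 2 by (auto simp: XY)
  hence nin: "x ^ n1 * inverse \<alpha> powi m1 \<notin> V" "y ^ n2 * inverse \<alpha> powi m2 \<notin> V"
    using 1 2 by (auto simp: slopes_def)
  hence nz: "x \<noteq> 0" "y \<noteq> 0" using subring_0[OF vsub] 1 2 by (auto simp: power_0_left)
  define z where "z = (x * y) ^ (n1 * n2) * inverse \<alpha> powi (m1 * int n2 + m2 * int n1)"
  have "inverse (x ^ n1 * inverse \<alpha> powi m1) ^ n2 * inverse (y ^ n2 * inverse \<alpha> powi m2) ^ n1 \<in> V"
    using nin by (intro subring_closed[OF vsub] val_ring_inverse[OF V])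
  also have "inverse (x ^ n1 * inverse \<alpha> powi m1) ^ n2 * inverse (y ^ n2 * inverse \<alpha> powi m2) ^ n1
      = inverse ((x ^ n1 * inverse \<alpha> powi m1) ^ n2 * (y ^ n2 * inverse \<alpha> powi m2) ^ n1)"
    by (simp only: power_inverse inverse_mult_distrib[of "(_ * _) ^ _" "(_ * _) ^ _"])
  also have "(x ^ n1 * inverse \<alpha> powi m1) ^ n2 * (y ^ n2 * inverse \<alpha> powi m2) ^ n1 = z"
    using alpha_nz unfolding z_def
    by (simp add: power_mult_distrib power_int_add power_int_mult mult_ac flip: power_mult)
  finally have zi: "inverse z \<in> V" .
  have z0: "z \<noteq> 0" using nz alpha_nz by (simp add: z_def)
  define w where "w = (x * y) ^ (n1 * n2 * n0) * inverse \<alpha> powi (M * int (n1 * n2))"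
  have "(M * int (n1 * n2), n1 * n2 * n0) \<in> slopes (x * y)"
    using M 1 2 n0 by (intro slopes_mono[OF M]) auto
  hence wV: "w \<in> V" by (simp add: slopes_def w_def)
  define g where "g = m1 * int n2 + m2 * int n1"
  define e where "e = M * int (n1 * n2) - g * int n0"
  have "z ^ n0 = (x * y) ^ (n1 * n2 * n0) * inverse \<alpha> powi (g * int n0)"
    by (simp add: z_def power_mult_distrib power_int_mult power_mult flip: g_def)
  moreover have "inverse \<alpha> powi (g * int n0) * inverse \<alpha> powi e = inverse \<alpha> powi (M * int (n1 * n2))"
    using alpha_nz by (simp add: e_def flip: power_int_add)
  ultimately have "w = z ^ n0 * inverse \<alpha> powi e"
    by (simp add: w_def mult.assoc)
  hence "inverse \<alpha> powi e = w * inverse z ^ n0"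
    using z0 by (simp add: power_inverse)
  also have "\<dots> \<in> V" by (intro subring_closed[OF vsub] wV zi)
  finally have "e \<ge> 0" by (simp add: inv_alpha_powi_iff)
  moreover have "of_int M / of_nat n0 < m1 / n1 + (m2 / n2 :: real)" using 2 by simp
  hence "of_int M * (real n1 * real n2) < (of_int m1 * real n2 + of_int m2 * real n1) * real n0"
    using 1(1) 2(1) n0 by (simp add: field_simps)
  hence "real_of_int e < 0" by (simp add: e_def g_def)
  ultimately show False by simp
qed

text \<open>One of the two elements is a multiple \<open>u = c * v\<close> of the other with
  \<open>c\<close> in \<open>V\<close>. Then \<open>u + v = (1 + c) * v\<close>, and every slope of
  \<open>v\<close> is one of \<open>u + v\<close>.\<close>

lemma vnorm_add:
  assumes x: "x \<in> vdom" and y: "y \<in> vdom"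
  shows "vnorm (x + y) \<le> max (vnorm x) (vnorm y)"
proof -
  have *: "vnorm (u + v) \<le> vnorm v" if u: "u \<in> vdom" and v: "v \<in> vdom" and c: "c \<in> V" "u = c * v" for u v c
  proof (rule vnorm_ge[OF v])
    fix m n assume mn: "(m, n) \<in> slopes v"
    hence "v ^ n * inverse \<alpha> powi m \<in> V" by (simp add: slopes_def)
    hence "(1 + c) ^ n * (v ^ n * inverse \<alpha> powi m) \<in> V"
      by (rule subring_mult[OF vsub subring_power[OF vsub subring_add[OF vsub subring_1[OF vsub] c(1)]]])
    also have "(1 + c) ^ n * (v ^ n * inverse \<alpha> powi m) = (u + v) ^ n * inverse \<alpha> powi m"
    proof -
      have "u + v = (1 + c) * v" by (simp add: c(2) algebra_simps)
      thus ?thesis by (simp only: power_mult_distrib mult.assoc)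
    qed
    finally have "(m, n) \<in> slopes (u + v)" using mn by (simp add: slopes_def)
    thus "vnorm (u + v) \<le> 2 powr (of_int m / of_nat n)" by (rule vnorm_le)
  qed
  consider "y = 0" | "x = 0" | "y \<noteq> 0" "x / y \<in> V" | "x \<noteq> 0" "y / x \<in> V"
    using val_ring_inverse[OF V, of "x / y"] by (metis inverse_divide)
  thus ?thesis
  proof cases
    case 1 thus ?thesis by simp
  next
    case 2 thus ?thesis by simp
  next
    case 3 from *[OF x y 3(2)] 3(1) show ?thesis by simp
  next
    case 4 from *[OF y x 4(2)] 4(1) show ?thesis by (simp add: add.commute)
  qed
qed

lemma alpha_in_vdom: "\<alpha> \<in> vdom"
  unfolding vdom_def using alpha_nz subring_1[OF vsub] by (auto intro!: exI[of _ 1])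

lemma vnorm_alpha: "vnorm \<alpha> = 2"
proof (rule antisym)
  have "(1, 1) \<in> slopes \<alpha>" using alpha_nz subring_1[OF vsub] by (simp add: slopes_def)
  from vnorm_le[OF this] show "vnorm \<alpha> \<le> 2" by simp
  show "2 \<le> vnorm \<alpha>"
  proof (rule vnorm_ge[OF alpha_in_vdom])
    fix m n assume mn: "(m, n) \<in> slopes \<alpha>"
    have "\<alpha> ^ n * inverse \<alpha> powi m = inverse \<alpha> powi (m - int n)"
      using alpha_nz by (simp add: power_int_diff field_simps power_inverse)
    hence "m \<ge> int n" "n > 0" using mn by (auto simp: slopes_def inv_alpha_powi_iff)
    hence "1 \<le> real_of_int m / real n" by simp
    hence "2 powr 1 \<le> 2 powr (real_of_int m / real n)" by (intro powr_mono) auto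
    thus "2 \<le> 2 powr (real_of_int m / real n)" by simp
  qed
qed

lemma vnorm_le_1: "x \<in> V \<Longrightarrow> vnorm x \<le> 1"
  using vnorm_le[of 0 1 x] by (simp add: slopes_def)

lemma vnorm_mult: "x \<in> vdom \<Longrightarrow> y \<in> vdom \<Longrightarrow> vnorm (x * y) = vnorm x * vnorm y"
  using vnorm_mult_le vnorm_mult_ge by (intro antisym)

text \<open>It matters that \<open>A\<close> is again a valuation ring: it contains \<alpha>, so
  statements about places where \<alpha> is integral apply to \<open>A\<close>, although \<alpha>
  has a pole at \<open>V\<close>.\<close>

lemma val_ring_ultranorm:
  "\<exists>A N. ultranorm A N \<and> val_ring A \<and> V \<subseteq> A \<and> \<alpha> \<in> A \<and> N \<alpha> = 2 \<and> (\<forall>x\<in>V. N x \<le> 1)"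
proof (intro exI conjI)
  show "ultranorm vdom vnorm"
  proof
    show "vnorm 1 = 1"
      using vnorm_mult[OF alpha_in_vdom subring_1[OF subring_vdom]] vnorm_alpha by simp
    show "vnorm 0 = 0"
      using vnorm_mult[OF alpha_in_vdom subring_0[OF subring_vdom]] vnorm_alpha by simp
  qed (use subring_vdom vnorm_nonneg vnorm_mult vnorm_add in auto)
  show "val_ring vdom"
    using V vdom_superset subring_vdom by (auto simp: val_ring_def)
qed (use vdom_superset alpha_in_vdom vnorm_alpha vnorm_le_1 in auto)

end

context ultranorm
begin

lemmas cl = subring_closed[OF A]

lemma N_power: "x \<in> A \<Longrightarrow> N (x ^ n) = N x ^ n"
  by (induction n) (auto simp: N_mult cl)

lemma N_minus: "x \<in> A \<Longrightarrow> N (- x) = N x"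
proof -
  assume x: "x \<in> A"
  have "N (- 1) ^ 2 = 1" using N_power[of "- 1" 2] cl by simp
  moreover have "N (- 1) \<ge> 0" by (intro N_nonneg cl)
  ultimately have "N (- 1) = 1" by (auto simp: power2_eq_1_iff)
  thus ?thesis using N_mult[of "- 1" x] x cl by simp
qed

lemma N_diff: "x \<in> A \<Longrightarrow> y \<in> A \<Longrightarrow> N (x - y) \<le> max (N x) (N y)"
  using N_add[of x "- y"] N_minus[of y] cl by simp

lemma N_add_le: "x \<in> A \<Longrightarrow> y \<in> A \<Longrightarrow> N x \<le> c \<Longrightarrow> N y \<le> c \<Longrightarrow> N (x + y) \<le> c"
  and N_diff_le: "x \<in> A \<Longrightarrow> y \<in> A \<Longrightarrow> N x \<le> c \<Longrightarrow> N y \<le> c \<Longrightarrow> N (x - y) \<le> c"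
  using N_add[of x y] N_diff[of x y] by auto

lemma N_add_eq:
  assumes "x \<in> A" "y \<in> A" "N x < N y"
  shows "N (x + y) = N y"
proof (rule antisym)
  show "N (x + y) \<le> N y" using assms by (intro N_add_le) auto
  have "N y \<le> max (N (x + y)) (N x)"
    using N_diff[of "x + y" x] assms cl by simp
  thus "N y \<le> N (x + y)" using assms(3) by auto
qed

lemma N_add_eq': "x \<in> A \<Longrightarrow> y \<in> A \<Longrightarrow> N y < N x \<Longrightarrow> N (x + y) = N x"
  using N_add_eq[of y x] by (simp add: add.commute)

lemma N_sum_le:
  assumes "\<And>i. i \<in> I \<Longrightarrow> g i \<in> A" "\<And>i. i \<in> I \<Longrightarrow> N (g i) \<le> c" "c \<ge> 0"
  shows "N (sum g I) \<le> c"
  using assms by (induction I rule: infinite_finite_induct) (auto intro!: N_add_le cl)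

lemma N_sum_less:
  assumes "\<And>i. i \<in> I \<Longrightarrow> g i \<in> A" "\<And>i. i \<in> I \<Longrightarrow> N (g i) < c" "c > 0"
  shows "N (sum g I) < c"
  using assms
proof (induction I rule: infinite_finite_induct)
  case (insert i I)
  have "N (g i + sum g I) \<le> max (N (g i)) (N (sum g I))"
    using insert by (intro N_add cl) auto
  also have "\<dots> < c" using insert by simp
  finally show ?case using insert by simp
qed auto

lemma N_prod:
  assumes "\<And>i. i \<in> I \<Longrightarrow> g i \<in> A"
  shows "N (prod g I) = (\<Prod>i\<in>I. N (g i))"
  using assms by (induction I rule: infinite_finite_induct) (auto simp: N_mult cl)

end


section \<open>Discriminants of finite sets\<close>

text \<open>The left side is a divided difference: interpolation at \<open>n + 1\<close> points is
  exact up to degree \<open>n\<close>, and the coefficients of degree \<open>n\<close> are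
  compared.\<close>

lemma lagrange_coeff:
  fixes q :: "'a::field poly"
  assumes E: "finite E" "card E = Suc n" and q: "degree q \<le> n"
  shows "(\<Sum>x\<in>E. poly q x / (\<Prod>y\<in>E - {x}. x - y)) = coeff q n"
proof -
  define w where "w x = (\<Prod>y\<in>E - {x}. x - y)" for x
  define l where "l x = (\<Prod>y\<in>E - {x}. [:- y, 1:])" for x
  define r where "r = (\<Sum>x\<in>E. smult (poly q x / w x) (l x))"
  have w: "w x \<noteq> 0" for x using E by (auto simp: w_def)
  have deg: "degree (l x) = n" if "x \<in> E" for x
    unfolding l_def using E that by (subst degree_prod_eq_sum_degree) auto
  have lead: "coeff (l x) n = 1" if "x \<in> E" for x
  proof -
    have "lead_coeff (l x) = 1" unfolding l_def by (subst lead_coeff_prod) auto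
    thus ?thesis using deg[OF that] by simp
  qed
  have poly_l: "poly (l x) z = (if z = x then w x else 0)" if "x \<in> E" "z \<in> E" for x z
    using E that by (auto simp: l_def w_def poly_prod)
  have "degree r \<le> n"
    unfolding r_def using E deg by (intro degree_sum_le order.trans[OF degree_smult_le]) auto
  moreover have "poly q z = poly r z" if "z \<in> E" for z
  proof -
    have "poly r z = (\<Sum>x\<in>E. if x = z then poly q z else 0)"
      unfolding r_def poly_sum using that w by (intro sum.cong) (auto simp: poly_l)
    thus ?thesis using E that by simp
  qed
  ultimately have "q = r"
    using E q by (intro poly_eqI_degree[of E]) auto
  hence "coeff q n = (\<Sum>x\<in>E. poly q x / w x * coeff (l x) n)"
    by (metis (no_types, lifting) r_def coeff_sum coeff_smult sum.cong)
  also have "\<dots> = (\<Sum>x\<in>E. poly q x / w x)"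
    using lead by simp
  finally show ?thesis by (simp add: w_def)
qed

text \<open>Over ordered pairs, hence up to sign the square of the Vandermonde product; this
  accounts for the squares in the bounds below.\<close>

definition discr :: "'a::field set \<Rightarrow> 'a" where
  "discr E = (\<Prod>x\<in>E. \<Prod>y\<in>E - {x}. x - y)"

lemma discr_nz: "finite E \<Longrightarrow> discr E \<noteq> 0"
  by (auto simp: discr_def)

lemma discr_in_subring: "subring S \<Longrightarrow> E \<subseteq> S \<Longrightarrow> discr E \<in> S"
  unfolding discr_def by (intro subring_prod subring_diff) auto

lemma discr_insert:
  assumes "finite E" "x \<notin> E"
  shows "discr (insert x E) = (\<Prod>y\<in>E. x - y) * (\<Prod>y\<in>E. y - x) * discr E"
proof -
  have "(\<Prod>z\<in>E. \<Prod>y\<in>insert x E - {z}. z - y) = (\<Prod>z\<in>E. (z - x) * (\<Prod>y\<in>E - {z}. z - y))"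
  proof (rule prod.cong[OF refl])
    fix z assume "z \<in> E"
    hence "insert x E - {z} = insert x (E - {z})" using assms by auto
    thus "(\<Prod>y\<in>insert x E - {z}. z - y) = (z - x) * (\<Prod>y\<in>E - {z}. z - y)"
      using assms by simp
  qed
  moreover have "insert x E - {x} = E" using assms by auto
  ultimately show ?thesis
    using assms by (simp add: discr_def prod.distrib mult.assoc)
qed

context ultranorm
begin

lemma N_discr_remove:
  assumes "finite E" "E \<subseteq> A" "x \<in> E"
  shows "N (discr E) = N (\<Prod>y\<in>E - {x}. x - y) ^ 2 * N (discr (E - {x}))"
proof -
  have E: "E = insert x (E - {x})" using assms by auto
  have mem: "x - y \<in> A" "y - x \<in> A" if "y \<in> E" for y
    using that assms by (auto intro: cl)
  have "N (y - x) = N (x - y)" if "y \<in> E" for y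
    using N_minus[OF mem(1)[OF that]] by simp
  moreover have "N (\<Prod>y\<in>E - {x}. y - x) = (\<Prod>y\<in>E - {x}. N (y - x))"
    "N (\<Prod>y\<in>E - {x}. x - y) = (\<Prod>y\<in>E - {x}. N (x - y))"
    using mem by (auto intro!: N_prod)
  ultimately have "N (\<Prod>y\<in>E - {x}. y - x) = N (\<Prod>y\<in>E - {x}. x - y)"
    by simp
  moreover have "discr E = (\<Prod>y\<in>E - {x}. x - y) * (\<Prod>y\<in>E - {x}. y - x) * discr (E - {x})"
    using discr_insert[of "E - {x}" x] assms E by simp
  moreover have "(\<Prod>y\<in>E - {x}. x - y) \<in> A" "(\<Prod>y\<in>E - {x}. y - x) \<in> A"
    using mem by (auto intro!: cl(9))
  moreover have "discr (E - {x}) \<in> A" using assms by (intro discr_in_subring A) auto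
  ultimately show ?thesis by (simp add: N_mult cl power2_eq_square)
qed

text \<open>By the ultrametric inequality some term of the sum in \<open>lagrange_coeff\<close> is
  at least as large as the sum itself.\<close>

lemma exists_close_point:
  assumes E: "finite E" "E \<subseteq> A" "card E = Suc n" and q: "q \<in> polys_over A" "degree q \<le> n"
    and c: "\<And>x. x \<in> E \<Longrightarrow> N (poly q x) \<le> c"
  shows "\<exists>x\<in>E. N (coeff q n) * N (\<Prod>y\<in>E - {x}. x - y) \<le> c"
proof (rule ccontr)
  define w where "w x = (\<Prod>y\<in>E - {x}. x - y)" for x
  assume "\<not> ?thesis"
  hence big: "N (coeff q n) * N (w x) > c" if "x \<in> E" for x
    using that by (auto simp: w_def)
  have wA: "w x \<in> A" if "x \<in> E" for x
    unfolding w_def using E that by (intro cl) auto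
  have w0: "w x \<noteq> 0" for x using E by (auto simp: w_def)
  have qA: "coeff q n \<in> A" "\<And>x. x \<in> E \<Longrightarrow> poly q x \<in> A"
    using q E poly_in_subring[OF A q(1)] by (auto simp: polys_over_def)
  have cpos: "c \<ge> 0"
  proof -
    obtain x where "x \<in> E" using E by fastforce
    thus ?thesis using c[of x] N_nonneg[OF qA(2)[of x]] by linarith
  qed
  have pos: "N (coeff q n) > 0" "\<And>x. x \<in> E \<Longrightarrow> N (w x) > 0"
  proof -
    show "N (w x) > 0" if "x \<in> E" for x
      using big[OF that] cpos N_nonneg[OF wA[OF that]] by (metis less_eq_real_def mult_zero_right not_less)
    obtain x where "x \<in> E" using E by fastforce
    thus "N (coeff q n) > 0"
      using big[of x] cpos N_nonneg[OF qA(1)] by (metis less_eq_real_def mult_zero_left not_less)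
  qed
  \<comment> \<open>Denominators are cleared because the quotients by \<open>w x\<close> may leave
    \<open>A\<close>, where \<open>N\<close> is not controlled.\<close>
  have "coeff q n * (\<Prod>x\<in>E. w x) = (\<Sum>x\<in>E. poly q x / w x) * (\<Prod>x\<in>E. w x)"
    using lagrange_coeff[OF E(1,3) q(2)] by (simp add: w_def)
  also have "\<dots> = (\<Sum>x\<in>E. poly q x * (\<Prod>z\<in>E - {x}. w z))"
    unfolding sum_distrib_right
  proof (rule sum.cong[OF refl])
    fix x assume "x \<in> E"
    hence "(\<Prod>x\<in>E. w x) = w x * (\<Prod>z\<in>E - {x}. w z)"
      using E by (simp add: prod.remove)
    thus "poly q x / w x * (\<Prod>x\<in>E. w x) = poly q x * (\<Prod>z\<in>E - {x}. w z)"
      using w0 by simp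
  qed
  finally have eq: "coeff q n * (\<Prod>x\<in>E. w x) = (\<Sum>x\<in>E. poly q x * (\<Prod>z\<in>E - {x}. w z))" .
  have "N (\<Sum>x\<in>E. poly q x * (\<Prod>z\<in>E - {x}. w z)) < N (coeff q n) * (\<Prod>x\<in>E. N (w x))"
  proof (rule N_sum_less)
    show "0 < N (coeff q n) * (\<Prod>x\<in>E. N (w x))"
      using pos by (intro mult_pos_pos prod_pos) auto
  next
    fix x assume x: "x \<in> E"
    have pA: "(\<Prod>z\<in>E - {x}. w z) \<in> A" using wA by (intro cl) auto
    show "poly q x * (\<Prod>z\<in>E - {x}. w z) \<in> A" using x qA pA by (intro cl(4)) auto
    have "N (poly q x * (\<Prod>z\<in>E - {x}. w z)) = N (poly q x) * (\<Prod>z\<in>E - {x}. N (w z))"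
    proof -
      have "N (\<Prod>z\<in>E - {x}. w z) = (\<Prod>z\<in>E - {x}. N (w z))"
        using wA by (intro N_prod) auto
      thus ?thesis using x qA pA by (simp add: N_mult)
    qed
    also have "\<dots> < N (coeff q n) * N (w x) * (\<Prod>z\<in>E - {x}. N (w z))"
      using c[OF x] big[OF x] pos by (intro mult_strict_right_mono prod_pos) auto
    also have "\<dots> = N (coeff q n) * (\<Prod>x\<in>E. N (w x))"
      using E x by (simp add: prod.remove mult.assoc)
    finally show "N (poly q x * (\<Prod>z\<in>E - {x}. w z)) < N (coeff q n) * (\<Prod>x\<in>E. N (w x))" .
  qed
  also have "\<dots> = N (coeff q n * (\<Prod>x\<in>E. w x))"
    using qA wA by (simp add: N_mult N_prod cl)
  finally show False using eq by simp
qed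

text \<open>
  A polynomial that is small on \<open>E\<close> compared to its leading coefficient witnesses that \<open>E\<close> lies in
  a set of small capacity.
\<close>
lemma N_discr_le:
  assumes E: "finite E" "E \<subseteq> A" and F: "F \<in> polys_over A" "degree F = m" "m > 0"
    and lead: "N (lead_coeff F) > 0"
    and \<theta>: "\<theta> \<ge> 0" "\<And>x. x \<in> E \<Longrightarrow> N (poly F x) \<le> \<theta> * N (lead_coeff F)"
    and \<rho>: "\<rho> \<ge> 0" "\<And>x. x \<in> E \<Longrightarrow> N x \<le> \<rho>"
  shows "N (discr E) \<le> (\<Prod>j<card E. \<theta> ^ (j div m) * \<rho> ^ (j mod m)) ^ 2"
  using E \<theta>(2) \<rho>(2)
proof (induction "card E" arbitrary: E)
  case 0
  thus ?case by (simp add: discr_def)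
next
  case (Suc n)
  \<comment> \<open>A polynomial of degree exactly \<open>n\<close>, as interpolation at
    \<open>n + 1\<close> points requires, containing as many small factors \<open>F\<close> as
    fit.\<close>
  define q where "q = F ^ (n div m) * monom 1 (n mod m)"
  have qA: "q \<in> polys_over A"
    unfolding q_def by (intro subring_closed[OF subring_polys_over[OF A]] F monom_in_polys_over A cl)
  have F0: "F \<noteq> 0" using lead by auto
  have dq: "degree q = n"
    using F F0 by (simp add: q_def degree_mult_eq degree_power_eq degree_monom_eq)
  have lq: "coeff q n = lead_coeff F ^ (n div m)"
  proof -
    have "lead_coeff q = lead_coeff F ^ (n div m)"
      by (simp add: q_def lead_coeff_mult lead_coeff_power degree_monom_eq)
    thus ?thesis by (simp add: dq)
  qed
  have FA: "poly F x \<in> A" if "x \<in> E" for x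
    using that Suc.prems by (intro poly_in_subring[OF A F(1)]) auto
  define L where "L = N (lead_coeff F) ^ (n div m)"
  have L: "L > 0" using lead by (simp add: L_def)
  have NL: "N (coeff q n) = L"
    using lead_coeff_in[OF F(1)] by (simp add: lq L_def N_power)
  have bound: "N (poly q x) \<le> L * (\<theta> ^ (n div m) * \<rho> ^ (n mod m))" if x: "x \<in> E" for x
  proof -
    have xA: "x \<in> A" using x Suc.prems by auto
    have "N (poly q x) = N (poly F x) ^ (n div m) * N x ^ (n mod m)"
      using FA[OF x] xA by (simp add: q_def poly_monom N_mult N_power cl)
    also have "\<dots> \<le> (\<theta> * N (lead_coeff F)) ^ (n div m) * \<rho> ^ (n mod m)"
      using Suc.prems x xA FA[OF x] \<theta>(1) \<rho>(1) lead
      by (intro mult_mono power_mono) auto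
    finally show ?thesis by (simp add: L_def power_mult_distrib mult_ac)
  qed
  obtain x where x: "x \<in> E" "L * N (\<Prod>y\<in>E - {x}. x - y) \<le> L * (\<theta> ^ (n div m) * \<rho> ^ (n mod m))"
    using exists_close_point[OF Suc.prems(1,2) Suc.hyps(2)[symmetric] qA _ bound] dq NL by auto
  define W where "W = (\<Prod>y\<in>E - {x}. x - y)"
  have W: "N W \<le> \<theta> ^ (n div m) * \<rho> ^ (n mod m)"
    using x L by (simp add: W_def)
  have WA: "W \<in> A" unfolding W_def using Suc.prems x by (intro cl) auto
  have IH: "N (discr (E - {x})) \<le> (\<Prod>j<n. \<theta> ^ (j div m) * \<rho> ^ (j mod m)) ^ 2"
  proof -
    have cn: "card (E - {x}) = n" using Suc.hyps(2) x by simp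
    have "N (discr (E - {x})) \<le> (\<Prod>j<card (E - {x}). \<theta> ^ (j div m) * \<rho> ^ (j mod m)) ^ 2"
      using Suc.prems cn by (intro Suc.hyps(1)) auto
    thus ?thesis by (simp only: cn)
  qed
  have "N (discr E) = N W ^ 2 * N (discr (E - {x}))"
    using N_discr_remove[OF Suc.prems(1,2) x(1)] by (simp add: W_def)
  also have "\<dots> \<le> (\<theta> ^ (n div m) * \<rho> ^ (n mod m)) ^ 2 * (\<Prod>j<n. \<theta> ^ (j div m) * \<rho> ^ (j mod m)) ^ 2"
    using W IH N_nonneg[OF WA] Suc.prems
    by (intro mult_mono power_mono) (auto intro!: N_nonneg discr_in_subring A)
  also have "\<dots> = (\<Prod>j<card E. \<theta> ^ (j div m) * \<rho> ^ (j mod m)) ^ 2"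
    by (simp add: Suc.hyps(2)[symmetric] power_mult_distrib mult.commute)
  finally show ?case .
qed

end

section \<open>The family at a place where \<open>\<alpha>\<close> has a pole\<close>

definition orb :: "'a::comm_ring_1 poly \<Rightarrow> 'a \<Rightarrow> 'a \<Rightarrow> nat \<Rightarrow> 'a" where
  "orb f \<mu> z n = (poly (translate_poly f \<mu>) ^^ n) z"

lemma orb_0 [simp]: "orb f \<mu> z 0 = z"
  and orb_Suc [simp]: "orb f \<mu> z (Suc n) = poly f (orb f \<mu> z n) + \<mu>"
  by (simp_all add: orb_def translate_poly_def)

lemma preperiodic_iff_orb: "preperiodic (poly (translate_poly f \<mu>)) z \<longleftrightarrow> finite (range (orb f \<mu> z))"
  by (simp add: preperiodic_def orb_def full_SetCompr_eq)

primrec param_orb :: "'a::comm_ring_1 poly \<Rightarrow> 'a \<Rightarrow> nat \<Rightarrow> 'a poly" where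
  "param_orb f z 0 = [:z:]"
| "param_orb f z (Suc n) = pcompose f (param_orb f z n) + [:0, 1:]"

lemma poly_param_orb: "poly (param_orb f z n) \<mu> = orb f \<mu> z n"
  by (induction n) (auto simp: poly_pcompose)

text \<open>In the factorisation by \<open>P - S\<close> the cofactor has \<open>s\<close> summands
  with the same degree and the same leading coefficient. They add up to \<open>s\<close> times it,
  which is nonzero because \<open>s\<close> is invertible.\<close>

lemma power_diff_bracket:
  fixes P S :: "'a::idom poly"
  assumes "degree P = D" "degree S = D" "lead_coeff P = c" "lead_coeff S = c"
    and "c \<noteq> 0" "of_nat s \<noteq> (0::'a)"
  shows "P ^ s - S ^ s = 0 \<longleftrightarrow> P - S = 0"
    and "degree (P ^ s - S ^ s) = (if P - S = 0 then 0 else (s - 1) * D + degree (P - S))"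
    and "lead_coeff (P ^ s - S ^ s) = of_nat s * c ^ (s - 1) * lead_coeff (P - S)"
proof -
  define T where "T = (\<Sum>i<s. S ^ (s - Suc i) * P ^ i)"
  have "P ^ s - S ^ s = (P - S) * T"
    unfolding T_def by (rule power_diff_sumr2)
  have PS: "P \<noteq> 0" "S \<noteq> 0" using assms by auto
  have deg1: "degree (S ^ (s - Suc i) * P ^ i) = (s - 1) * D"
    and lc1: "lead_coeff (S ^ (s - Suc i) * P ^ i) = c ^ (s - 1)" if "i < s" for i
  proof -
    have "degree (S ^ (s - Suc i) * P ^ i) = (s - Suc i + i) * D"
      using PS assms by (simp add: degree_mult_eq degree_power_eq distrib_right)
    thus "degree (S ^ (s - Suc i) * P ^ i) = (s - 1) * D" using that by simp
    have "lead_coeff (S ^ (s - Suc i) * P ^ i) = c ^ (s - Suc i + i)"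
      using assms by (simp only: lead_coeff_mult lead_coeff_power power_add)
    thus "lead_coeff (S ^ (s - Suc i) * P ^ i) = c ^ (s - 1)" using that by simp
  qed
  have degT: "degree T \<le> (s - 1) * D"
    unfolding T_def using deg1 by (intro degree_sum_le) auto
  have "coeff T ((s - 1) * D) = (\<Sum>i<s. c ^ (s - 1))"
    unfolding T_def coeff_sum
  proof (rule sum.cong[OF refl])
    fix i assume "i \<in> {..<s}"
    thus "coeff (S ^ (s - Suc i) * P ^ i) ((s - 1) * D) = c ^ (s - 1)"
      using deg1[of i] lc1[of i] by simp
  qed
  hence cT: "coeff T ((s - 1) * D) = of_nat s * c ^ (s - 1)" by simp
  hence nz: "coeff T ((s - 1) * D) \<noteq> 0" using assms by simp
  hence T0: "T \<noteq> 0" by auto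
  have dT: "degree T = (s - 1) * D"
    by (rule antisym[OF degT le_degree[OF nz]])
  show "P ^ s - S ^ s = 0 \<longleftrightarrow> P - S = 0"
    using T0 \<open>P ^ s - S ^ s = (P - S) * T\<close> by simp
  show "degree (P ^ s - S ^ s) = (if P - S = 0 then 0 else (s - 1) * D + degree (P - S))"
    using T0 \<open>P ^ s - S ^ s = (P - S) * T\<close> dT by (simp add: degree_mult_eq)
  show "lead_coeff (P ^ s - S ^ s) = of_nat s * c ^ (s - 1) * lead_coeff (P - S)"
    unfolding \<open>P ^ s - S ^ s = (P - S) * T\<close> lead_coeff_mult dT cT by simp
qed

lemma degree_lead_coeff_add_cases:
  fixes U W :: "'a::comm_ring_1 poly"
  shows "degree W < degree U \<Longrightarrow> degree (U + W) = degree U \<and> lead_coeff (U + W) = lead_coeff U"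
    and "degree U < degree W \<Longrightarrow> degree (U + W) = degree W \<and> lead_coeff (U + W) = lead_coeff W"
    and "degree U = degree W \<Longrightarrow> lead_coeff U + lead_coeff W \<noteq> 0 \<Longrightarrow>
      degree (U + W) = degree W \<and> lead_coeff (U + W) = lead_coeff U + lead_coeff W"
proof -
  show "degree W < degree U \<Longrightarrow> degree (U + W) = degree U \<and> lead_coeff (U + W) = lead_coeff U"
    by (simp add: degree_add_eq_left coeff_eq_0)
  show "degree U < degree W \<Longrightarrow> degree (U + W) = degree W \<and> lead_coeff (U + W) = lead_coeff W"
    by (simp add: degree_add_eq_right coeff_eq_0)
  assume eq: "degree U = degree W" and nz: "lead_coeff U + lead_coeff W \<noteq> 0"
  have "degree (U + W) = degree W"
  proof (rule antisym)
    show "degree (U + W) \<le> degree W" using eq by (intro degree_add_le) auto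
    show "degree W \<le> degree (U + W)" using nz eq by (intro le_degree) auto
  qed
  thus "degree (U + W) = degree W \<and> lead_coeff (U + W) = lead_coeff U + lead_coeff W"
    using eq by simp
qed

text \<open>\<open>Q1\<close> and \<open>Q2\<close> are the inseparable degrees of the two
  monomials. \<open>a\<close> and \<open>b\<close> are the powers of \<open>R\<close> by which they
  stretch differences on the sphere of radius \<open>R\<close>, and \<open>w\<close> is the gap
  between the powers of the difference itself.\<close>

locale family =
  fixes p l1 l2 s1 s2 :: nat and c1 c2 :: "'a::field" and f :: "'a poly"
    and Q1 Q2 d1 d2 a b w :: nat
  assumes p: "prime p" and char: "CHAR('a) = p"
    and c_nz: "c1 \<noteq> 0" "c2 \<noteq> 0"
    and s_unit: "\<not> p dvd s1" "\<not> p dvd s2"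
    and Q_def: "Q1 = p ^ l1" "Q2 = p ^ l2"
    and d_def: "d1 = Q1 * s1" "d2 = Q2 * s2"
    and ab_def: "a = Q1 * (s1 - 1)" "b = Q2 * (s2 - 1)"
    and w_def: "w = Q2 - Q1"
    and d_less: "d1 < d2" and b_less_a: "b < a"
    and f_def: "f = monom c1 d1 + monom c2 d2"
begin

lemma s_pos: "s1 > 0" "s2 > 0"
  using s_unit by (auto intro: gr0I)

lemma Q_pos: "Q1 > 0" "Q2 > 0"
  using p by (auto simp: Q_def prime_gt_0_nat)

lemma s_of_nat: "of_nat s1 \<noteq> (0::'a)" "of_nat s2 \<noteq> (0::'a)"
  using s_unit char by (auto simp: of_nat_eq_0_iff_char_dvd)

lemma d_eq: "d1 = a + Q1" "d2 = b + Q2"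
  using s_pos by (auto simp: d_def ab_def algebra_simps)

lemma Q_less: "Q1 < Q2"
  using d_eq d_less b_less_a by simp

text \<open>\<open>a - b < w\<close> is \<open>d1 < d2\<close> rewritten. It puts the break-even
  size strictly below \<open>R\<close>.\<close>

lemma Q2_eq: "Q2 = Q1 + w" and w_pos: "w > 0" and ab_less_w: "a - b < w" and a_pos: "a > 0"
  using Q_less d_eq d_less b_less_a by (auto simp: w_def)

lemma d2_gt_1: "d2 > 1"
  using d_less Q_pos a_pos by (simp add: d_eq)

lemma poly_f: "poly f z = c1 * z ^ d1 + c2 * z ^ d2"
  by (simp add: f_def poly_monom)

lemma f_diff: "poly f x - poly f y = c1 * (x ^ s1 - y ^ s1) ^ Q1 + c2 * (x ^ s2 - y ^ s2) ^ Q2"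
  unfolding Q_def frob_diff[OF p char] poly_f d_def
  by (simp only: power_swap) (simp add: algebra_simps)

lemma pcompose_f: "pcompose f P = smult c1 (P ^ d1) + smult c2 (P ^ d2)"
proof -
  have "pcompose (monom c n) P = smult c (P ^ n)" for c :: 'a and n
    by (induction n) (auto simp: monom_Suc pcompose_pCons monom_0)
  thus ?thesis by (simp add: f_def pcompose_add)
qed

lemma pcompose_f_diff:
  "pcompose f P - pcompose f S = smult c1 ((P ^ s1 - S ^ s1) ^ Q1) + smult c2 ((P ^ s2 - S ^ s2) ^ Q2)"
  unfolding Q_def frob_diff_poly[OF p char] pcompose_f d_def
  by (simp only: power_swap) (simp add: smult_diff_right)

text \<open>The leading term does not depend on \<open>z\<close>. So
  \<open>power_diff_bracket\<close> applies to the orbits of \<alpha> and \<beta>, and at every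
  place the leading coefficient has size \<open>1\<close>.\<close>

lemma param_orb_degree:
  "degree (param_orb f z (Suc n)) = d2 ^ n"
  "lead_coeff (param_orb f z (Suc n)) = c2 ^ (\<Sum>i<n. d2 ^ i)"
proof -
  have "degree (param_orb f z (Suc n)) = d2 ^ n \<and>
    lead_coeff (param_orb f z (Suc n)) = c2 ^ (\<Sum>i<n. d2 ^ i)"
  proof (induction n)
    case 0
    have "pcompose f [:z:] = [:poly f z:]"
      by (simp add: pcompose_f poly_f poly_const_pow)
    thus ?case by simp
  next
    case (Suc n)
    define P where "P = param_orb f z (Suc n)"
    have P: "degree P = d2 ^ n" "lead_coeff P = c2 ^ (\<Sum>i<n. d2 ^ i)"
      using Suc by (auto simp: P_def)
    have P0: "P \<noteq> 0" using P c_nz by auto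
    define U W where "U = smult c1 (P ^ d1)" and "W = smult c2 (P ^ d2)"
    have 1: "degree U = d1 * d2 ^ n" "degree W = d2 ^ Suc n"
      using P(1) P0 c_nz by (simp_all add: U_def W_def degree_power_eq)
    have lW: "lead_coeff W = c2 * lead_coeff P ^ d2"
      unfolding W_def by (simp only: lead_coeff_smult lead_coeff_power)
    have "d1 * d2 ^ n < d2 ^ Suc n" using d_less d2_gt_1 by simp
    hence "degree U < degree W" by (simp only: 1)
    hence 2: "degree (pcompose f P) = d2 ^ Suc n"
      "lead_coeff (pcompose f P) = c2 * lead_coeff P ^ d2"
      using degree_lead_coeff_add_cases(2)[of U W] 1 lW
      unfolding pcompose_f U_def[symmetric] W_def[symmetric] by metis+
    have "degree [:0, 1::'a:] < d2 ^ Suc n"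
      using d2_gt_1 one_less_power[of d2 "Suc n"] by simp
    hence 3: "degree (pcompose f P + [:0, 1:]) = d2 ^ Suc n"
      "lead_coeff (pcompose f P + [:0, 1:]) = c2 * lead_coeff P ^ d2"
      using 2 degree_lead_coeff_add_cases(1)[of "[:0, 1:]" "pcompose f P"] by metis+
    have "(\<Sum>i<Suc n. d2 ^ i) = Suc (d2 * (\<Sum>i<n. d2 ^ i))"
      by (simp only: sum.lessThan_Suc_shift power_0 power_Suc sum_distrib_left plus_1_eq_Suc)
    hence "c2 ^ (\<Sum>i<Suc n. d2 ^ i) = c2 * (c2 ^ (\<Sum>i<n. d2 ^ i)) ^ d2"
      by (simp only: power_swap power_Suc)
    thus ?case using 3 unfolding P(2) by (simp only: P_def param_orb.simps simp_thms)
  qed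
  thus "degree (param_orb f z (Suc n)) = d2 ^ n"
    "lead_coeff (param_orb f z (Suc n)) = c2 ^ (\<Sum>i<n. d2 ^ i)" by auto
qed

lemma param_orb_in:
  assumes S: "subring S" and "c1 \<in> S" "c2 \<in> S" "z \<in> S"
  shows "param_orb f z n \<in> polys_over S"
proof (induction n)
  case 0 show ?case using const_in_polys_over[OF S assms(4)] by simp
next
  case (Suc n)
  note P = subring_polys_over[OF S]
  show ?case
    unfolding param_orb.simps pcompose_f
    by (intro subring_add[OF P] smult_in_polys_over[OF S] subring_power[OF P] Suc X_in_polys_over[OF S] assms)
qed

text \<open>
  At a critical place, where \<open>R ^ (a - b) \<le> N \<delta> ^ w\<close>, leading terms cannot cancel, and \<open>ediff n\<close> is the
  degree of \<open>pdiff \<alpha> \<beta> n\<close>.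
\<close>

primrec ediff :: "nat \<Rightarrow> nat" where
  "ediff 0 = 0"
| "ediff (Suc n) = max (a * d2 ^ n + Q1 * ediff n) (b * d2 ^ n + Q2 * ediff n)"

definition pdiff :: "'a \<Rightarrow> 'a \<Rightarrow> nat \<Rightarrow> 'a poly" where
  "pdiff \<alpha> \<beta> n = param_orb f \<alpha> (Suc n) - param_orb f \<beta> (Suc n)"

text \<open>
  In the separable additive case the second difference, divided by the first, has its residue in a
  finite field at a critical place, so that this polynomial becomes small.
\<close>

definition additive_witness :: "'a \<Rightarrow> 'a \<Rightarrow> 'a poly" where
  "additive_witness \<alpha> \<beta> =
    pdiff \<alpha> \<beta> 1 ^ Q2 - smult ((poly f \<alpha> - poly f \<beta>) ^ w) (pdiff \<alpha> \<beta> 1)"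

lemma ediff_Suc_pos: "ediff (Suc n) > 0"
proof -
  have "0 < a * d2 ^ n" using a_pos d2_gt_1 by simp
  thus ?thesis unfolding ediff.simps by linarith
qed

text \<open>If the term of degree \<open>d\<^sub>1\<close> always dominated, the degrees would grow too fast.\<close>

lemma ediff_second_term_wins:
  assumes "Q1 = 1" "b > 0"
  shows "\<exists>n. a * d2 ^ n + Q1 * ediff n \<le> b * d2 ^ n + Q2 * ediff n"
proof (rule ccontr)
  assume "\<not> ?thesis"
  hence less: "b * d2 ^ n + Q2 * ediff n < a * d2 ^ n + ediff n" for n
    using assms(1) by (simp add: not_le)
  hence rec: "ediff (Suc n) = a * d2 ^ n + ediff n" for n
  proof -
    have "ediff (Suc n) = a * d2 ^ n + Q1 * ediff n"
      unfolding ediff.simps using less[of n] assms(1) by (intro max_absorb1) simp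
    thus ?thesis unfolding assms(1) by simp
  qed
  have e: "int (ediff n) * (int d2 - 1) = int a * (int d2 ^ n - 1)" for n
  proof (induction n)
    case (Suc n)
    have "int (ediff (Suc n)) * (int d2 - 1) = int a * int d2 ^ n * (int d2 - 1) + int (ediff n) * (int d2 - 1)"
      unfolding rec by (simp add: algebra_simps)
    thus ?case unfolding Suc by (simp add: algebra_simps)
  qed simp
  \<comment> \<open>For this \<open>n\<close> the inequality derived below,
    \<open>d2 ^ n < a * (Q2 - 1)\<close>, contradicts \<open>n < d2 ^ n\<close>.\<close>
  define n where "n = a * Q2"
  have "int b * int d2 ^ n + int Q2 * int (ediff n) < int a * int d2 ^ n + int (ediff n)"
    using less[of n] by (metis of_nat_add of_nat_less_iff of_nat_mult of_nat_power)
  hence "(int Q2 - 1) * int (ediff n) < (int a - int b) * int d2 ^ n"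
    by (simp add: algebra_simps)
  moreover have "int d2 - 1 > 0" using d2_gt_1 by simp
  ultimately have "((int Q2 - 1) * int (ediff n)) * (int d2 - 1) < ((int a - int b) * int d2 ^ n) * (int d2 - 1)"
    by (rule mult_strict_right_mono)
  hence "(int Q2 - 1) * (int a * (int d2 ^ n - 1)) < (int a - int b) * int d2 ^ n * (int d2 - 1)"
    by (simp only: mult.assoc e)
  also have "(int a - int b) * int d2 ^ n * (int d2 - 1) =
      int a * (int Q2 - 1) * int d2 ^ n - int b * (int d2 - int d1) * int d2 ^ n"
    using assms(1) by (simp add: d_eq algebra_simps)
  finally have *: "int b * (int d2 - int d1) * int d2 ^ n < int a * (int Q2 - 1)"
    by (simp add: algebra_simps)
  have "1 * int d2 ^ n \<le> int b * (int d2 - int d1) * int d2 ^ n"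
    using assms(2) d_less by (intro mult_right_mono) (auto simp: int_one_le_iff_zero_less)
  hence "int d2 ^ n < int a * (int Q2 - 1)" using * by simp
  also have "\<dots> \<le> int n" by (simp add: n_def algebra_simps)
  finally have "d2 ^ n < n" by (simp flip: of_nat_power)
  moreover have "n < d2 ^ n" using d2_gt_1 by (intro power_gt_expt) simp
  ultimately show False by simp
qed

end

section \<open>Sizes of orbits and of their differences at a single place\<close>

locale place = family p l1 l2 s1 s2 c1 c2 f Q1 Q2 d1 d2 a b w + ultranorm A N
  for p l1 l2 s1 s2 :: nat and c1 c2 :: "'a::field" and f :: "'a poly"
    and Q1 Q2 d1 d2 a b w :: nat and A :: "'a set" and N :: "'a \<Rightarrow> real" +
  fixes \<alpha> \<beta> :: 'a and R :: real
  assumes c_in: "c1 \<in> A" "c2 \<in> A" and N_c: "N c1 = 1" "N c2 = 1"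
    and N_s: "N (of_nat s1) = 1" "N (of_nat s2) = 1"
    and \<alpha>_in: "\<alpha> \<in> A" and \<beta>_in: "\<beta> \<in> A" and R_def: "N \<alpha> = R" and R_gt_1: "R > 1"
begin

lemma f_in: "z \<in> A \<Longrightarrow> poly f z \<in> A"
  unfolding poly_f using c_in by (intro cl(4,6,7))

lemma orb_in: "z \<in> A \<Longrightarrow> \<mu> \<in> A \<Longrightarrow> orb f \<mu> z n \<in> A"
  by (induction n) (auto intro!: cl(6) f_in)

lemma N_poly_f:
  assumes "z \<in> A" "N z > 1"
  shows "N (poly f z) = N z ^ d2"
proof -
  have eq: "N (c1 * z ^ d1) = N z ^ d1" "N (c2 * z ^ d2) = N z ^ d2"
    using assms c_in N_c by (auto simp: N_mult N_power cl(7))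
  have "N z ^ d1 < N z ^ d2"
    using assms(2) d_less by simp
  hence "N (c1 * z ^ d1 + c2 * z ^ d2) = N (c2 * z ^ d2)"
    using c_in assms eq by (intro N_add_eq cl(4,7)) auto
  thus ?thesis by (simp add: poly_f eq)
qed

lemma N_poly_f_le_1:
  assumes "z \<in> A" "N z \<le> 1"
  shows "N (poly f z) \<le> 1"
proof -
  have "N (c1 * z ^ d1) \<le> 1" "N (c2 * z ^ d2) \<le> 1"
    using assms c_in N_c by (auto simp: N_mult N_power cl(7) intro!: power_le_one)
  thus ?thesis unfolding poly_f using c_in assms by (intro N_add_le cl(4,7)) auto
qed

text \<open>Take a point of maximal norm: its image is as bounded, so the parameter must cancel \<open>f\<close> there.\<close>

lemma preperiodic_norm:
  assumes z: "z \<in> A" and \<mu>: "\<mu> \<in> A" and fin: "finite (range (orb f \<mu> z))"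
    and big: "N (orb f \<mu> z m) > 1"
  shows "N (orb f \<mu> z n) = N (orb f \<mu> z m)" "N \<mu> = N (orb f \<mu> z m) ^ d2"
proof -
  let ?o = "orb f \<mu> z"
  define \<rho> where "\<rho> = Max (N ` range ?o)"
  have fin': "finite (N ` range ?o)" using fin by simp
  have le: "N (?o n) \<le> \<rho>" for n
    unfolding \<rho>_def by (intro Max_ge fin') auto
  have "\<rho> \<in> N ` range ?o" unfolding \<rho>_def by (intro Max_in fin') auto
  then obtain k where k: "\<rho> = N (?o k)" by auto
  have \<rho>: "\<rho> > 1" using le[of m] big by simp
  have mem: "?o n \<in> A" for n using orb_in z \<mu> by blast
  have pow: "\<rho> < \<rho> ^ d2"
    using \<rho> d2_gt_1 power_strict_increasing[of 1 d2 \<rho>] by simp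
  have fk: "N (poly f (?o k)) = \<rho> ^ d2"
    using N_poly_f[OF mem[of k]] \<rho> by (simp add: k)
  have step: "N \<mu> = N (poly f (?o n))" if "\<rho> < N (poly f (?o n)) \<or> \<rho> < N \<mu>" for n
  proof -
    have 1: "N (poly f (?o n) + \<mu>) \<le> \<rho>" using le[of "Suc n"] by simp
    show ?thesis
    proof (cases "N (poly f (?o n))" "N \<mu>" rule: linorder_cases)
      case less
      from N_add_eq[OF f_in[OF mem] \<mu> this] 1 that less show ?thesis by simp
    next
      case greater
      from N_add_eq'[OF f_in[OF mem] \<mu> this] 1 that greater show ?thesis by simp
    qed simp
  qed
  have N\<mu>: "N \<mu> = \<rho> ^ d2" using step[of k] fk pow by simp
  have all: "N (?o n) = \<rho>" for n
  proof -
    have fn: "N (poly f (?o n)) = \<rho> ^ d2" using step[of n] N\<mu> pow by simp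
    have "N (?o n) > 1"
    proof (rule ccontr)
      assume "\<not> N (?o n) > 1"
      hence "N (poly f (?o n)) \<le> 1" using N_poly_f_le_1[OF mem] by simp
      thus False using fn pow \<rho> by simp
    qed
    hence "N (?o n) ^ d2 = \<rho> ^ d2" using N_poly_f[OF mem] fn by simp
    thus ?thesis
      using \<rho> \<open>N (?o n) > 1\<close> d2_gt_1 by (simp add: power_eq_iff_eq_base)
  qed
  show "N (?o n) = N (?o m)" "N \<mu> = N (?o m) ^ d2" using all N\<mu> by simp_all
qed

definition common :: "'a \<Rightarrow> bool" where
  "common \<mu> \<longleftrightarrow> \<mu> \<in> A \<and> finite (range (orb f \<mu> \<alpha>)) \<and> finite (range (orb f \<mu> \<beta>))"

text \<open>The orbit of \<alpha> starts outside the unit disc and fixes the size of the parameter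
  as \<open>R ^ d2\<close>. The orbit of \<beta> cannot stay in the unit disc, since adding such a
  parameter leaves it; the parameter then determines its radius, too.\<close>

lemma common_orbits:
  assumes "common \<mu>"
  shows "N \<mu> = R ^ d2" "N (orb f \<mu> \<alpha> n) = R" "N (orb f \<mu> \<beta> n) = R"
proof -
  have \<mu>: "\<mu> \<in> A" and fin: "finite (range (orb f \<mu> \<alpha>))" "finite (range (orb f \<mu> \<beta>))"
    using assms by (auto simp: common_def)
  have *: "N (orb f \<mu> \<alpha> n) = R \<and> N \<mu> = R ^ d2" for n
    using preperiodic_norm[OF \<alpha>_in \<mu> fin(1), of 0] R_gt_1 R_def by simp
  show "N \<mu> = R ^ d2" "N (orb f \<mu> \<alpha> n) = R" using * by auto
  have R2: "R ^ d2 > 1" using R_gt_1 d2_gt_1 by (intro one_less_power) auto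
  have "\<exists>m. N (orb f \<mu> \<beta> m) > 1"
  proof (rule ccontr)
    assume "\<not> ?thesis"
    hence le: "N (orb f \<mu> \<beta> m) \<le> 1" for m by (simp add: not_less)
    have "N (poly f \<beta>) \<le> 1" using le[of 0] N_poly_f_le_1[OF \<beta>_in] by simp
    hence "N (poly f \<beta> + \<mu>) = N \<mu>" using * R2 \<mu> by (intro N_add_eq f_in \<beta>_in) auto
    thus False using le[of 1] * R2 by simp
  qed
  then obtain m where m: "N (orb f \<mu> \<beta> m) > 1" ..
  note q = preperiodic_norm[OF \<beta>_in \<mu> fin(2) m]
  have "N (orb f \<mu> \<beta> m) ^ d2 = R ^ d2" using q(2) * by simp
  hence "N (orb f \<mu> \<beta> m) = R"
    using m R_gt_1 d2_gt_1 by (simp add: power_eq_iff_eq_base)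
  thus "N (orb f \<mu> \<beta> n) = R" using q(1) by simp
qed

text \<open>The quotient of \<open>x ^ s - y ^ s\<close> by \<open>x - y\<close>, written so that it
  stays in \<open>A\<close> and makes sense for \<open>x = y\<close>.\<close>

definition bracket :: "nat \<Rightarrow> 'a \<Rightarrow> 'a \<Rightarrow> 'a" where
  "bracket s x y = (\<Sum>i<s. y ^ (s - Suc i) * x ^ i)"

lemma bracket_eq: "x ^ s - y ^ s = (x - y) * bracket s x y"
  unfolding bracket_def by (rule power_diff_sumr2)

lemma bracket_in: "x \<in> A \<Longrightarrow> y \<in> A \<Longrightarrow> bracket s x y \<in> A"
  unfolding bracket_def by (intro cl(4,7,8)) auto

lemma N_bracket_le:
  assumes "x \<in> A" "y \<in> A" "N x = R" "N y = R"
  shows "N (bracket s x y) \<le> R ^ (s - 1)"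
  unfolding bracket_def
proof (rule N_sum_le)
  fix i assume i: "i \<in> {..<s}"
  show "y ^ (s - Suc i) * x ^ i \<in> A" using assms by (intro cl(4,7)) auto
  have "N (y ^ (s - Suc i) * x ^ i) = R ^ (s - Suc i + i)"
    using assms by (simp add: N_mult N_power cl(7) power_add)
  also have "s - Suc i + i = s - 1" using i by auto
  finally show "N (y ^ (s - Suc i) * x ^ i) \<le> R ^ (s - 1)" by simp
qed (use R_gt_1 in auto)

lemma N_power_diff_le:
  assumes "x \<in> A" "y \<in> A" "N x = R" "N y = R"
  shows "N (x ^ s - y ^ s) \<le> R ^ (s - 1) * N (x - y)"
proof -
  have "N (x ^ s - y ^ s) = N (x - y) * N (bracket s x y)"
    unfolding bracket_eq using assms by (intro N_mult cl bracket_in)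
  also have "\<dots> \<le> N (x - y) * R ^ (s - 1)"
    using assms by (intro mult_left_mono N_bracket_le N_nonneg cl)
  finally show ?thesis by (simp add: mult.commute)
qed

text \<open>For \<open>x\<close> near \<open>y\<close> the bracket is dominated by its diagonal
  value, the derivative \<open>s * x ^ (s - 1)\<close>, and \<open>s\<close> has size
  \<open>1\<close>.\<close>

lemma N_power_diff_eq:
  assumes xy: "x \<in> A" "y \<in> A" "N x = R" "N y = R" and near: "N (x - y) < R"
    and s: "s > 0" "N (of_nat s) = 1"
  shows "N (x ^ s - y ^ s) = R ^ (s - 1) * N (x - y)"
proof -
  have "bracket s x y = of_nat s * x ^ (s - 1) - (\<Sum>i<s. (x ^ (s - Suc i) - y ^ (s - Suc i)) * x ^ i)"
  proof -
    have "(\<Sum>i<s. x ^ (s - Suc i) * x ^ i) = (\<Sum>i<s. x ^ (s - 1))"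
      by (intro sum.cong refl) (simp flip: power_add)
    thus ?thesis
      by (simp add: bracket_def left_diff_distrib sum_subtractf)
  qed
  moreover have "N (\<Sum>i<s. (x ^ (s - Suc i) - y ^ (s - Suc i)) * x ^ i) < R ^ (s - 1)"
  proof (rule N_sum_less)
    fix i assume i: "i \<in> {..<s}"
    show "(x ^ (s - Suc i) - y ^ (s - Suc i)) * x ^ i \<in> A"
      using xy by (intro cl(3,4,7)) auto
    have eq: "N ((x ^ (s - Suc i) - y ^ (s - Suc i)) * x ^ i) = N (x ^ (s - Suc i) - y ^ (s - Suc i)) * R ^ i"
      using xy by (simp add: N_mult N_power cl(3,7))
    show "N ((x ^ (s - Suc i) - y ^ (s - Suc i)) * x ^ i) < R ^ (s - 1)"
    proof (cases "s - Suc i")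
      case 0
      thus ?thesis using R_gt_1 by simp
    next
      case (Suc j)
      have "N (x ^ Suc j - y ^ Suc j) \<le> R ^ j * N (x - y)"
        using N_power_diff_le[OF xy, of "Suc j"] by simp
      also have "\<dots> < R ^ j * R" using near R_gt_1 by simp
      finally have "N (x ^ Suc j - y ^ Suc j) * R ^ i < R ^ j * R * R ^ i"
        using R_gt_1 by simp
      also have "R ^ j * R * R ^ i = R ^ (Suc j + i)" by (simp add: power_add)
      also have "Suc j + i = s - 1" using Suc by simp
      finally show ?thesis unfolding eq unfolding Suc .
    qed
  qed (use R_gt_1 in auto)
  moreover have "N (of_nat s * x ^ (s - 1)) = R ^ (s - 1)"
    using xy s by (simp add: N_mult N_power cl)
  ultimately have "N (bracket s x y) = R ^ (s - 1)"
    using N_add_eq'[of "of_nat s * x ^ (s - 1)"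
      "- (\<Sum>i<s. (x ^ (s - Suc i) - y ^ (s - Suc i)) * x ^ i)"] xy
      N_minus[of "\<Sum>i<s. (x ^ (s - Suc i) - y ^ (s - Suc i)) * x ^ i"]
    by (simp add: cl)
  thus ?thesis
    unfolding bracket_eq using xy by (simp add: N_mult cl bracket_in mult.commute)
qed

lemma N_terms_le:
  assumes "x \<in> A" "y \<in> A" "N x = R" "N y = R"
  shows "N (c1 * (x ^ s1 - y ^ s1) ^ Q1) \<le> R ^ a * N (x - y) ^ Q1"
    "N (c2 * (x ^ s2 - y ^ s2) ^ Q2) \<le> R ^ b * N (x - y) ^ Q2"
proof -
  have mem: "x ^ n - y ^ n \<in> A" for n using assms by (intro cl)
  have *: "N (x ^ s - y ^ s) ^ Q \<le> R ^ (Q * (s - 1)) * N (x - y) ^ Q" for s Q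
  proof -
    have "N (x ^ s - y ^ s) ^ Q \<le> (R ^ (s - 1) * N (x - y)) ^ Q"
      using N_power_diff_le[OF assms] mem by (intro power_mono) auto
    thus ?thesis by (simp add: power_mult_distrib power_swap)
  qed
  show "N (c1 * (x ^ s1 - y ^ s1) ^ Q1) \<le> R ^ a * N (x - y) ^ Q1"
    "N (c2 * (x ^ s2 - y ^ s2) ^ Q2) \<le> R ^ b * N (x - y) ^ Q2"
    using * mem c_in N_c by (simp_all add: N_mult N_power cl(7) ab_def)
qed

lemma near_if_small:
  assumes "N x ^ w < R ^ (a - b)"
  shows "N x < R"
proof (rule ccontr)
  assume "\<not> N x < R"
  hence "R ^ w \<le> N x ^ w" using R_gt_1 by (intro power_mono) auto
  moreover have "R ^ (a - b) < R ^ w" using R_gt_1 ab_less_w by simp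
  ultimately show False using assms by simp
qed

text \<open>Below the break-even size the term of degree \<open>d1\<close> strictly dominates, and
  \<open>near_if_small\<close> makes its size exact. The case of size \<open>0\<close> is separate
  because the domination is then not strict.\<close>

lemma N_f_diff_small:
  assumes xy: "x \<in> A" "y \<in> A" "N x = R" "N y = R" and small: "N (x - y) ^ w < R ^ (a - b)"
  shows "N (poly f x - poly f y) = R ^ a * N (x - y) ^ Q1"
proof (cases "N (x - y) = 0")
  case True
  have mem: "c1 * (x ^ s1 - y ^ s1) ^ Q1 \<in> A" "c2 * (x ^ s2 - y ^ s2) ^ Q2 \<in> A"
    using xy c_in by (intro cl(3,4,7); simp)+
  have "N (poly f x - poly f y) \<le> 0"
    unfolding f_diff using N_terms_le[OF xy] True Q_pos mem by (intro N_add_le) (auto simp: power_0_left)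
  moreover have "N (poly f x - poly f y) \<ge> 0" using xy by (intro N_nonneg cl f_in)
  ultimately show ?thesis using True Q_pos by (simp add: power_0_left)
next
  case False
  hence pos: "N (x - y) > 0" using N_nonneg[of "x - y"] xy cl(3) by fastforce
  have mem: "c1 * (x ^ s1 - y ^ s1) ^ Q1 \<in> A" "c2 * (x ^ s2 - y ^ s2) ^ Q2 \<in> A"
    using xy c_in by (intro cl(3,4,7); simp)+
  have 1: "N (c1 * (x ^ s1 - y ^ s1) ^ Q1) = R ^ a * N (x - y) ^ Q1"
    using N_power_diff_eq[OF xy near_if_small[OF small] s_pos(1) N_s(1)] xy c_in N_c
    by (simp add: N_mult N_power cl(3,7) power_mult_distrib power_swap ab_def)
  have "R ^ b * N (x - y) ^ Q2 = R ^ b * N (x - y) ^ Q1 * N (x - y) ^ w"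
    by (simp add: Q2_eq power_add)
  also have "\<dots> < R ^ b * N (x - y) ^ Q1 * R ^ (a - b)"
    using small pos R_gt_1 by simp
  also have "\<dots> = R ^ a * N (x - y) ^ Q1"
    using b_less_a by (simp add: mult_ac flip: power_add)
  finally have "N (c2 * (x ^ s2 - y ^ s2) ^ Q2) < R ^ a * N (x - y) ^ Q1"
    using N_terms_le(2)[OF xy] by simp
  thus ?thesis
    unfolding f_diff using 1 mem by (subst N_add_eq') auto
qed

text \<open>For \<open>s2 = 1\<close> the term of degree \<open>d2\<close> is additive, so its
  contribution is known exactly even when \<open>x\<close> and \<open>y\<close> are far
  apart.\<close>

lemma N_f_diff_large:
  assumes xy: "x \<in> A" "y \<in> A" "N x = R" "N y = R" and large: "R ^ a < N (x - y) ^ w" and s2: "s2 = 1"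
  shows "N (poly f x - poly f y) = N (x - y) ^ Q2"
proof -
  have mem: "c1 * (x ^ s1 - y ^ s1) ^ Q1 \<in> A" "c2 * (x ^ s2 - y ^ s2) ^ Q2 \<in> A"
    using xy c_in by (intro cl(3,4,7); simp)+
  have pos: "N (x - y) > 0"
  proof (rule ccontr)
    assume "\<not> N (x - y) > 0"
    hence "N (x - y) = 0" using N_nonneg[of "x - y"] xy cl(3) by fastforce
    thus False using large w_pos R_gt_1 by (auto simp: power_0_left)
  qed
  have 2: "N (c2 * (x ^ s2 - y ^ s2) ^ Q2) = N (x - y) ^ Q2"
    using xy c_in N_c by (simp add: s2 N_mult N_power cl(3,7))
  have "R ^ a * N (x - y) ^ Q1 < N (x - y) ^ w * N (x - y) ^ Q1"
    using large pos by simp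
  also have "\<dots> = N (x - y) ^ Q2" by (simp add: Q2_eq power_add mult.commute)
  finally have "N (c1 * (x ^ s1 - y ^ s1) ^ Q1) < N (x - y) ^ Q2"
    using N_terms_le(1)[OF xy] by simp
  thus ?thesis
    unfolding f_diff using 2 mem by (subst N_add_eq) auto
qed

definition dif :: "'a \<Rightarrow> nat \<Rightarrow> 'a" where
  "dif \<mu> n = orb f \<mu> \<alpha> n - orb f \<mu> \<beta> n"

abbreviation \<delta> :: 'a where
  "\<delta> \<equiv> poly f \<alpha> - poly f \<beta>"

lemma dif_1: "dif \<mu> (Suc 0) = \<delta>"
  by (simp add: dif_def)

lemma dif_Suc: "dif \<mu> (Suc n) = poly f (orb f \<mu> \<alpha> n) - poly f (orb f \<mu> \<beta> n)"
  by (simp add: dif_def)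

context
  fixes \<mu>
  assumes \<mu>: "common \<mu>"
begin

lemma orb_mem: "orb f \<mu> \<alpha> n \<in> A" "orb f \<mu> \<beta> n \<in> A"
  using \<mu> orb_in \<alpha>_in \<beta>_in by (auto simp: common_def)

lemmas orb_pair = orb_mem common_orbits(2,3)[OF \<mu>]

lemma dif_in: "dif \<mu> n \<in> A"
  unfolding dif_def using orb_mem by (intro cl)

lemma N_dif_le: "N (dif \<mu> n) \<le> R"
  unfolding dif_def using orb_pair by (intro N_diff_le) auto

lemma dif_step_small: "N (dif \<mu> n) ^ w < R ^ (a - b) \<Longrightarrow> N (dif \<mu> (Suc n)) = R ^ a * N (dif \<mu> n) ^ Q1"
  unfolding dif_Suc using N_f_diff_small[OF orb_pair(1)[of n] orb_pair(2)[of n]] orb_pair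
  by (simp add: dif_def)

text \<open>A larger difference would be raised to the power \<open>Q2\<close> in the next step and
  exceed \<open>R\<close>, impossible for two points of the sphere.\<close>

lemma N_dif_additive:
  assumes "s2 = 1"
  shows "N (dif \<mu> n) ^ w \<le> R ^ a"
proof (rule ccontr)
  assume "\<not> ?thesis"
  hence large: "R ^ a < N (dif \<mu> n) ^ w" by simp
  hence eq: "N (dif \<mu> (Suc n)) = N (dif \<mu> n) ^ Q2"
    unfolding dif_Suc using N_f_diff_large[OF orb_pair(1)[of n] orb_pair(2)[of n]] orb_pair assms
    by (simp add: dif_def)
  have R: "R \<le> R ^ a" using R_gt_1 a_pos by (intro self_le_power) auto
  have gt1: "N (dif \<mu> n) > 1"
  proof (rule ccontr)
    assume "\<not> N (dif \<mu> n) > 1"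
    hence "N (dif \<mu> n) ^ w \<le> 1" using dif_in by (intro power_le_one) auto
    thus False using large R R_gt_1 by simp
  qed
  have "R < N (dif \<mu> n) ^ w" using large R by simp
  also have "\<dots> \<le> N (dif \<mu> n) ^ Q2" using gt1 by (intro power_increasing) (auto simp: Q2_eq)
  finally show False using eq N_dif_le[of "Suc n"] by simp
qed

text \<open>
  At a place where \<open>\<delta>\<close> is not of the critical size the first difference is expanded by the term
  of degree \<open>d\<^sub>1\<close>, and boundedness forces \<open>\<delta>\<close> to be small.
\<close>

lemma dichotomy: "R * N \<delta> ^ d2 \<le> 1 \<or> R ^ (a - b) \<le> N \<delta> ^ w"
proof (rule disjCI)
  assume "\<not> R ^ (a - b) \<le> N \<delta> ^ w"
  hence small: "N \<delta> ^ w < R ^ (a - b)" by simp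
  have \<delta>A: "\<delta> \<in> A" using dif_in[of "Suc 0"] dif_1 by simp
  have eq: "N (dif \<mu> (Suc (Suc 0))) = R ^ a * N \<delta> ^ Q1"
    using dif_step_small[of "Suc 0"] small dif_1 by simp
  have le: "R ^ a * N \<delta> ^ Q1 \<le> R" using N_dif_le[of "Suc (Suc 0)"] eq by simp
  have Ra: "R ^ a = R * R ^ (a - 1)" using a_pos by (metis power_eq_if not_gr0)
  hence le': "R ^ (a - 1) * N \<delta> ^ Q1 \<le> 1" using le R_gt_1 by simp
  have \<delta>1: "N \<delta> \<le> 1"
  proof (rule ccontr)
    assume "\<not> N \<delta> \<le> 1"
    hence "1 < N \<delta> ^ Q1" using Q_pos by (intro one_less_power) auto
    moreover have "1 \<le> R ^ (a - 1)" using R_gt_1 by (intro one_le_power) auto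
    ultimately have "1 * 1 < R ^ (a - 1) * N \<delta> ^ Q1" by (intro mult_le_less_imp_less) auto
    thus False using le' by simp
  qed
  \<comment> \<open>The two cases below yield the exponents \<open>Q1\<close> and \<open>w\<close>.
    Both are at most \<open>d2\<close>, so one exponent serves every place.\<close>
  have *: "R * N \<delta> ^ d2 \<le> 1" if "R * N \<delta> ^ e \<le> 1" "e \<le> d2" for e
  proof -
    have "N \<delta> ^ d2 \<le> N \<delta> ^ e" using \<delta>1 \<delta>A that(2) by (intro power_decreasing) auto
    hence "R * N \<delta> ^ d2 \<le> R * N \<delta> ^ e" using R_gt_1 by simp
    thus ?thesis using that(1) by simp
  qed
  show "R * N \<delta> ^ d2 \<le> 1"
  proof (cases "a = 1")
    case False
    hence "R ^ 1 \<le> R ^ (a - 1)" using a_pos R_gt_1 by (intro power_increasing) auto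
    hence "R * N \<delta> ^ Q1 \<le> R ^ (a - 1) * N \<delta> ^ Q1"
      using \<delta>A by (intro mult_right_mono) auto
    hence "R * N \<delta> ^ Q1 \<le> 1" using le' by simp
    thus ?thesis by (rule *) (use d_eq d_less in simp)
  next
    \<comment> \<open>Now \<open>le'\<close> carries no power of \<open>R\<close>. But
      \<open>a = 1\<close> forces \<open>Q1 = 1\<close> and \<open>s2 = 1\<close>, and the additive
      bound on the second difference supplies the missing factor.\<close>
    case True
    hence 1: "Q1 = 1" "b = 0" using b_less_a by (auto simp: ab_def)
    hence s2: "s2 = 1" using s_pos Q_pos by (simp add: ab_def)
    have w2: "w \<ge> 2" using d_less True 1 by (simp add: d_eq Q2_eq)
    have "N (dif \<mu> (Suc (Suc 0))) ^ w \<le> R ^ a" by (rule N_dif_additive[OF s2])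
    hence "R ^ w * N \<delta> ^ w \<le> R" by (simp add: eq True 1 power_mult_distrib)
    moreover have "R ^ 2 * N \<delta> ^ w \<le> R ^ w * N \<delta> ^ w"
      using w2 R_gt_1 \<delta>A by (intro mult_right_mono power_increasing) auto
    ultimately have "R * (R * N \<delta> ^ w) \<le> R * 1" by (simp add: power2_eq_square)
    hence "R * N \<delta> ^ w \<le> 1" using R_gt_1 by simp
    thus ?thesis by (rule *) (use d_eq Q2_eq in simp)
  qed
qed

end

end

section \<open>Differences of orbits as polynomials in the parameter, and witnesses at critical
  places\<close>

context place
begin

lemma poly_pdiff: "poly (pdiff \<alpha> \<beta> n) \<mu> = dif \<mu> (Suc n)"
  by (simp add: pdiff_def dif_def poly_param_orb del: param_orb.simps orb_Suc)

lemma pdiff_in: "pdiff \<alpha> \<beta> n \<in> polys_over A"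
  unfolding pdiff_def
  by (intro subring_diff[OF subring_polys_over[OF A]] param_orb_in A c_in \<alpha>_in \<beta>_in)

lemma lead_in: "lead_coeff (pdiff \<alpha> \<beta> n) \<in> A"
  using pdiff_in by (rule lead_coeff_in)

lemma pdiff_0: "pdiff \<alpha> \<beta> 0 = [:\<delta>:]"
  by (simp add: pdiff_def pcompose_f poly_f poly_const_pow)

text \<open>The two terms of \<open>f\<close> contribute leading coefficients of sizes
  \<open>N L ^ Q1\<close> and \<open>N L ^ Q2\<close>, where \<open>L\<close> is the leading
  coefficient before the step. Since \<open>N L > 1\<close> these sizes differ, so nothing cancels
  even when the degrees agree.\<close>

lemma pdiff_step:
  assumes deg: "degree (pdiff \<alpha> \<beta> n) = ediff n" and lead: "N (lead_coeff (pdiff \<alpha> \<beta> n)) > 1"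
  shows "degree (pdiff \<alpha> \<beta> (Suc n)) = ediff (Suc n)"
    and "N (lead_coeff (pdiff \<alpha> \<beta> (Suc n))) = N (lead_coeff (pdiff \<alpha> \<beta> n)) ^
      (if a * d2 ^ n + Q1 * ediff n \<le> b * d2 ^ n + Q2 * ediff n then Q2 else Q1)"
proof -
  define P S L c where "P = param_orb f \<alpha> (Suc n)" and "S = param_orb f \<beta> (Suc n)"
    and "L = lead_coeff (pdiff \<alpha> \<beta> n)" and "c = c2 ^ (\<Sum>i<n. d2 ^ i)"
  have PS: "degree P = d2 ^ n" "degree S = d2 ^ n" "lead_coeff P = c" "lead_coeff S = c"
    unfolding P_def S_def c_def by (rule param_orb_degree)+
  have c0: "c \<noteq> 0" using c_nz by (simp add: c_def)
  have cA: "c \<in> A" and Nc: "N c = 1" using c_in N_c by (auto simp: c_def N_power cl(7))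
  have PS_diff: "P - S = pdiff \<alpha> \<beta> n" by (simp add: P_def S_def pdiff_def)
  have L: "L \<in> A" "N L > 1" using lead_in lead by (auto simp: L_def)
  have nz: "P - S \<noteq> 0" using lead PS_diff by auto
  define U W where "U = smult c1 ((P ^ s1 - S ^ s1) ^ Q1)" and "W = smult c2 ((P ^ s2 - S ^ s2) ^ Q2)"
  have sum: "pdiff \<alpha> \<beta> (Suc n) = U + W"
    unfolding U_def W_def pcompose_f_diff[symmetric]
    by (simp add: pdiff_def P_def S_def)
  note br1 = power_diff_bracket[OF PS c0 s_of_nat(1)]
  note br2 = power_diff_bracket[OF PS c0 s_of_nat(2)]
  have degU: "degree U = a * d2 ^ n + Q1 * ediff n"
    using br1(1,2) nz c_nz deg
    by (simp add: U_def degree_power_eq PS_diff ab_def algebra_simps)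
  have degW: "degree W = b * d2 ^ n + Q2 * ediff n"
    using br2(1,2) nz c_nz deg
    by (simp add: W_def degree_power_eq PS_diff ab_def algebra_simps)
  have lU: "lead_coeff U = c1 * (of_nat s1 * c ^ (s1 - 1) * L) ^ Q1"
    unfolding U_def lead_coeff_smult lead_coeff_power br1(3) PS_diff L_def ..
  have lW: "lead_coeff W = c2 * (of_nat s2 * c ^ (s2 - 1) * L) ^ Q2"
    unfolding W_def lead_coeff_smult lead_coeff_power br2(3) PS_diff L_def ..
  have UA: "lead_coeff U \<in> A" "lead_coeff W \<in> A"
    unfolding lU lW using c_in cA L by (intro cl(4,7,10); simp)+
  have NU: "N (lead_coeff U) = N L ^ Q1" and NW: "N (lead_coeff W) = N L ^ Q2"
    unfolding lU lW using c_in cA L N_c N_s Nc by (simp_all add: N_mult N_power cl(4,7,10))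
  have less: "N (lead_coeff U) < N (lead_coeff W)"
    unfolding NU NW using L Q_less by simp
  consider "degree W < degree U" | "degree U < degree W" | "degree U = degree W" by linarith
  hence *: "degree (U + W) = max (degree U) (degree W) \<and>
    N (lead_coeff (U + W)) = N L ^ (if degree U \<le> degree W then Q2 else Q1)"
  proof cases
    case 1
    thus ?thesis using degree_lead_coeff_add_cases(1)[OF 1] NU by auto
  next
    case 2
    thus ?thesis using degree_lead_coeff_add_cases(2)[OF 2] NW by auto
  next
    case 3
    have eq: "N (lead_coeff U + lead_coeff W) = N L ^ Q2"
      using N_add_eq[OF UA less] NW by simp
    hence "lead_coeff U + lead_coeff W \<noteq> 0" using L by auto
    from degree_lead_coeff_add_cases(3)[OF 3 this] eq 3 show ?thesis by auto
  qed
  from conjunct1[OF *] show "degree (pdiff \<alpha> \<beta> (Suc n)) = ediff (Suc n)"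
    by (simp only: sum degU degW ediff.simps)
  from conjunct2[OF *] show "N (lead_coeff (pdiff \<alpha> \<beta> (Suc n))) = N (lead_coeff (pdiff \<alpha> \<beta> n)) ^
      (if a * d2 ^ n + Q1 * ediff n \<le> b * d2 ^ n + Q2 * ediff n then Q2 else Q1)"
    by (simp only: sum degU degW L_def)
qed

context
  assumes crit: "R ^ (a - b) \<le> N \<delta> ^ w"
begin

lemma \<delta>_in: "\<delta> \<in> A"
  by (intro cl(3) f_in \<alpha>_in \<beta>_in)

lemma R_le: "R \<le> N \<delta> ^ w"
proof -
  have "R \<le> R ^ (a - b)" using R_gt_1 b_less_a by (intro self_le_power) auto
  thus ?thesis using crit by simp
qed

lemma N_\<delta>_gt_1: "N \<delta> > 1"
proof (rule ccontr)
  assume "\<not> N \<delta> > 1"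
  hence "N \<delta> ^ w \<le> 1" using \<delta>_in by (intro power_le_one) auto
  thus False using R_le R_gt_1 by simp
qed

lemma pdiff_degree_lead: "degree (pdiff \<alpha> \<beta> n) = ediff n \<and>
  N (lead_coeff (pdiff \<alpha> \<beta> n)) \<ge> N \<delta> ^ (Q1 ^ n) \<and> N (lead_coeff (pdiff \<alpha> \<beta> n)) > 1"
proof (induction n)
  case 0
  show ?case using N_\<delta>_gt_1 by (simp add: pdiff_0)
next
  case (Suc n)
  let ?L = "N (lead_coeff (pdiff \<alpha> \<beta> n))"
  define e where "e = (if a * d2 ^ n + Q1 * ediff n \<le> b * d2 ^ n + Q2 * ediff n then Q2 else Q1)"
  have e: "Q1 \<le> e" using Q_less by (simp add: e_def)
  have step: "degree (pdiff \<alpha> \<beta> (Suc n)) = ediff (Suc n)"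
      "N (lead_coeff (pdiff \<alpha> \<beta> (Suc n))) = ?L ^ e"
    using pdiff_step[of n] Suc unfolding e_def by blast+
  have "N \<delta> ^ (Q1 ^ Suc n) = (N \<delta> ^ (Q1 ^ n)) ^ Q1" by (simp add: power_swap mult.commute)
  also have "\<dots> \<le> ?L ^ Q1" using Suc \<delta>_in by (intro power_mono) auto
  also have "\<dots> \<le> ?L ^ e" using Suc e by (intro power_increasing) auto
  finally have "N \<delta> ^ (Q1 ^ Suc n) \<le> ?L ^ e" .
  moreover have "1 < ?L ^ e" using Suc e Q_pos by (intro one_less_power) auto
  ultimately show ?case using step by simp
qed

text \<open>The values stay bounded by \<open>R\<close>, while the leading coefficient grows at
  least like \<open>N \<delta> ^ (Q1 ^ n)\<close>. The exponent \<open>2 * w\<close> pays for two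
  factors \<open>R\<close>: the bound on the values and the gain.\<close>

lemma crit_witness_inseparable:
  assumes n: "2 * w \<le> Q1 ^ n" and \<mu>: "common \<mu>"
  shows "R * N (poly (pdiff \<alpha> \<beta> n) \<mu>) ^ 1 \<le> N (lead_coeff (pdiff \<alpha> \<beta> n)) ^ 1"
proof -
  have "R * N (poly (pdiff \<alpha> \<beta> n) \<mu>) \<le> R * R"
    using N_dif_le[OF \<mu>] R_gt_1 by (simp add: poly_pdiff)
  also have "\<dots> \<le> N \<delta> ^ w * N \<delta> ^ w" using R_le R_gt_1 by (intro mult_mono) auto
  also have "\<dots> = N \<delta> ^ (2 * w)" by (simp add: mult_2 power_add)
  also have "\<dots> \<le> N \<delta> ^ (Q1 ^ n)" using N_\<delta>_gt_1 n by (intro power_increasing) auto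
  also have "\<dots> \<le> N (lead_coeff (pdiff \<alpha> \<beta> n))" using pdiff_degree_lead by blast
  finally show ?thesis by simp
qed

text \<open>For \<open>Q1 = 1\<close> the leading coefficient need not grow at every step, but where
  the second term wins it is raised to the power \<open>w + 1\<close>. Its \<open>w\<close>-th power
  is then at least \<open>(N \<delta> ^ w) ^ (w + 1) \<ge> R * R ^ w\<close>.\<close>

lemma crit_witness_mixed:
  assumes Q1: "Q1 = 1" and n: "a * d2 ^ n + Q1 * ediff n \<le> b * d2 ^ n + Q2 * ediff n"
    and \<mu>: "common \<mu>"
  shows "R * N (poly (pdiff \<alpha> \<beta> (Suc n)) \<mu>) ^ w \<le> N (lead_coeff (pdiff \<alpha> \<beta> (Suc n))) ^ w"
proof -
  let ?L = "N (lead_coeff (pdiff \<alpha> \<beta> n))"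
  have "N \<delta> ^ (Q1 ^ n) \<le> ?L" using pdiff_degree_lead by blast
  hence L: "N \<delta> \<le> ?L" by (simp only: Q1 power_one power_one_right)
  have eq: "N (lead_coeff (pdiff \<alpha> \<beta> (Suc n))) = ?L ^ Suc w"
  proof -
    have Q2: "Q2 = Suc w" using Q2_eq Q1 by simp
    have dl: "degree (pdiff \<alpha> \<beta> n) = ediff n" "?L > 1" using pdiff_degree_lead[of n] by blast+
    show ?thesis
      unfolding Q2[symmetric] using pdiff_step(2)[OF dl] n by (simp only: if_True)
  qed
  have "R * N (poly (pdiff \<alpha> \<beta> (Suc n)) \<mu>) ^ w \<le> R * R ^ w"
    using N_dif_le[OF \<mu>] R_gt_1 dif_in[OF \<mu>] by (intro mult_left_mono power_mono) (auto simp: poly_pdiff)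
  also have "\<dots> = R ^ Suc w" by simp
  also have "\<dots> \<le> (N \<delta> ^ w) ^ Suc w" using R_le R_gt_1 by (intro power_mono) auto
  also have "\<dots> = (N \<delta> ^ Suc w) ^ w" by (simp only: power_swap mult.commute)
  also have "\<dots> \<le> (?L ^ Suc w) ^ w" using L \<delta>_in by (intro power_mono zero_le_power N_nonneg) auto
  finally show ?thesis by (simp only: eq)
qed

lemma additive_witness_in: "additive_witness \<alpha> \<beta> \<in> polys_over A"
  unfolding additive_witness_def
  by (intro subring_diff[OF subring_polys_over[OF A]] subring_power[OF subring_polys_over[OF A]]
    smult_in_polys_over[OF A] pdiff_in cl(7) \<delta>_in)

context
  assumes Q1: "Q1 = 1" and s2: "s2 = 1"
begin

lemma b0: "b = 0" and Q2_w: "Q2 = Suc w" and d2_Q2: "d2 = Q2" and s1_a: "s1 = Suc a" and d1_s1: "d1 = s1"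
  using Q1 s2 s_pos by (auto simp: ab_def Q2_eq d_def)

lemma additive_witness_lead:
  "degree (additive_witness \<alpha> \<beta>) = a * Q2" "N (lead_coeff (additive_witness \<alpha> \<beta>)) = N \<delta> ^ Q2"
proof -
  have e1: "ediff 1 = a" using b_less_a by simp
  have deg: "degree (pdiff \<alpha> \<beta> 1) = a" using pdiff_degree_lead[of 1] unfolding e1 by blast
  have "N (lead_coeff (pdiff \<alpha> \<beta> 1)) = N \<delta> ^ Q1"
    using pdiff_step(2)[of 0] pdiff_degree_lead[of 0] b_less_a by (simp add: pdiff_0)
  hence lead: "N (lead_coeff (pdiff \<alpha> \<beta> 1)) = N \<delta>" by (simp only: Q1 power_one_right)
  hence nz: "pdiff \<alpha> \<beta> 1 \<noteq> 0" using N_\<delta>_gt_1 by auto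
  have 1: "degree (pdiff \<alpha> \<beta> 1 ^ Q2) = a * Q2" using nz deg by (simp add: degree_power_eq mult.commute)
  define U V where "U = pdiff \<alpha> \<beta> 1 ^ Q2" and "V = - smult (\<delta> ^ w) (pdiff \<alpha> \<beta> 1)"
  have UV: "(additive_witness \<alpha> \<beta>) = U + V" by (simp add: additive_witness_def U_def V_def)
  have "degree V < a * Q2"
    using deg a_pos w_pos degree_smult_le[of "\<delta> ^ w" "pdiff \<alpha> \<beta> 1"] by (auto simp: V_def Q2_w)
  hence less: "degree V < degree U" using 1 by (simp add: U_def)
  have *: "degree (additive_witness \<alpha> \<beta>) = degree (pdiff \<alpha> \<beta> 1 ^ Q2)"
    "lead_coeff (additive_witness \<alpha> \<beta>) = lead_coeff (pdiff \<alpha> \<beta> 1 ^ Q2)"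
    using degree_lead_coeff_add_cases(1)[OF less] unfolding UV U_def by blast+
  show "degree (additive_witness \<alpha> \<beta>) = a * Q2" using * 1 by simp
  show "N (lead_coeff (additive_witness \<alpha> \<beta>)) = N \<delta> ^ Q2"
    unfolding *(2) lead_coeff_power using lead_in lead by (simp add: N_power)
qed

text \<open>Here \<open>b = 0\<close> and \<open>d2 = Q2\<close>, so the term of degree
  \<open>d1\<close> always has the higher degree. Leading coefficients keep the size
  \<open>N \<delta>\<close>, which is also the bound on the values, and no \<open>pdiff\<close>
  gains. The gain comes from eliminating the \<open>Q2\<close>-th powers between two steps of the
  recursion \<open>rec\<close>: what remains involves \<open>T 2 - T 1\<close>, small because
  consecutive orbit points are close.\<close>

lemma crit_witness_additive:
  assumes \<mu>: "common \<mu>"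
  shows "R * N (poly (additive_witness \<alpha> \<beta>) \<mu>) ^ Q2 \<le> N (lead_coeff (additive_witness \<alpha> \<beta>)) ^ Q2"
proof -
  define x y where "x = orb f \<mu> \<alpha>" and "y = orb f \<mu> \<beta>"
  have mem: "x n \<in> A" "y n \<in> A" and nrm: "N (x n) = R" "N (y n) = R" for n
    unfolding x_def y_def using orb_pair[OF \<mu>] by blast+
  define \<Delta> where "\<Delta> = dif \<mu>"
  have \<Delta>A: "\<Delta> n \<in> A" for n unfolding \<Delta>_def by (rule dif_in[OF \<mu>])
  have \<Delta>1: "\<Delta> 1 = \<delta>" by (simp add: \<Delta>_def dif_1)
  define T where "T n = bracket s1 (x n) (y n)" for n
  have TA: "T n \<in> A" for n unfolding T_def by (intro bracket_in mem)
  have rec: "\<Delta> (Suc n) = c1 * (\<Delta> n * T n) + c2 * \<Delta> n ^ Q2" for n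
  proof -
    have "\<Delta> (Suc n) = c1 * (x n ^ s1 - y n ^ s1) ^ 1 + c2 * (x n ^ 1 - y n ^ 1) ^ Q2"
      unfolding \<Delta>_def dif_Suc f_diff x_def y_def Q1 s2 ..
    thus ?thesis
      unfolding bracket_eq[of "x n" s1 "y n"] by (simp add: T_def \<Delta>_def dif_def x_def y_def)
  qed
  have \<Delta>_le: "N (\<Delta> n) \<le> N \<delta>" for n
  proof -
    have "N (\<Delta> n) ^ w \<le> N \<delta> ^ w"
      using N_dif_additive[OF \<mu> s2, of n] crit b0 by (simp add: \<Delta>_def)
    thus ?thesis using power_mono_iff[of "N (\<Delta> n)" "N \<delta>" w] \<Delta>A \<delta>_in w_pos by simp
  qed
  have \<delta>w: "N \<delta> ^ w = R ^ a"
    using N_dif_additive[OF \<mu> s2, of "Suc 0"] crit b0 dif_1[of \<mu>] by simp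
  define M where "M = max (N (x 2 - x 1)) (N (y 2 - y 1))"
  \<comment> \<open>The difference of \<open>f\<close> at \<open>z 2\<close> and \<open>z 1\<close>
    is \<open>z 3 - z 2\<close>, of size at most \<open>R\<close>, and its term of degree
    \<open>d2\<close> is a pure \<open>Q2\<close>-th power of \<open>z 2 - z 1\<close>. As
    \<open>d1 < Q2\<close>, the bound places consecutive points closer than
    \<open>R\<close>.\<close>
  have MQ: "N (z 2 - z 1) ^ Q2 \<le> R ^ d1" if z: "z = x \<or> z = y" for z
  proof -
    have zA: "z n \<in> A" and zR: "N (z n) = R" and zS: "z (Suc n) = poly f (z n) + \<mu>" for n
      using z mem nrm by (auto simp: x_def y_def)
    have "z 3 - z 2 = poly f (z 2) - poly f (z 1)"
      using zS[of 2] zS[of 1] by (simp add: numeral_2_eq_2 numeral_3_eq_3)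
    hence eq: "c2 * (z 2 - z 1) ^ Q2 = (z 3 - z 2) - c1 * (z 2 ^ s1 - z 1 ^ s1)"
      unfolding f_diff by (simp add: Q1 s2)
    have RR: "R \<le> R ^ d1" using R_gt_1 d_eq Q1 by (intro self_le_power) auto
    have "N (z 2 ^ s1 - z 1 ^ s1) \<le> R ^ d1"
      using zA zR by (intro N_diff_le cl(7)) (auto simp: N_power d1_s1)
    moreover have "N (z 3 - z 2) \<le> R ^ d1"
      using zA zR RR by (intro N_diff_le) auto
    ultimately have "N (c2 * (z 2 - z 1) ^ Q2) \<le> R ^ d1"
      unfolding eq using zA c_in N_c
      by (intro N_diff_le[of "z 3 - z 2"]) (auto simp: N_mult cl(3,4,7))
    thus ?thesis using zA c_in N_c by (simp add: N_mult N_power cl(3,7))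
  qed
  have M: "M ^ Q2 \<le> R ^ d1" "M \<ge> 0"
    using MQ[of x] MQ[of y] mem by (auto simp: M_def max_def cl(3))
  have pd: "R * N (z 2 ^ k - z 1 ^ k) \<le> R ^ k * M" if z: "z = x \<or> z = y" for z k
  proof (cases k)
    case 0
    thus ?thesis using M by simp
  next
    case (Suc j)
    have zA: "z n \<in> A" and zR: "N (z n) = R" for n using z mem nrm by auto
    have "N (z 2 ^ k - z 1 ^ k) \<le> R ^ j * N (z 2 - z 1)"
      using N_power_diff_le[of "z 2" "z 1" k] zA zR Suc by simp
    also have "\<dots> \<le> R ^ j * M" using z R_gt_1 by (intro mult_left_mono) (auto simp: M_def)
    finally show ?thesis using R_gt_1 Suc by simp
  qed
  have Tdiff: "R * N (T 2 - T 1) \<le> R ^ a * M"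
  proof -
    \<comment> \<open>In each summand first the power of \<open>y\<close>, then the power of
      \<open>x\<close> is replaced, so that only differences of powers of consecutive points
      occur.\<close>
    have "T 2 - T 1 = (\<Sum>i<s1. (y 2 ^ (s1 - Suc i) - y 1 ^ (s1 - Suc i)) * x 2 ^ i
        + y 1 ^ (s1 - Suc i) * (x 2 ^ i - x 1 ^ i))"
      by (simp add: T_def bracket_def algebra_simps flip: sum_subtractf)
    moreover have "N \<dots> \<le> R ^ a * M / R"
    proof (rule N_sum_le)
      fix i assume i: "i \<in> {..<s1}"
      let ?k = "s1 - Suc i"
      have k: "?k + i = a" using i s1_a by auto
      have A1: "(y 2 ^ ?k - y 1 ^ ?k) * x 2 ^ i \<in> A" "y 1 ^ ?k * (x 2 ^ i - x 1 ^ i) \<in> A"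
        using mem by (intro cl(3,4,7); simp)+
      thus "(y 2 ^ ?k - y 1 ^ ?k) * x 2 ^ i + y 1 ^ ?k * (x 2 ^ i - x 1 ^ i) \<in> A" by (rule cl(6))
      have "R * N ((y 2 ^ ?k - y 1 ^ ?k) * x 2 ^ i) = R * N (y 2 ^ ?k - y 1 ^ ?k) * R ^ i"
        using mem nrm by (simp add: N_mult N_power cl(3,7))
      also have "\<dots> \<le> R ^ ?k * M * R ^ i" using pd[of y ?k] R_gt_1 by (intro mult_right_mono) auto
      also have "\<dots> = R ^ a * M" unfolding k[symmetric] by (simp add: power_add)
      finally have 1: "N ((y 2 ^ ?k - y 1 ^ ?k) * x 2 ^ i) \<le> R ^ a * M / R"
        using R_gt_1 by (simp add: field_simps)
      have "R * N (y 1 ^ ?k * (x 2 ^ i - x 1 ^ i)) = R ^ ?k * (R * N (x 2 ^ i - x 1 ^ i))"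
        using mem nrm by (simp add: N_mult N_power cl(3,7))
      also have "\<dots> \<le> R ^ ?k * (R ^ i * M)" using pd[of x i] R_gt_1 by (intro mult_left_mono) auto
      also have "\<dots> = R ^ a * M" unfolding k[symmetric] by (simp add: power_add)
      finally have 2: "N (y 1 ^ ?k * (x 2 ^ i - x 1 ^ i)) \<le> R ^ a * M / R"
        using R_gt_1 by (simp add: field_simps)
      show "N ((y 2 ^ ?k - y 1 ^ ?k) * x 2 ^ i + y 1 ^ ?k * (x 2 ^ i - x 1 ^ i)) \<le> R ^ a * M / R"
        using A1 1 2 by (rule N_add_le)
    qed (use M R_gt_1 in auto)
    ultimately show ?thesis using R_gt_1 by (simp add: field_simps)
  qed
  define F where "F = poly (additive_witness \<alpha> \<beta>) \<mu>"
  have F: "F = \<Delta> 2 ^ Q2 - \<delta> ^ w * \<Delta> 2"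
    by (simp add: F_def additive_witness_def poly_pdiff \<Delta>_def numeral_2_eq_2)
  have FA: "F \<in> A" unfolding F by (intro cl(3,4,7) \<Delta>A \<delta>_in)
  have \<Delta>2: "\<Delta> 2 = c1 * (\<delta> * T 1) + c2 * \<delta> ^ Q2"
    using rec[of 1] \<Delta>1 by (simp add: numeral_2_eq_2)
  have \<Delta>3: "\<Delta> 3 = c1 * (\<Delta> 2 * T 2) + c2 * \<Delta> 2 ^ Q2"
    using rec[of 2] by (simp add: numeral_3_eq_3 numeral_2_eq_2)
  have "\<delta> * (c2 * F) = \<delta> * (c2 * \<Delta> 2 ^ Q2) - (c2 * \<delta> ^ Q2) * \<Delta> 2"
    by (simp add: F Q2_w algebra_simps)
  also have "c2 * \<Delta> 2 ^ Q2 = \<Delta> 3 - c1 * (\<Delta> 2 * T 2)" using \<Delta>3 by simp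
  also have "c2 * \<delta> ^ Q2 = \<Delta> 2 - c1 * (\<delta> * T 1)" using \<Delta>2 by (simp add: algebra_simps)
  finally have key: "\<delta> * (c2 * F) = (\<delta> * \<Delta> 3 - \<Delta> 2 * \<Delta> 2) - c1 * (\<delta> * \<Delta> 2 * (T 2 - T 1))"
    by (simp add: algebra_simps)
  \<comment> \<open>The maximum with \<open>1\<close> lets one bound cover both the quadratic terms
    in \<open>key\<close> and the term with \<open>T 2 - T 1\<close>.\<close>
  define X where "X = max 1 (N (T 2 - T 1))"
  have sq: "N \<delta> * N (\<Delta> 3) \<le> N \<delta> * N \<delta>" "N (\<Delta> 2) * N (\<Delta> 2) \<le> N \<delta> * N \<delta>" "N \<delta> * N (\<Delta> 2) \<le> N \<delta> * N \<delta>"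
    using \<Delta>_le \<Delta>A \<delta>_in by (auto intro!: mult_mono)
  have X1: "N \<delta> * N \<delta> \<le> N \<delta> * N \<delta> * X"
    using mult_left_mono[of 1 X "N \<delta> * N \<delta>"] by (simp add: X_def)
  have "N (\<delta> * \<Delta> 3 - \<Delta> 2 * \<Delta> 2) \<le> N \<delta> * N \<delta> * X"
    using sq X1 \<delta>_in \<Delta>A by (intro N_diff_le cl(4)) (auto simp: N_mult)
  moreover have "N (c1 * (\<delta> * \<Delta> 2 * (T 2 - T 1))) \<le> N \<delta> * N \<delta> * X"
  proof -
    have "N (c1 * (\<delta> * \<Delta> 2 * (T 2 - T 1))) = N \<delta> * N (\<Delta> 2) * N (T 2 - T 1)"
      using \<delta>_in \<Delta>A TA c_in N_c by (simp add: N_mult cl(3,4))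
    also have "\<dots> \<le> N \<delta> * N \<delta> * X"
      using \<Delta>A TA \<delta>_in by (intro mult_mono[OF sq(3)]) (auto simp: X_def cl(3))
    finally show ?thesis .
  qed
  ultimately have "N (\<delta> * (c2 * F)) \<le> N \<delta> * N \<delta> * X"
    unfolding key using \<delta>_in \<Delta>A TA c_in 
    by (intro N_diff_le[of _ "c1 * (\<delta> * \<Delta> 2 * (T 2 - T 1))"]) (simp_all add: cl(3,4))
  hence "N \<delta> * N F \<le> N \<delta> * (N \<delta> * X)"
    using \<delta>_in FA c_in N_c by (simp add: N_mult cl(4) mult.assoc)
  hence NF: "N F \<le> N \<delta> * X" using N_\<delta>_gt_1 by simp
  \<comment> \<open>The spare factor \<open>R\<close> comes from \<open>d1 < Q2\<close>:
    \<open>Tdiff\<close> gains \<open>R ^ Q2\<close> and \<open>M ^ Q2\<close> costs only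
    \<open>R ^ d1\<close>.\<close>
  have RX: "R * X ^ Q2 \<le> (R ^ a) ^ Q2"
  proof (cases "N (T 2 - T 1) \<le> 1")
    case True
    have "R \<le> R ^ (Q2 * a)" using R_gt_1 a_pos Q_pos by (intro self_le_power) auto
    thus ?thesis using True by (simp add: X_def power_swap)
  next
    case False
    hence X: "X = N (T 2 - T 1)" by (simp add: X_def)
    have "(R * X) ^ Q2 \<le> (R ^ a * M) ^ Q2"
      using Tdiff TA R_gt_1 by (intro power_mono) (auto simp: X cl(3))
    hence "R ^ Q2 * X ^ Q2 \<le> (R ^ a) ^ Q2 * M ^ Q2" by (simp only: power_mult_distrib)
    also have "\<dots> \<le> (R ^ a) ^ Q2 * R ^ d1" using M R_gt_1 by (intro mult_left_mono) auto
    finally have 1: "R ^ Q2 * X ^ Q2 \<le> (R ^ a) ^ Q2 * R ^ d1" .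
    have "R ^ Suc d1 \<le> R ^ Q2" using R_gt_1 d_less d2_Q2 by (intro power_increasing) auto
    hence "R ^ Suc d1 * X ^ Q2 \<le> R ^ Q2 * X ^ Q2"
      by (intro mult_right_mono) (auto simp: X_def)
    hence "R ^ d1 * (R * X ^ Q2) \<le> R ^ d1 * (R ^ a) ^ Q2" using 1 by (simp add: mult_ac)
    thus ?thesis using R_gt_1 by simp
  qed
  have "N F ^ Q2 \<le> (N \<delta> * X) ^ Q2" using NF FA by (intro power_mono) auto
  hence "R * N F ^ Q2 \<le> R * (N \<delta> * X) ^ Q2" using R_gt_1 by simp
  also have "\<dots> = N \<delta> ^ Q2 * (R * X ^ Q2)" by (simp add: power_mult_distrib)
  also have "\<dots> \<le> N \<delta> ^ Q2 * (R ^ a) ^ Q2" using RX \<delta>_in by (intro mult_left_mono) auto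
  also have "\<dots> = (N \<delta> * N \<delta> ^ w) ^ Q2" by (simp only: \<delta>w power_mult_distrib)
  also have "\<dots> = (N \<delta> ^ Q2) ^ Q2" by (simp add: Q2_w)
  finally show ?thesis by (simp only: F_def additive_witness_lead(2))
qed

end

end

end

section \<open>Discriminants of sets of common parameters\<close>

context place
begin

lemma common_in: "common \<mu> \<Longrightarrow> \<mu> \<in> A"
  by (simp add: common_def)

text \<open>The orbit of \<alpha> gives a polynomial of degree \<open>d2 ^ n\<close> with leading
  coefficient of size \<open>1\<close> and values of size \<open>R\<close>. So the parameters lie in
  a set of capacity at most the \<open>d2 ^ n\<close>-th root of \<open>R\<close>, as close to
  \<open>1\<close> as desired.\<close>

lemma N_discr_le_general:
  assumes E: "finite E" "\<And>\<mu>. \<mu> \<in> E \<Longrightarrow> common \<mu>" "card E = K"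
  shows "N (discr E) \<le> R ^ (2 * (K * (K div d2 ^ n + d2 * d2 ^ n)))"
proof -
  define D where "D = d2 ^ n"
  have D: "D > 0" using d2_gt_1 by (simp add: D_def)
  define F where "F = param_orb f \<alpha> (Suc n)"
  have F: "F \<in> polys_over A" "degree F = D"
    unfolding F_def D_def by (rule param_orb_in[OF A c_in \<alpha>_in], rule param_orb_degree(1))
  have FN: "N (lead_coeff F) = 1"
    unfolding F_def param_orb_degree(2) using c_in N_c by (simp add: N_power)
  have pF: "N (poly F \<mu>) \<le> R * N (lead_coeff F)" if "\<mu> \<in> E" for \<mu>
    using common_orbits(2)[OF E(2)[OF that], of "Suc n"] unfolding FN
    by (simp only: F_def poly_param_orb)
  have "N (discr E) \<le> (\<Prod>j<card E. R ^ (j div D) * (R ^ d2) ^ (j mod D)) ^ 2"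
    using E(1,2) common_in F FN D R_gt_1 pF common_orbits(1)
    by (intro N_discr_le[of E F D]) auto
  also have "\<dots> \<le> (\<Prod>j<card E. R ^ (K div D + d2 * D)) ^ 2"
  proof (intro power_mono prod_mono conjI prod_nonneg ballI)
    fix j assume j: "j \<in> {..<card E}"
    have "R ^ (j div D) * (R ^ d2) ^ (j mod D) = R ^ (j div D + d2 * (j mod D))"
      by (simp add: power_add power_mult)
    also have "\<dots> \<le> R ^ (K div D + d2 * D)"
      using R_gt_1 j D E(3) by (intro power_increasing add_mono mult_left_mono div_le_mono) (auto simp: less_imp_le)
    finally show "R ^ (j div D) * (R ^ d2) ^ (j mod D) \<le> R ^ (K div D + d2 * D)" .
  qed (use R_gt_1 in auto)
  also have "\<dots> = R ^ (2 * (K * (K div D + d2 * D)))"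
    by (simp add: E(3) power_swap flip: power_mult)
  finally show ?thesis by (simp add: D_def)
qed

lemma sum_div_blocks: "2 * (\<Sum>j<m * M. j div m) = m * (M * (M - 1 :: nat))"
proof (cases "m = 0")
  case False
  have "(\<Sum>j<M * m. j div m) = (\<Sum>i<M. \<Sum>j\<in>{i * m..<i * m + m}. j div m)"
    by (rule sum.nat_group[symmetric])
  also have "\<dots> = (\<Sum>i<M. \<Sum>j\<in>{i * m..<i * m + m}. i)"
  proof (intro sum.cong refl)
    fix i j assume "j \<in> {i * m..<i * m + m}"
    hence "i * m \<le> j" "j < Suc i * m" by auto
    thus "j div m = i" using False by (intro div_nat_eqI) (auto simp: mult.commute)
  qed
  also have "\<dots> = m * (\<Sum>i<M. i)" by (simp add: sum_distrib_left)
  finally have "2 * (\<Sum>j<m * M. j div m) = m * (2 * (\<Sum>i<M. i))" by (simp add: mult.commute)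
  also have "2 * (\<Sum>i<M. i) = M * (M - 1)"
  proof (induction M)
    case (Suc M)
    thus ?case by (cases M) auto
  qed simp
  finally show ?thesis .
qed auto

text \<open>The gain \<open>m * (M * (M - 1))\<close> is quadratic in \<open>M\<close>, the loss on
  the right only linear.\<close>

lemma N_discr_le_crit:
  assumes E: "finite E" "\<And>\<mu>. \<mu> \<in> E \<Longrightarrow> common \<mu>" "card E = m * M"
    and F: "F \<in> polys_over A" "degree F = m" "m > 0" "N (lead_coeff F) > 0"
    and e: "e > 0" "\<And>\<mu>. \<mu> \<in> E \<Longrightarrow> R * N (poly F \<mu>) ^ e \<le> N (lead_coeff F) ^ e"
  shows "N (discr E) ^ e * R ^ (m * (M * (M - 1))) \<le> R ^ (2 * (e * d2 * m * (m * M)))"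
proof -
  \<comment> \<open>The witness is small only after raising to the power \<open>e\<close>; the
    \<open>e\<close>-th power taken below removes this root.\<close>
  define \<theta> where "\<theta> = root e (1 / R)"
  have \<theta>: "\<theta> > 0" "\<theta> ^ e = 1 / R" using R_gt_1 e(1) by (auto simp: \<theta>_def)
  have EA: "E \<subseteq> A" using E common_in by auto
  have pF: "N (poly F \<mu>) \<le> \<theta> * N (lead_coeff F)" if "\<mu> \<in> E" for \<mu>
  proof -
    have "N (poly F \<mu>) ^ e \<le> N (lead_coeff F) ^ e / R"
      using e(2)[OF that] R_gt_1 by (simp add: field_simps)
    also have "\<dots> = (\<theta> * N (lead_coeff F)) ^ e" by (simp add: power_mult_distrib \<theta>)
    finally show ?thesis
      using power_mono_iff[of "N (poly F \<mu>)" "\<theta> * N (lead_coeff F)" e] e(1) \<theta>(1) F(4)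
        poly_in_subring[OF A F(1), of \<mu>] EA that by auto
  qed
  have "N (discr E) \<le> (\<Prod>j<card E. \<theta> ^ (j div m) * (R ^ d2) ^ (j mod m)) ^ 2"
    using E(1) EA F R_gt_1 \<theta> pF common_orbits(1)[OF E(2)] by (intro N_discr_le[of E F m]) auto
  hence "N (discr E) ^ e \<le> ((\<Prod>j<card E. \<theta> ^ (j div m) * (R ^ d2) ^ (j mod m)) ^ 2) ^ e"
    using EA by (intro power_mono N_nonneg discr_in_subring A)
  also have "\<dots> = (\<Prod>j<card E. (\<theta> ^ (j div m) * (R ^ d2) ^ (j mod m)) ^ e) ^ 2"
    unfolding prod_power_distrib by (simp only: power_swap mult.commute)
  also have "\<dots> \<le> (\<Prod>j<card E. (1 / R) ^ (j div m) * R ^ (e * d2 * m)) ^ 2"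
  proof (intro power_mono prod_mono conjI prod_nonneg ballI)
    fix j assume j: "j \<in> {..<card E}"
    have "(\<theta> ^ (j div m) * (R ^ d2) ^ (j mod m)) ^ e = (\<theta> ^ e) ^ (j div m) * R ^ (e * d2 * (j mod m))"
      by (simp only: power_mult_distrib power_swap mult_ac)
    also have "\<dots> \<le> (1 / R) ^ (j div m) * R ^ (e * d2 * m)"
      unfolding \<theta>(2) using R_gt_1 F(3)
      by (intro mult_left_mono power_increasing) (auto simp: less_imp_le)
    finally show "(\<theta> ^ (j div m) * (R ^ d2) ^ (j mod m)) ^ e \<le> (1 / R) ^ (j div m) * R ^ (e * d2 * m)" .
  qed (use R_gt_1 \<theta> in auto)
  also have "\<dots> = (1 / R) ^ (2 * (\<Sum>j<m * M. j div m)) * R ^ (2 * (e * d2 * m * (m * M)))"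
    by (simp add: E(3) prod.distrib power_mult_distrib power_swap mult_ac flip: power_sum power_mult)
  finally have "N (discr E) ^ e \<le> (1 / R) ^ (m * (M * (M - 1))) * R ^ (2 * (e * d2 * m * (m * M)))"
    unfolding sum_div_blocks .
  thus ?thesis using R_gt_1 by (simp add: power_divide field_simps)
qed

lemma norm_lt_1_if_pow:
  assumes "x \<ge> 0" "x ^ k * R ^ i \<le> R ^ j" "j < i"
  shows "x < 1"
proof (rule ccontr)
  assume "\<not> x < 1"
  hence "1 \<le> x ^ k" by (intro one_le_power) auto
  hence "1 * R ^ i \<le> x ^ k * R ^ i" using R_gt_1 by (intro mult_right_mono) auto
  moreover have "R ^ j < R ^ i" using assms(3) R_gt_1 by simp
  ultimately show False using assms(2) by simp
qed

text \<open>At a non-critical place the power of \<delta> wins against the slow growth of the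
  discriminant. At a critical place the discriminant wins against \<delta>, whose size is at most
  \<open>R\<close>.\<close>

lemma combination_small:
  assumes E: "finite E" "\<And>\<mu>. \<mu> \<in> E \<Longrightarrow> common \<mu>" "card E = m * M"
    and m: "m > 0" and e: "e > 0"
    and F: "R ^ (a - b) \<le> N \<delta> ^ w \<Longrightarrow> F \<in> polys_over A \<and> degree F = m \<and> N (lead_coeff F) > 0 \<and>
      (\<forall>\<mu>. common \<mu> \<longrightarrow> R * N (poly F \<mu>) ^ e \<le> N (lead_coeff F) ^ e)"
    and n: "8 * e * d2 * m ^ 2 \<le> d2 ^ n"
    and M: "M > 8 * e * d2 ^ 2 * m * d2 ^ n" "M > 4 * e * d2 * m + 2"
  shows "N (discr E ^ (2 * e) * \<delta> ^ (M * M)) < 1"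
proof -
  have EA: "E \<subseteq> A" using E common_in by auto
  have dA: "discr E \<in> A" using EA by (rule discr_in_subring[OF A])
  have \<delta>A: "\<delta> \<in> A" by (intro cl(3) f_in \<alpha>_in \<beta>_in)
  have Nu: "N (discr E ^ (2 * e) * \<delta> ^ (M * M)) = N (discr E) ^ (2 * e) * N \<delta> ^ (M * M)"
    using dA \<delta>A by (simp add: N_mult N_power cl(7))
  have "card E > 0" using E(3) m M by simp
  then obtain \<mu> where "\<mu> \<in> E" by (metis card.empty all_not_in_conv less_irrefl)
  hence \<mu>: "common \<mu>" using E by blast
  have \<delta>R: "N \<delta> \<le> R" using N_dif_le[OF \<mu>, of "Suc 0"] dif_1 by simp
  consider "R * N \<delta> ^ d2 \<le> 1" | "R ^ (a - b) \<le> N \<delta> ^ w" using dichotomy[OF \<mu>] by blast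
  thus ?thesis
  proof cases
    case 1
    define D where "D = d2 ^ n"
    define K where "K = m * M"
    define X where "X = 2 * e * d2 * (2 * (K * (K div D + d2 * D)))"
    have "N (discr E) ^ (2 * e * d2) \<le> (R ^ (2 * (K * (K div D + d2 * D)))) ^ (2 * e * d2)"
      using N_discr_le_general[OF E(1,2), of "m * M" n] E(3) dA
      by (intro power_mono) (auto simp: K_def D_def)
    also have "\<dots> = R ^ X" by (simp only: power_swap X_def)
    finally have d: "N (discr E) ^ (2 * e * d2) \<le> R ^ X" .
    have "(R * N \<delta> ^ d2) ^ (M * M) \<le> 1"
      using 1 R_gt_1 \<delta>A by (intro power_le_one) auto
    hence "N (discr E) ^ (2 * e * d2) * (R * N \<delta> ^ d2) ^ (M * M) \<le> R ^ X * 1"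
      using d R_gt_1 \<delta>A dA by (intro mult_mono) auto
    hence "(N (discr E) ^ (2 * e) * N \<delta> ^ (M * M)) ^ d2 * R ^ (M * M) \<le> R ^ X"
      by (simp add: power_mult_distrib power_swap mult_ac)
    moreover have "X < M * M"
    proof -
      \<comment> \<open>The choice of \<open>n\<close> bounds the part of \<open>X\<close> with
        \<open>K div D\<close> by half of \<open>M * M\<close>, and the choice of \<open>M\<close>
        bounds the rest by less than the other half.\<close>
      define q where "q = K div D"
      have "m * (8 * e * d2 * m * q) = 8 * e * d2 * m ^ 2 * q"
        by (simp add: power2_eq_square algebra_simps)
      also have "\<dots> \<le> D * q" using n unfolding D_def by (rule mult_le_mono1)
      also have "\<dots> \<le> m * M" by (simp add: q_def K_def)
      finally have "m * (8 * e * d2 * m * q) \<le> m * M" .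
      hence "8 * e * d2 * m * q \<le> M" using m by simp
      hence "M * (8 * e * d2 * m * q) \<le> M * M" by (rule mult_le_mono2)
      moreover have "M * (8 * e * d2 ^ 2 * m * D) < M * M" using M by (simp add: D_def)
      moreover have "2 * X = M * (8 * e * d2 * m * q) + M * (8 * e * d2 ^ 2 * m * D)"
        by (simp add: X_def K_def q_def power2_eq_square algebra_simps)
      ultimately show ?thesis by linarith
    qed
    ultimately show ?thesis
      unfolding Nu using dA \<delta>A by (intro norm_lt_1_if_pow[of _ d2 "M * M" X]) auto
  next
    case 2
    \<comment> \<open>Here the exponent \<open>2 * e\<close> of the discriminant is needed: \<delta>
      may cost \<open>R ^ (M * M)\<close>, and for \<open>m = 1\<close> a single gain
      \<open>M * (M - 1)\<close> would not cover this.\<close>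
    define Y where "Y = m * (M * (M - 1))"
    define Z where "Z = 2 * (e * d2 * m * (m * M))"
    have "N (discr E) ^ e * R ^ Y \<le> R ^ Z"
      unfolding Y_def Z_def using F[OF 2] m e E by (intro N_discr_le_crit) auto
    hence "(N (discr E) ^ e * R ^ Y) ^ 2 \<le> (R ^ Z) ^ 2"
      using dA R_gt_1 by (intro power_mono) auto
    hence "N (discr E) ^ (2 * e) * R ^ (2 * Y) \<le> R ^ (2 * Z)"
      by (simp only: power_mult_distrib power_swap)
    moreover have "N \<delta> ^ (M * M) \<le> R ^ (M * M)" using \<delta>R \<delta>A by (intro power_mono) auto
    ultimately have "(N (discr E) ^ (2 * e) * R ^ (2 * Y)) * N \<delta> ^ (M * M) \<le> R ^ (2 * Z) * R ^ (M * M)"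
      using \<delta>A R_gt_1 by (intro mult_mono) auto
    hence "(N (discr E) ^ (2 * e) * N \<delta> ^ (M * M)) ^ 1 * R ^ (2 * Y) \<le> R ^ (2 * Z + M * M)"
      by (simp add: power_add mult_ac)
    moreover have "2 * Z + M * M < 2 * Y"
    proof -
      obtain M' where M': "M = Suc M'" using M by (cases M) auto
      have "m * (4 * e * d2 * m + 2) < m * M"
        using M(2) m by (rule mult_strict_left_mono)
      moreover have "M \<le> m * M" using m by simp
      ultimately have "4 * e * d2 * m * m + M < 2 * (m * M')"
        by (simp add: M' algebra_simps)
      hence "M * (4 * e * d2 * m * m + M) < M * (2 * (m * M'))" 
        by (rule mult_strict_left_mono) (simp add: M')
      moreover have "2 * Z + M * M = M * (4 * e * d2 * m * m + M)"
        by (simp add: Z_def algebra_simps)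
      moreover have "M - 1 = M'" by (simp add: M')
      hence "2 * Y = M * (2 * (m * M'))" by (simp add: Y_def)
      ultimately show ?thesis by simp
    qed
    ultimately show ?thesis
      unfolding Nu using dA \<delta>A by (intro norm_lt_1_if_pow[of _ 1 "2 * Y" "2 * Z + M * M"]) auto
  qed
qed

end

section \<open>One witness for all critical places\<close>

context family
begin

text \<open>The quantifier order is the point: the witness depends on the family, \<alpha> and
  \<beta>, but not on the place. The three cases are \<open>Q1 > 1\<close>, then
  \<open>Q1 = 1\<close> with \<open>s2 > 1\<close>, which makes \<open>b\<close> positive, and
  finally \<open>Q1 = s2 = 1\<close>.\<close>

lemma crit_witness:
  "\<exists>F m e. m > 0 \<and> e > 0 \<and> (\<forall>A N R.
    place p l1 l2 s1 s2 c1 c2 f Q1 Q2 d1 d2 a b w A N \<alpha> \<beta> R \<longrightarrow>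
    R ^ (a - b) \<le> N (poly f \<alpha> - poly f \<beta>) ^ w \<longrightarrow>
    F \<in> polys_over A \<and> degree F = m \<and> N (lead_coeff F) > 0 \<and>
    (\<forall>\<mu>. place.common f A \<alpha> \<beta> \<mu> \<longrightarrow> R * N (poly F \<mu>) ^ e \<le> N (lead_coeff F) ^ e))"
proof -
  consider "Q1 > 1" | "Q1 = 1" "s2 > 1" | "Q1 = 1" "s2 = 1"
    using Q_pos s_pos by linarith
  thus ?thesis
  proof cases
    case 1
    define n where "n = 2 * w"
    have n: "2 * w \<le> Q1 ^ n" using power_gt_expt[of Q1 n] 1 by (simp add: n_def)
    obtain n' where n': "n = Suc n'" using w_pos by (cases n) (auto simp: n_def)
    show ?thesis
    proof (rule exI[of _ "pdiff \<alpha> \<beta> n"], rule exI[of _ "ediff n"], rule exI[of _ 1], intro conjI allI impI)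
      show "ediff n > 0" unfolding n' by (rule ediff_Suc_pos)
    next
      fix A N R
      assume "place p l1 l2 s1 s2 c1 c2 f Q1 Q2 d1 d2 a b w A N \<alpha> \<beta> R"
      then interpret place p l1 l2 s1 s2 c1 c2 f Q1 Q2 d1 d2 a b w A N \<alpha> \<beta> R .
      assume crit: "R ^ (a - b) \<le> N (poly f \<alpha> - poly f \<beta>) ^ w"
      show "pdiff \<alpha> \<beta> n \<in> polys_over A" by (rule pdiff_in)
      show "degree (pdiff \<alpha> \<beta> n) = ediff n" "N (lead_coeff (pdiff \<alpha> \<beta> n)) > 0"
        using pdiff_degree_lead[OF crit, of n] by linarith+
      show "R * N (poly (pdiff \<alpha> \<beta> n) \<mu>) ^ 1 \<le> N (lead_coeff (pdiff \<alpha> \<beta> n)) ^ 1" if "common \<mu>" for \<mu>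
        by (rule crit_witness_inseparable[OF crit n that])
    qed simp
  next
    case 2
    hence "b > 0" using Q_pos by (simp add: ab_def)
    then obtain n where n: "a * d2 ^ n + Q1 * ediff n \<le> b * d2 ^ n + Q2 * ediff n"
      using ediff_second_term_wins[OF 2(1)] by blast
    show ?thesis
    proof (rule exI[of _ "pdiff \<alpha> \<beta> (Suc n)"], rule exI[of _ "ediff (Suc n)"], rule exI[of _ w], intro conjI allI impI)
      show "ediff (Suc n) > 0" by (rule ediff_Suc_pos)
      show "w > 0" by (rule w_pos)
    next
      fix A N R
      assume "place p l1 l2 s1 s2 c1 c2 f Q1 Q2 d1 d2 a b w A N \<alpha> \<beta> R"
      then interpret place p l1 l2 s1 s2 c1 c2 f Q1 Q2 d1 d2 a b w A N \<alpha> \<beta> R .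
      assume crit: "R ^ (a - b) \<le> N (poly f \<alpha> - poly f \<beta>) ^ w"
      show "pdiff \<alpha> \<beta> (Suc n) \<in> polys_over A" by (rule pdiff_in)
      show "degree (pdiff \<alpha> \<beta> (Suc n)) = ediff (Suc n)" "N (lead_coeff (pdiff \<alpha> \<beta> (Suc n))) > 0"
        using pdiff_degree_lead[OF crit, of "Suc n"] by linarith+
      show "R * N (poly (pdiff \<alpha> \<beta> (Suc n)) \<mu>) ^ w \<le> N (lead_coeff (pdiff \<alpha> \<beta> (Suc n))) ^ w" if "common \<mu>" for \<mu>
        by (rule crit_witness_mixed[OF crit 2(1) n that])
    qed
  next
    case 3
    show ?thesis
    proof (rule exI[of _ "additive_witness \<alpha> \<beta>"], rule exI[of _ "a * Q2"], rule exI[of _ Q2], intro conjI allI impI)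
      show "a * Q2 > 0" "Q2 > 0" using a_pos Q_pos by simp_all
    next
      fix A N R
      assume "place p l1 l2 s1 s2 c1 c2 f Q1 Q2 d1 d2 a b w A N \<alpha> \<beta> R"
      then interpret place p l1 l2 s1 s2 c1 c2 f Q1 Q2 d1 d2 a b w A N \<alpha> \<beta> R .
      assume crit: "R ^ (a - b) \<le> N (poly f \<alpha> - poly f \<beta>) ^ w"
      show "additive_witness \<alpha> \<beta> \<in> polys_over A" by (rule additive_witness_in[OF crit])
      show "degree (additive_witness \<alpha> \<beta>) = a * Q2"
        by (rule additive_witness_lead(1)[OF crit 3])
      show "N (lead_coeff (additive_witness \<alpha> \<beta>)) > 0"
      proof -
        have "0 < N (poly f \<alpha> - poly f \<beta>) ^ Q2" using N_\<delta>_gt_1[OF crit] by simp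
        thus ?thesis using additive_witness_lead(2)[OF crit 3] by (simp only:)
      qed
      show "R * N (poly (additive_witness \<alpha> \<beta>) \<mu>) ^ Q2 \<le> N (lead_coeff (additive_witness \<alpha> \<beta>)) ^ Q2" if "common \<mu>" for \<mu>
        by (rule crit_witness_additive[OF crit 3 that])
    qed
  qed
qed

end

section \<open>From single places to all places\<close>

context family
begin

text \<open>Nonzero constants have size \<open>1\<close> since they and their inverses lie in
  \<open>V\<close>. \<beta> is left free: whether it lies in \<open>A\<close> is settled only later,
  by integrality over \<open>A\<close>.\<close>

lemma place_of_val_ring:
  assumes V: "val_ring V" "Fp_bar \<subseteq> V" "\<alpha> \<notin> V" and c: "c1 \<in> Fp_bar" "c2 \<in> Fp_bar"
  shows "\<exists>A N. val_ring A \<and> V \<subseteq> A \<and> \<alpha> \<in> A \<and> (\<forall>x\<in>V. N x \<le> 1) \<and>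
    (\<forall>\<beta>\<in>A. place p l1 l2 s1 s2 c1 c2 f Q1 Q2 d1 d2 a b w A N \<alpha> \<beta> 2)"
proof -
  obtain A N where AN: "ultranorm A N" "val_ring A" "V \<subseteq> A" "\<alpha> \<in> A" "N \<alpha> = 2" "\<And>x. x \<in> V \<Longrightarrow> N x \<le> 1"
    using val_ring_ultranorm[OF V(1,3)] by blast
  interpret ultranorm A N by (rule AN(1))
  have unit: "u \<in> A \<and> N u = 1" if u: "u \<in> Fp_bar" "u \<noteq> 0" for u
  proof -
    have mem: "u \<in> V" "inverse u \<in> V" using u V Fp_bar_inverse[OF p char u(1)] by auto
    have memA: "u \<in> A" "inverse u \<in> A" using mem AN by auto
    have "N u * N (inverse u) = 1" using N_mult[OF memA] u by simp
    moreover have "N u * N (inverse u) \<le> N u * 1"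
      using AN(6)[OF mem(2)] memA by (intro mult_left_mono) auto
    ultimately show ?thesis using AN(6)[OF mem(1)] memA by simp
  qed
  have of_nat: "of_nat n \<in> (Fp_bar :: 'a set)" for n
    by (rule subring_of_nat[OF subring_Fp_bar[OF p char]])
  have "place p l1 l2 s1 s2 c1 c2 f Q1 Q2 d1 d2 a b w A N \<alpha> \<beta> 2" if "\<beta> \<in> A" for \<beta>
    by unfold_locales (use unit c c_nz of_nat s_of_nat AN that in auto)
  thus ?thesis using AN by blast
qed

text \<open>At a pole of \<mu>, sizes are measured by \<mu> itself, which takes the roles of both
  points of \<open>place\<close>. The first iterate then has the size of \<mu>, whereas
  preperiodicity requires \<mu> to have that size to the power \<open>d2\<close>.\<close>

lemma parameter_integral:
  assumes V: "val_ring V" "Fp_bar \<subseteq> V" and c: "c1 \<in> Fp_bar" "c2 \<in> Fp_bar"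
    and \<alpha>: "\<alpha> \<in> V" "finite (range (orb f \<mu> \<alpha>))"
  shows "\<mu> \<in> V"
proof (rule ccontr)
  assume "\<mu> \<notin> V"
  from place_of_val_ring[OF V this c]
  obtain A N where AN: "V \<subseteq> A" "\<mu> \<in> A" "\<And>x. x \<in> V \<Longrightarrow> N x \<le> 1"
    "place p l1 l2 s1 s2 c1 c2 f Q1 Q2 d1 d2 a b w A N \<mu> \<mu> 2" by blast
  interpret place p l1 l2 s1 s2 c1 c2 f Q1 Q2 d1 d2 a b w A N \<mu> \<mu> 2 by (rule AN(4))
  have \<alpha>A: "\<alpha> \<in> A" using AN \<alpha> by blast
  have "N (poly f \<alpha>) \<le> 1" using AN(3)[OF \<alpha>(1)] by (rule N_poly_f_le_1[OF \<alpha>A])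
  hence "N (poly f \<alpha> + \<mu>) = 2"
    using N_add_eq[OF f_in[OF \<alpha>A] AN(2)] R_def by simp
  hence "N (orb f \<mu> \<alpha> 1) = 2" by simp
  hence "N \<mu> = 2 ^ d2" using preperiodic_norm(2)[OF \<alpha>A AN(2) \<alpha>(2), of 1] by simp
  thus False using R_def d2_gt_1 power_strict_increasing[of 1 d2 "2::real"] by simp
qed

text \<open>At a pole of \<beta> preperiodicity would force the parameter to have size
  \<open>2 ^ d2\<close>, but it is integral.\<close>

lemma point_integral:
  assumes V: "val_ring V" "Fp_bar \<subseteq> V" and c: "c1 \<in> Fp_bar" "c2 \<in> Fp_bar"
    and \<mu>: "\<mu> \<in> V" "finite (range (orb f \<mu> \<beta>))"
  shows "\<beta> \<in> V"
proof (rule ccontr)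
  assume "\<beta> \<notin> V"
  from place_of_val_ring[OF V this c]
  obtain A N where AN: "V \<subseteq> A" "\<beta> \<in> A" "\<And>x. x \<in> V \<Longrightarrow> N x \<le> 1"
    "place p l1 l2 s1 s2 c1 c2 f Q1 Q2 d1 d2 a b w A N \<beta> \<beta> 2" by blast
  interpret place p l1 l2 s1 s2 c1 c2 f Q1 Q2 d1 d2 a b w A N \<beta> \<beta> 2 by (rule AN(4))
  have "N \<mu> = 2 ^ d2"
    using preperiodic_norm(2)[OF AN(2) _ \<mu>(2), of 0] AN(1) \<mu> R_def by auto
  moreover have "N \<mu> \<le> 1" using AN(3) \<mu> by blast
  ultimately show False using d2_gt_1 power_strict_increasing[of 1 d2 "2::real"] by simp
qed

theorem common_infinite_imp:
  assumes c: "c1 \<in> Fp_bar" "c2 \<in> Fp_bar" and \<alpha>: "\<alpha> \<notin> Fp_bar"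
    and inf: "infinite (Prep f \<alpha> \<beta>)"
  shows "poly f \<alpha> = poly f \<beta>"
proof (rule ccontr)
  define \<delta> where "\<delta> = poly f \<alpha> - poly f \<beta>"
  assume "poly f \<alpha> \<noteq> poly f \<beta>"
  hence \<delta>0: "\<delta> \<noteq> 0" by (simp add: \<delta>_def)
  have Prep: "Prep f \<alpha> \<beta> = {\<mu>. finite (range (orb f \<mu> \<alpha>)) \<and> finite (range (orb f \<mu> \<beta>))}"
    by (simp add: Prep_def preperiodic_iff_orb)
  obtain F m e where m: "m > 0" and e: "e > 0" and F: "\<And>A N R.
    place p l1 l2 s1 s2 c1 c2 f Q1 Q2 d1 d2 a b w A N \<alpha> \<beta> R \<Longrightarrow>
    R ^ (a - b) \<le> N (poly f \<alpha> - poly f \<beta>) ^ w \<Longrightarrow>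
    F \<in> polys_over A \<and> degree F = m \<and> N (lead_coeff F) > 0 \<and>
    (\<forall>\<mu>. place.common f A \<alpha> \<beta> \<mu> \<longrightarrow> R * N (poly F \<mu>) ^ e \<le> N (lead_coeff F) ^ e)"
    using crit_witness[of \<alpha> \<beta>] by blast
  define n where "n = 8 * e * d2 * m ^ 2"
  have n: "8 * e * d2 * m ^ 2 \<le> d2 ^ n"
    using power_gt_expt[of d2 n] d2_gt_1 by (simp add: n_def)
  \<comment> \<open>Large enough for both lower bounds of \<open>combination_small\<close> at
    once.\<close>
  define M where "M = 8 * e * d2 ^ 2 * m * d2 ^ n + 4 * e * d2 * m + 3"
  obtain E where E: "finite E" "card E = m * M" "E \<subseteq> Prep f \<alpha> \<beta>"
    using infinite_arbitrarily_large[OF inf] by blast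
  define u where "u = discr E ^ (2 * e) * \<delta> ^ (M * M)"
  have u0: "u \<noteq> 0" using discr_nz[OF E(1)] \<delta>0 by (simp add: u_def)
  have \<mu>V: "E \<subseteq> V" and \<beta>V: "\<beta> \<in> V" if V: "val_ring V" "Fp_bar \<subseteq> V" "\<alpha> \<in> V" for V
  proof -
    show EV: "E \<subseteq> V"
    proof
      fix \<mu> assume "\<mu> \<in> E"
      hence "finite (range (orb f \<mu> \<alpha>))" using E Prep by auto
      thus "\<mu> \<in> V" by (rule parameter_integral[OF V(1,2) c V(3)])
    qed
    have "m * M > 0" using m by (simp add: M_def)
    then obtain \<mu> where \<mu>: "\<mu> \<in> E" using E by (metis card.empty all_not_in_conv less_irrefl)
    hence "finite (range (orb f \<mu> \<beta>))" using E Prep by auto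
    thus "\<beta> \<in> V" by (rule point_integral[OF V(1,2) c subsetD[OF EV \<mu>]])
  qed
  have pole: "inverse u \<notin> V" if V: "val_ring V" "Fp_bar \<subseteq> V" "\<alpha> \<notin> V" for V
  proof
    assume inv: "inverse u \<in> V"
    obtain A N where AN: "val_ring A" "V \<subseteq> A" "\<alpha> \<in> A" "\<And>x. x \<in> V \<Longrightarrow> N x \<le> 1"
      "\<And>\<beta>. \<beta> \<in> A \<Longrightarrow> place p l1 l2 s1 s2 c1 c2 f Q1 Q2 d1 d2 a b w A N \<alpha> \<beta> 2"
      using place_of_val_ring[OF V c] by blast
    have kA: "Fp_bar \<subseteq> A" using V AN by blast
    \<comment> \<open>Integrality is used over \<open>A\<close>, which contains \<alpha>, and not
      over \<open>V\<close>, which does not.\<close>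
    note EA = \<mu>V[OF AN(1) kA AN(3)] and \<beta>A = \<beta>V[OF AN(1) kA AN(3)]
    note pl = AN(5)[OF \<beta>A]
    interpret place p l1 l2 s1 s2 c1 c2 f Q1 Q2 d1 d2 a b w A N \<alpha> \<beta> 2 by (rule pl)
    have "N u < 1"
      unfolding u_def \<delta>_def
    proof (rule combination_small[OF E(1) _ E(2) m e F[OF pl] n])
      show "common \<mu>" if "\<mu> \<in> E" for \<mu>
        using that E(3) EA by (auto simp: common_def Prep)
      show "M > 8 * e * d2 ^ 2 * m * d2 ^ n" "M > 4 * e * d2 * m + 2" by (auto simp: M_def)
    qed
    moreover have uA: "u \<in> A"
      unfolding u_def \<delta>_def by (intro cl(3,4,7) discr_in_subring[OF A EA] f_in AN(3) \<beta>A)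
    moreover have "inverse u \<in> A" "N (inverse u) \<le> 1" using inv AN by auto
    moreover from this uA u0 have "N u * N (inverse u) = 1" by (simp flip: N_mult)
    ultimately show False
      using mult_left_mono[of "N (inverse u)" 1 "N u"] by auto
  qed
  have "u \<in> Fp_bar"
  proof (rule ccontr)
    assume "u \<notin> Fp_bar"
    then obtain V where V: "val_ring V" "Fp_bar \<subseteq> V" "u \<notin> V"
      using val_ring_separates[OF p char] by blast
    note R = val_ring_subring[OF V(1)]
    show False
    proof (cases "\<alpha> \<in> V")
      case True
      have fV: "poly f z \<in> V" if "z \<in> V" for z
        unfolding poly_f using c V that by (intro subring_add[OF R] subring_mult[OF R] subring_power[OF R]) auto
      have "u \<in> V"
        unfolding u_def \<delta>_def using True \<mu>V[OF V(1,2) True] \<beta>V[OF V(1,2) True]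
        by (intro subring_mult[OF R] subring_power[OF R] subring_diff[OF R] discr_in_subring[OF R] fV)
      thus False using V by simp
    next
      case False
      thus False using pole[OF V(1,2) False] val_ring_inverse[OF V(1,3)] by simp
    qed
  qed
  \<comment> \<open>A nonzero constant has its inverse in every \<open>V\<close>, which
    \<open>pole\<close> forbids at a place where \<alpha> has a pole; such a place exists.\<close>
  moreover obtain V where V: "val_ring V" "Fp_bar \<subseteq> V" "\<alpha> \<notin> V"
    using val_ring_separates[OF p char \<alpha>] by blast
  ultimately show False
    using pole[OF V] Fp_bar_inverse[OF p char] by blast
qed

end

context family
begin

section \<open>Infinitely many common parameters\<close>

lemma finite_orbit_Fp_bar:
  assumes "c1 \<in> Fp_bar" "c2 \<in> Fp_bar" "\<mu> \<in> Fp_bar" "z \<in> Fp_bar"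
  shows "finite (range (orb f \<mu> z))"
proof -
  obtain m where m: "m > 0" "\<forall>c\<in>{c1, c2, \<mu>, z}. c ^ (p ^ m) = c"
    using Fp_bar_common_level[OF p char, of "{c1, c2, \<mu>, z}"] assms by auto
  define S where "S = {x::'a. x ^ (p ^ m) = x}"
  have S: "subring S" unfolding S_def by (rule subring_frob_fixed[OF p char])
  have mem: "c1 \<in> S" "c2 \<in> S" "\<mu> \<in> S" "z \<in> S" using m by (auto simp: S_def)
  have "orb f \<mu> z n \<in> S" for n
  proof (induction n)
    case (Suc n)
    show ?case
      unfolding orb_Suc poly_f
      by (intro subring_add[OF S] subring_mult[OF S] subring_power[OF S] mem Suc)
  qed (simp add: mem)
  hence "range (orb f \<mu> z) \<subseteq> S" by blast
  thus ?thesis using finite_frob_fixed[OF p char m(1)] unfolding S_def by (rule finite_subset)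
qed

text \<open>With parameter \<open>0\<close> the iterated map has constant coefficients, so preimages
  of constants are constants.\<close>

lemma Fp_bar_if_orb_0:
  assumes c: "c1 \<in> Fp_bar" "c2 \<in> Fp_bar" and "orb f 0 z n \<in> Fp_bar"
  shows "z \<in> Fp_bar"
  using assms(3)
proof (induction n)
  case (Suc n)
  note k = subring_Fp_bar[OF p char]
  define t where "t = poly f (orb f 0 z n)"
  have t: "t \<in> Fp_bar" using Suc.prems by (simp add: t_def)
  have "f - [:t:] \<in> polys_over Fp_bar"
    unfolding f_def
    by (intro subring_diff[OF subring_polys_over[OF k]] subring_add[OF subring_polys_over[OF k]]
      monom_in_polys_over[OF k] const_in_polys_over[OF k] c t)
  moreover have "coeff (f - [:t:]) d2 = c2"
    using d_less by (cases d2) (auto simp: f_def coeff_monom)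
  hence "f - [:t:] \<noteq> 0" using c_nz by (metis coeff_0)
  moreover have "poly (f - [:t:]) (orb f 0 z n) = 0" by (simp add: t_def)
  ultimately show ?case using Suc.IH Fp_bar_closed[OF p char] by blast
qed simp

lemma degree_param_orb_diff: "degree (param_orb f z (Suc n) - param_orb f z n) = d2 ^ n"
proof -
  have "degree (param_orb f z n) < d2 ^ n"
  proof (cases n)
    case (Suc m)
    thus ?thesis using param_orb_degree(1)[of z m] d2_gt_1 by simp
  qed (simp)
  hence "degree (- param_orb f z n) < degree (param_orb f z (Suc n))"
    unfolding param_orb_degree(1) by simp
  from degree_add_eq_left[OF this] show ?thesis
    unfolding param_orb_degree(1) by simp
qed

end

locale family_closed = family p l1 l2 s1 s2 c1 c2 f Q1 Q2 d1 d2 a b w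
  for p l1 l2 s1 s2 :: nat and c1 c2 :: "'a::alg_closed_field" and f :: "'a poly"
    and Q1 Q2 d1 d2 a b w :: nat
begin

text \<open>
  The factor \<open>G\<close> collects the parameters for which \<open>\<alpha>\<close> lands on a fixed point at step
  \<open>n + 1\<close>; those for which it already does at step \<open>n\<close> would be critical, hence \<open>0\<close>.
\<close>

lemma exists_exact_preperiod:
  assumes c: "c1 \<in> Fp_bar" "c2 \<in> Fp_bar" and z: "z \<notin> Fp_bar"
  shows "\<exists>\<mu>. orb f \<mu> z (Suc (Suc n)) = orb f \<mu> z (Suc n) \<and> orb f \<mu> z (Suc n) \<noteq> orb f \<mu> z n"
proof -
  define P S where "P = param_orb f z (Suc n)" and "S = param_orb f z n"
  define T where "T s = (\<Sum>i<s. S ^ (s - Suc i) * P ^ i)" for s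
  define G where "G = smult c1 (T s1 ^ Q1) + smult c2 ((P - S) ^ w * T s2 ^ Q2)"
  have T: "P ^ s - S ^ s = (P - S) * T s" for s
    unfolding T_def by (rule power_diff_sumr2)
  have eq: "param_orb f z (Suc (Suc n)) - param_orb f z (Suc n) = (P - S) ^ Q1 * G"
  proof -
    have "param_orb f z (Suc (Suc n)) - param_orb f z (Suc n) = pcompose f P - pcompose f S"
      by (simp add: P_def S_def)
    also have "\<dots> = smult c1 ((P - S) ^ Q1 * T s1 ^ Q1) + smult c2 ((P - S) ^ (Q1 + w) * T s2 ^ Q2)"
      unfolding pcompose_f_diff T power_mult_distrib using Q2_eq by simp
    finally show ?thesis by (simp add: G_def algebra_simps power_add)
  qed
  have dPS: "degree (P - S) = d2 ^ n" unfolding P_def S_def by (rule degree_param_orb_diff)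
  have nz: "(P - S) ^ Q1 * G \<noteq> 0"
  proof
    assume "(P - S) ^ Q1 * G = 0"
    hence "d2 ^ Suc n = degree (0 :: 'a poly)"
      using degree_param_orb_diff[of z "Suc n"] unfolding eq by (simp only:)
    thus False using d2_gt_1 by simp
  qed
  hence "degree ((P - S) ^ Q1 * G) = degree ((P - S) ^ Q1) + degree G"
    by (intro degree_mult_eq) auto
  moreover have "degree ((P - S) ^ Q1) = Q1 * d2 ^ n"
  proof -
    have "P - S \<noteq> 0" using nz Q_pos by (auto simp: power_0_left)
    from degree_power_eq[OF this] show ?thesis by (simp only: dPS)
  qed
  \<comment> \<open>Comparing degrees in \<open>eq\<close> leaves a positive degree for
    \<open>G\<close>, hence a root, as the field is algebraically closed.\<close>
  ultimately have "d2 ^ Suc n = Q1 * d2 ^ n + degree G"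
    using degree_param_orb_diff[of z "Suc n"] unfolding eq by (simp only:)
  moreover have "Q1 < d2" using d_eq d_less by linarith
  hence "Q1 * d2 ^ n < d2 ^ Suc n" using d2_gt_1 by simp
  ultimately have "degree G > 0" by linarith
  then obtain \<mu> where \<mu>: "poly G \<mu> = 0" using alg_closed_imp_poly_has_root by blast
  have "poly (param_orb f z (Suc (Suc n)) - param_orb f z (Suc n)) \<mu> = 0"
    unfolding eq by (simp add: \<mu>)
  hence 1: "orb f \<mu> z (Suc (Suc n)) = orb f \<mu> z (Suc n)"
    unfolding poly_diff poly_param_orb by simp
  have 2: "orb f \<mu> z (Suc n) \<noteq> orb f \<mu> z n"
  proof
    assume same: "orb f \<mu> z (Suc n) = orb f \<mu> z n"
    define x where "x = orb f \<mu> z n"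
    have PS: "poly P \<mu> = x" "poly S \<mu> = x"
      unfolding P_def S_def poly_param_orb x_def by (rule same, rule refl)
    \<comment> \<open>Where \<open>P\<close> and \<open>S\<close> agree, \<open>T s\<close> takes
      its diagonal value, and the second term of \<open>G\<close> vanishes because
      \<open>w > 0\<close>. So \<open>G = 0\<close> says that \<open>x\<close> is a critical point,
      which is \<open>0\<close> because \<open>s1 > 1\<close>.\<close>
    have "poly (T s) \<mu> = of_nat s * x ^ (s - 1)" for s
    proof -
      have "poly (T s) \<mu> = (\<Sum>i<s. x ^ (s - 1))"
        unfolding T_def poly_sum by (intro sum.cong refl) (simp add: PS flip: power_add)
      thus ?thesis by simp
    qed
    hence "c1 * (of_nat s1 * x ^ (s1 - 1)) ^ Q1 = 0"
      using \<mu> w_pos by (simp add: G_def PS power_0_left)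
    hence "x = 0" using c_nz s_of_nat by simp
    moreover have "x = poly f x + \<mu>" using same by (simp add: x_def)
    moreover have "d1 \<noteq> 0" "d2 \<noteq> 0" using d_eq a_pos d2_gt_1 by linarith+
    ultimately have "\<mu> = 0" by (simp add: poly_f power_0_left)
    hence "orb f 0 z n \<in> Fp_bar"
      using \<open>x = 0\<close> subring_0[OF subring_Fp_bar[OF p char]] by (simp add: x_def)
    thus False using Fp_bar_if_orb_0[OF c] z by blast
  qed
  show ?thesis using 1 2 by blast
qed

text \<open>The parameters obtained for different \<open>n\<close> differ: for \<mu> with index
  \<open>m\<close> the orbit is constant from step \<open>m + 1\<close> on, while for a larger index
  \<open>n\<close> it still moves from step \<open>n\<close> to \<open>n + 1\<close>.\<close>

lemma infinite_preperiodic_parameters: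
  assumes c: "c1 \<in> Fp_bar" "c2 \<in> Fp_bar" and z: "z \<notin> Fp_bar"
  shows "infinite {\<mu>. finite (range (orb f \<mu> z))}"
proof -
  obtain \<mu> where \<mu>: "orb f (\<mu> n) z (Suc (Suc n)) = orb f (\<mu> n) z (Suc n)"
      "orb f (\<mu> n) z (Suc n) \<noteq> orb f (\<mu> n) z n" for n
    using exists_exact_preperiod[OF assms] by metis
  have const: "orb f (\<mu> n) z (Suc n + k) = orb f (\<mu> n) z (Suc n)" for n k
  proof (induction k)
    case (Suc k)
    have "orb f (\<mu> n) z (Suc n + Suc k) = poly f (orb f (\<mu> n) z (Suc n + k)) + \<mu> n" by simp
    also have "\<dots> = orb f (\<mu> n) z (Suc (Suc n))" unfolding Suc by simp
    finally show ?case using \<mu>(1) by simp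
  qed simp
  have "inj \<mu>"
  proof (rule linorder_injI)
    fix m n :: nat assume "m < n"
    then obtain k where n: "n = Suc m + k" using less_iff_Suc_add by auto
    show "\<mu> m \<noteq> \<mu> n"
      using \<mu>(2)[of n] const[of m k] const[of m "Suc k"] unfolding n by (metis add_Suc_right)
  qed
  moreover have "range \<mu> \<subseteq> {\<mu>. finite (range (orb f \<mu> z))}"
  proof safe
    fix n
    have "range (orb f (\<mu> n) z) \<subseteq> orb f (\<mu> n) z ` {..Suc n}"
    proof safe
      fix k
      show "orb f (\<mu> n) z k \<in> orb f (\<mu> n) z ` {..Suc n}"
      proof (cases "k \<le> Suc n")
        case False
        hence "orb f (\<mu> n) z k = orb f (\<mu> n) z (Suc n)" using const[of n "k - Suc n"] by simp
        thus ?thesis by blast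
      qed blast
    qed
    thus "finite (range (orb f (\<mu> n) z))" by (rule finite_subset) simp
  qed
  ultimately show ?thesis using infinite_super range_inj_infinite by blast
qed

end

theorem theorem1p4:
  fixes p :: nat and L :: "'a::alg_closed_field set"
    and f :: "'a poly" and c1 c2 \<alpha> \<beta> :: 'a
    and d1 d2 l1 l2 s1 s2 :: nat
  assumes "prime p"
    and "is_algebraic_closure_of TYPE('a) L"
    and "CHAR('a) = p"
    and "c1 \<in> Fp_bar" "c1 \<noteq> 0"
    and "c2 \<in> Fp_bar" "c2 \<noteq> 0"
    and "1 \<le> d1" "d1 < d2"
    and "f = monom c1 d1 + monom c2 d2"
    and "d1 = p ^ l1 * s1" "\<not> p dvd s1"
    and "d2 = p ^ l2 * s2" "\<not> p dvd s2"
    and "p ^ l2 * (s2 - 1) < p ^ l1 * (s1 - 1)"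
    and "\<alpha> \<in> L" "\<beta> \<in> L"
  shows "infinite (Prep f \<alpha> \<beta>) \<longleftrightarrow>
           (\<alpha> \<in> Fp_bar \<and> \<beta> \<in> Fp_bar) \<or> poly f \<alpha> = poly f \<beta>"
proof -
  interpret family_closed p l1 l2 s1 s2 c1 c2 f "p ^ l1" "p ^ l2" d1 d2
    "p ^ l1 * (s1 - 1)" "p ^ l2 * (s2 - 1)" "p ^ l2 - p ^ l1"
    by unfold_locales (use assms in auto)
  note c = assms(4,6)
  have Prep: "Prep f x y = {\<mu>. finite (range (orb f \<mu> x)) \<and> finite (range (orb f \<mu> y))}" for x y
    by (simp add: Prep_def preperiodic_iff_orb)
  \<comment> \<open>Every constant parameter works, since all data then lie in one finite
    ring.\<close>
  have both: "infinite (Prep f \<alpha> \<beta>)" if "\<alpha> \<in> Fp_bar" "\<beta> \<in> Fp_bar"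
  proof -
    have "Fp_bar \<subseteq> Prep f \<alpha> \<beta>"
      using finite_orbit_Fp_bar[OF c] that by (auto simp: Prep)
    thus ?thesis using infinite_Fp_bar[OF assms(1,3)] infinite_super by blast
  qed
  have swap: "Prep f \<alpha> \<beta> = Prep f \<beta> \<alpha>" by (auto simp: Prep)
  \<comment> \<open>Equal images make the two orbits coincide from step \<open>1\<close> on.\<close>
  have tail: "finite (range (orb f \<mu> y))"
    if "poly f x = poly f y" "finite (range (orb f \<mu> x))" for x y \<mu>
  proof -
    have "orb f \<mu> y (Suc n) = orb f \<mu> x (Suc n)" for n
      by (induction n) (use that in auto)
    hence "orb f \<mu> y n \<in> insert y (range (orb f \<mu> x))" for n
      by (cases n) (auto simp del: orb_Suc)
    hence "range (orb f \<mu> y) \<subseteq> insert y (range (orb f \<mu> x))" by blast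
    thus ?thesis using that(2) finite_subset by blast
  qed
  have collide: "infinite (Prep f x y)" if "poly f x = poly f y" "x \<notin> Fp_bar" for x y
  proof -
    have "Prep f x y = {\<mu>. finite (range (orb f \<mu> x))}"
      using tail[OF that(1)] by (auto simp: Prep)
    thus ?thesis using infinite_preperiodic_parameters[OF c that(2)] by simp
  qed
  show ?thesis
  proof
    assume inf: "infinite (Prep f \<alpha> \<beta>)"
    \<comment> \<open>If not both points are constant, one of them is transcendental over the
      constants; when it is \<beta>, the roles are exchanged by \<open>swap\<close>.\<close>
    show "(\<alpha> \<in> Fp_bar \<and> \<beta> \<in> Fp_bar) \<or> poly f \<alpha> = poly f \<beta>"
      using common_infinite_imp[OF c _ inf] common_infinite_imp[OF c, of \<beta> \<alpha>] inf swap by metis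
  next
    assume "(\<alpha> \<in> Fp_bar \<and> \<beta> \<in> Fp_bar) \<or> poly f \<alpha> = poly f \<beta>"
    thus "infinite (Prep f \<alpha> \<beta>)"
      using both collide[of \<alpha> \<beta>] collide[of \<beta> \<alpha>] swap by metis
  qed
qed

end
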